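(* Let $n\in\{1,2,\dots,\infty\}$ and let $\beta^n$ be the even Clifford flow of rank $n$. Then the gauge index $\dim G(\beta^n)$ is $0$.
   Context: An $E_0$-semigroup on a von Neumann algebra $\mathrm{M}$ is a semigroup $(\alpha_t)_{t\ge 0}$ of normal unital $*$-endomorphisms of $\mathrm{M}$ with $\alpha_0=\mathrm{id}$, $\alpha_t(\mathrm{M})\ne \mathrm{M}$ for all $t>0$, and $t\mapsto\rho(\alpha_t(x))$ continuous for all $x\in\mathrm{M}$, $\rho\in\mathrm{M}_*$. A cocycle for $\alpha$ is a strongly continuous family of unitaries $(U_t)_{t\ge0}$ in $\mathrm{M}$ with $U_s\alpha_s(U_t)=U_{s+t}$ for all $s,t\ge 0$. Gauge index: for $\alpha$ on a $\mathrm{II}_1$ factor $\mathrm{M}$ with trace $\tau$, a gauge cocycle is a cocycle $U$ with $U_t\in\mathrm{M}\cap\alpha_t(\mathrm{M})'$ for all $t\ge0$; the gauge cocycles form a group $G(\alpha)$ under $(UV)_t=U_tV_t$. For $U,V\in G(\alpha)$ there is a unique $c_*(U,V)\in\mathbb{C}$ with $\tau(U_t^*V_t)=e^{c_*(U,V)t}$ for all $t\ge0$. The form $\langle f,g\rangle=\sum_{U,V}c_*(U,V)\overline{f(U)}g(V)$ is positive semidefinite on the space of finitely supported functions $f:G(\alpha)\to\mathbb{C}$ with $\sum_Uf(U)=0$; $H(G(\alpha))$ is the Hilbert space obtained by quotienting by null vectors and completing, and $\dim G(\alpha):=\dim H(G(\alpha))$. Even Clifford flow: let $\mathrm{k}$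 be a separable real Hilbert space of dimension $n$ with complexification $\mathrm{k}^{\mathbb{C}}$, and let $\Gamma_a$ be the antisymmetric Fock space over $L^2(\mathbb{R}_+;\mathrm{k}^{\mathbb{C}})$ with vacuum $\Omega$. Let $a^*(f)$ be the fermionic creation operators, $a^*(f)\Omega=f$, $a^*(f)(\xi_1\wedge\dots\wedge\xi_m)=f\wedge\xi_1\wedge\dots\wedge\xi_m$ (satisfying the canonical anticommutation relations), $a(f)=a^*(f)^*$, and $u(f)=(a(f)+a^*(f))/\sqrt2$ for $f\in L^2(\mathbb{R}_+;\mathrm{k})$. The von Neumann algebra $\mathcal{R}=\{u(f)\}''$ is the hyperfinite $\mathrm{II}_1$ factor with trace vector $\Omega$. With $(T_t)$ the unilateral shift semigroup, $(T_tf)(s)=0$ for $s<t$ and $f(s-t)$ for $s\ge t$, the Clifford flow of rank $n$ is the $E_0$-semigroup $\alpha^n$ on $\mathcal{R}$ with $\alpha^n_t(u(f_1)\cdots u(f_k))=u(T_tf_1)\cdots u(T_tf_k)$. The von Neumann algebra $\mathcal{R}_e$ generated by the even products $u(f_1)\cdots u(f_{2m})$ is also the hyperfinite $\mathrm{II}_1$ factor, and the even Clifford flow of rank $n$, $\beta^n$, is the restriction of $\alpha^n$ to $\mathcal{R}_e$. *)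

theory Defs
  imports "HOL-Analysis.Analysis" "HOL-Library.Extended_Nat" "HOL-Combinatorics.Permutations"
begin

section \<open>Complex Hilbert spaces and their operators\<close>

text \<open>The inner product is linear in the second argument.\<close>

class complex_hilbert_space = banach +
  fixes scaleC :: "complex \<Rightarrow> 'a \<Rightarrow> 'a"  (infixr "*\<^sub>C" 75)
    and cinner :: "'a \<Rightarrow> 'a \<Rightarrow> complex"
  assumes scaleC_add_right: "c *\<^sub>C (x + y) = c *\<^sub>C x + c *\<^sub>C y"
    and scaleC_add_left: "(c + d) *\<^sub>C x = c *\<^sub>C x + d *\<^sub>C x"
    and scaleC_scaleC: "c *\<^sub>C (d *\<^sub>C x) = (c * d) *\<^sub>C x"
    and scaleC_of_real: "complex_of_real r *\<^sub>C x = r *\<^sub>R x"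
    and cinner_commute: "cinner x y = cnj (cinner y x)"
    and cinner_add_right: "cinner x (y + z) = cinner x y + cinner x z"
    and cinner_scaleC_right: "cinner x (c *\<^sub>C y) = c * cinner x y"
    and cinner_self: "cinner x x = complex_of_real ((norm x)\<^sup>2)"

interpretation complex_vector: vector_space "scaleC :: complex \<Rightarrow> 'a \<Rightarrow> 'a::complex_hilbert_space"
proof
  show "1 *\<^sub>C x = x" for x :: 'a
    using scaleC_of_real[of 1 x] by simp
qed (simp_all add: scaleC_add_right scaleC_add_left scaleC_scaleC)

definition bounded_operators :: "('h::complex_hilbert_space \<Rightarrow> 'h) set" where
  "bounded_operators = {A. bounded_linear A \<and> (\<forall>c x. A (c *\<^sub>C x) = c *\<^sub>C A x)}"

definition hilbert_adjoint :: "('h::complex_hilbert_space \<Rightarrow> 'h) \<Rightarrow> 'h \<Rightarrow> 'h" where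
  "hilbert_adjoint A =
    (THE B. B \<in> bounded_operators \<and> (\<forall>x y. cinner (B x) y = cinner x (A y)))"

definition unitary_operator :: "('h::complex_hilbert_space \<Rightarrow> 'h) \<Rightarrow> bool" where
  "unitary_operator A \<longleftrightarrow>
    A \<in> bounded_operators \<and> hilbert_adjoint A \<circ> A = id \<and> A \<circ> hilbert_adjoint A = id"

definition commutant :: "('h::complex_hilbert_space \<Rightarrow> 'h) set \<Rightarrow> ('h \<Rightarrow> 'h) set" where
  "commutant S = {A \<in> bounded_operators. \<forall>B\<in>S. A \<circ> B = B \<circ> A}"

definition von_neumann_algebra :: "('h::complex_hilbert_space \<Rightarrow> 'h) set \<Rightarrow> bool" where
  "von_neumann_algebra M \<longleftrightarrow>
    M \<subseteq> bounded_operators \<and> (\<forall>A\<in>M. hilbert_adjoint A \<in> M) \<and> commutant (commutant M) = M"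

text \<open>
  The predual of \<open>M\<close>, as the set of \<open>\<sigma>\<close>-weakly continuous functionals on \<open>M\<close>.  Only the values
  on \<open>M\<close> of these functions, and of the maps \<open>\<theta>\<close> and \<open>\<alpha> t\<close> below, are ever used.
\<close>

definition predual ::
    "('h::complex_hilbert_space \<Rightarrow> 'h) set \<Rightarrow> (('h \<Rightarrow> 'h) \<Rightarrow> complex) set" where
  "predual M = {\<rho>. \<exists>\<xi> \<eta> :: nat \<Rightarrow> 'h.
     summable (\<lambda>i. (norm (\<xi> i))\<^sup>2) \<and> summable (\<lambda>i. (norm (\<eta> i))\<^sup>2) \<and>
     (\<forall>A\<in>M. \<rho> A = (\<Sum>i. cinner (\<xi> i) (A (\<eta> i))))}"

definition normal_unital_star_endomorphism ::
    "('h::complex_hilbert_space \<Rightarrow> 'h) set \<Rightarrow> (('h \<Rightarrow> 'h) \<Rightarrow> 'h \<Rightarrow> 'h) \<Rightarrow> bool" where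
  "normal_unital_star_endomorphism M \<theta> \<longleftrightarrow>
    \<theta> ` M \<subseteq> M \<and>
    (\<forall>A\<in>M. \<forall>B\<in>M. \<theta> (\<lambda>x. A x + B x) = (\<lambda>x. \<theta> A x + \<theta> B x)) \<and>
    (\<forall>c. \<forall>A\<in>M. \<theta> (\<lambda>x. c *\<^sub>C A x) = (\<lambda>x. c *\<^sub>C \<theta> A x)) \<and>
    (\<forall>A\<in>M. \<forall>B\<in>M. \<theta> (A \<circ> B) = \<theta> A \<circ> \<theta> B) \<and>
    (\<forall>A\<in>M. \<theta> (hilbert_adjoint A) = hilbert_adjoint (\<theta> A)) \<and>
    \<theta> id = id \<and>
    (\<forall>\<rho>\<in>predual M. (\<lambda>A. \<rho> (\<theta> A)) \<in> predual M)"

definition E0_semigroup ::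
    "('h::complex_hilbert_space \<Rightarrow> 'h) set \<Rightarrow> (real \<Rightarrow> ('h \<Rightarrow> 'h) \<Rightarrow> 'h \<Rightarrow> 'h) \<Rightarrow> bool" where
  "E0_semigroup M \<alpha> \<longleftrightarrow>
    von_neumann_algebra M \<and>
    (\<forall>t\<ge>0. normal_unital_star_endomorphism M (\<alpha> t)) \<and>
    (\<forall>A\<in>M. \<alpha> 0 A = A) \<and>
    (\<forall>s\<ge>0. \<forall>t\<ge>0. \<forall>A\<in>M. \<alpha> (s + t) A = \<alpha> s (\<alpha> t A)) \<and>
    (\<forall>t>0. \<alpha> t ` M \<noteq> M) \<and>
    (\<forall>A\<in>M. \<forall>\<rho>\<in>predual M. continuous_on {0..} (\<lambda>t. \<rho> (\<alpha> t A)))"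


section \<open>Hilbert dimension and Hilbert space completion\<close>

definition orthonormal :: "('v \<Rightarrow> 'v \<Rightarrow> 's::zero_neq_one) \<Rightarrow> 'v set \<Rightarrow> bool" where
  "orthonormal ip S \<longleftrightarrow> (\<forall>x\<in>S. \<forall>y\<in>S. ip x y = (if x = y then 1 else 0))"

text \<open>An orthonormal basis of a Hilbert space is a maximal orthonormal set.\<close>

definition orthonormal_basis :: "'v set \<Rightarrow> ('v \<Rightarrow> 'v \<Rightarrow> 's::zero_neq_one) \<Rightarrow> 'v set \<Rightarrow> bool" where
  "orthonormal_basis H ip S \<longleftrightarrow>
    S \<subseteq> H \<and> orthonormal ip S \<and> (\<forall>S'. S \<subseteq> S' \<and> S' \<subseteq> H \<and> orthonormal ip S' \<longrightarrow> S' = S)"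

definition hilbert_dim :: "'v set \<Rightarrow> ('v \<Rightarrow> 'v \<Rightarrow> 's::zero_neq_one) \<Rightarrow> enat" where
  "hilbert_dim H ip =
    (THE d. \<exists>S. orthonormal_basis H ip S \<and> d = (if finite S then enat (card S) else \<infinity>))"

text \<open>
  Completion of the quotient by null vectors of a space \<open>V\<close> with a positive semidefinite form \<open>b\<close>:
  classes of Cauchy sequences modulo sequences whose seminorm tends to \<open>0\<close>.
\<close>

definition form_seminorm :: "('v \<Rightarrow> 'v \<Rightarrow> complex) \<Rightarrow> 'v \<Rightarrow> real" where
  "form_seminorm b v = sqrt (Re (b v v))"

definition form_cauchy ::
    "('v::minus) set \<Rightarrow> ('v \<Rightarrow> 'v \<Rightarrow> complex) \<Rightarrow> (nat \<Rightarrow> 'v) set" where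
  "form_cauchy V b = {X. range X \<subseteq> V \<and>
     (\<forall>e>0. \<exists>N. \<forall>m\<ge>N. \<forall>n\<ge>N. form_seminorm b (X m - X n) < e)}"

definition form_completion ::
    "('v::minus) set \<Rightarrow> ('v \<Rightarrow> 'v \<Rightarrow> complex) \<Rightarrow> (nat \<Rightarrow> 'v) set set" where
  "form_completion V b = form_cauchy V b //
     {(X, Y). X \<in> form_cauchy V b \<and> Y \<in> form_cauchy V b \<and>
              (\<lambda>m. form_seminorm b (X m - Y m)) \<longlonglongrightarrow> 0}"

definition completion_inner ::
    "('v \<Rightarrow> 'v \<Rightarrow> complex) \<Rightarrow> (nat \<Rightarrow> 'v) set \<Rightarrow> (nat \<Rightarrow> 'v) set \<Rightarrow> complex" where
  "completion_inner b \<xi> \<eta> = (THE z. \<forall>X\<in>\<xi>. \<forall>Y\<in>\<eta>. (\<lambda>m. b (X m) (Y m)) \<longlonglongrightarrow> z)"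


section \<open>Gauge cocycles and the gauge index\<close>

text \<open>
  A family indexed by \<open>t \<ge> 0\<close> is a function on \<open>real\<close> that is \<open>undefined\<close> at negative arguments, so
  that equality of functions is equality of families.
\<close>

definition cocycles ::
    "('h::complex_hilbert_space \<Rightarrow> 'h) set \<Rightarrow> (real \<Rightarrow> ('h \<Rightarrow> 'h) \<Rightarrow> 'h \<Rightarrow> 'h) \<Rightarrow>
      (real \<Rightarrow> 'h \<Rightarrow> 'h) set" where
  "cocycles M \<alpha> = {U \<in> {0..} \<rightarrow>\<^sub>E M.
     (\<forall>t\<ge>0. unitary_operator (U t)) \<and>
     (\<forall>x. continuous_on {0..} (\<lambda>t. U t x)) \<and>
     (\<forall>s\<ge>0. \<forall>t\<ge>0. U s \<circ> \<alpha> s (U t) = U (s + t))}"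

definition gauge_group ::
    "('h::complex_hilbert_space \<Rightarrow> 'h) set \<Rightarrow> (real \<Rightarrow> ('h \<Rightarrow> 'h) \<Rightarrow> 'h \<Rightarrow> 'h) \<Rightarrow>
      (real \<Rightarrow> 'h \<Rightarrow> 'h) set" where
  "gauge_group M \<alpha> = {U \<in> cocycles M \<alpha>. \<forall>t\<ge>0. U t \<in> M \<inter> commutant (\<alpha> t ` M)}"

definition gauge_covariance ::
    "(('h \<Rightarrow> 'h) \<Rightarrow> complex) \<Rightarrow>
      (real \<Rightarrow> 'h \<Rightarrow> 'h) \<Rightarrow> (real \<Rightarrow> 'h::complex_hilbert_space \<Rightarrow> 'h) \<Rightarrow> complex" where
  "gauge_covariance \<tau> U V =
    (THE c. \<forall>t\<ge>0. \<tau> (hilbert_adjoint (U t) \<circ> V t) = exp (c * complex_of_real t))"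

definition sum_zero_functions :: "'a set \<Rightarrow> ('a \<Rightarrow> complex) set" where
  "sum_zero_functions G =
    {f. finite {x. f x \<noteq> 0} \<and> {x. f x \<noteq> 0} \<subseteq> G \<and> (\<Sum>x | f x \<noteq> 0. f x) = 0}"

definition covariance_form ::
    "('a \<Rightarrow> 'a \<Rightarrow> complex) \<Rightarrow> ('a \<Rightarrow> complex) \<Rightarrow> ('a \<Rightarrow> complex) \<Rightarrow> complex" where
  "covariance_form c f g =
    (\<Sum>x | f x \<noteq> 0. \<Sum>y | g y \<noteq> 0. c x y * cnj (f x) * g y)"

definition gauge_index ::
    "('h::complex_hilbert_space \<Rightarrow> 'h) set \<Rightarrow> (('h \<Rightarrow> 'h) \<Rightarrow> complex) \<Rightarrow>
      (real \<Rightarrow> ('h \<Rightarrow> 'h) \<Rightarrow> 'h \<Rightarrow> 'h) \<Rightarrow> enat" where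
  "gauge_index M \<tau> \<alpha> =
    (let b = covariance_form (gauge_covariance \<tau>)
     in hilbert_dim (form_completion (sum_zero_functions (gauge_group M \<alpha>)) b)
          (completion_inner b))"


section \<open>Antisymmetric Fock space and the even Clifford flow\<close>

text \<open>
  Vectors of \<open>L\<^sup>2(\<real>\<^sub>+; \<dots>)\<close> are represented by functions on \<open>real\<close>, whose values at negative arguments
  are irrelevant; almost everywhere equal functions have the same image under every map below.
\<close>

abbreviation halfline :: "real measure" where
  "halfline \<equiv> restrict_space lborel {0..}"

definition L2_halfline :: "(real \<Rightarrow> 'v::real_normed_vector) set" where
  "L2_halfline = {f. f \<in> borel_measurable halfline \<and> integrable halfline (\<lambda>s. (norm (f s))\<^sup>2)}"

text \<open>
  The complexification of the real Hilbert space \<open>'k\<close> is \<open>'k \<times> 'k\<close>, the pair \<open>(x, y)\<close> standing for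
  \<open>x + \<i>y\<close>; the product norm is the norm of the following complex inner product.
\<close>

definition complexified_inner :: "'k::real_inner \<times> 'k \<Rightarrow> 'k \<times> 'k \<Rightarrow> complex" where
  "complexified_inner v w =
    Complex (fst v \<bullet> fst w + snd v \<bullet> snd w) (fst v \<bullet> snd w - snd v \<bullet> fst w)"

definition L2_inner ::
    "(real \<Rightarrow> 'k::real_inner \<times> 'k) \<Rightarrow> (real \<Rightarrow> 'k \<times> 'k) \<Rightarrow> complex" where
  "L2_inner f g = (LINT s|halfline. complexified_inner (f s) (g s))"

definition gram_determinant ::
    "(real \<Rightarrow> 'k::real_inner \<times> 'k) list \<Rightarrow> (real \<Rightarrow> 'k \<times> 'k) list \<Rightarrow> complex" where
  "gram_determinant fs gs =
    (\<Sum>p | p permutes {..<length fs}.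
       of_int (sign p) * (\<Prod>i<length fs. L2_inner (fs ! i) (gs ! p i)))"

text \<open>
  \<open>'h\<close> is the antisymmetric Fock space over \<open>L\<^sup>2(\<real>\<^sub>+; 'k \<times> 'k)\<close>, with \<open>W [f\<^sub>1, \<dots>, f\<^sub>m]\<close> the vector
  \<open>f\<^sub>1 \<and> \<dots> \<and> f\<^sub>m\<close> and \<open>W []\<close> the vacuum \<open>\<Omega>\<close>: that is, \<open>'h\<close> is the Hilbert space direct sum over \<open>m\<close>
  of the completed exterior powers with \<open>\<langle>f\<^sub>1 \<and> \<dots> \<and> f\<^sub>m, g\<^sub>1 \<and> \<dots> \<and> g\<^sub>m\<rangle> = det (\<langle>f\<^sub>i, g\<^sub>j\<rangle>)\<close>.
  Multilinearity and antisymmetry of \<open>W\<close> follow from the formula for the inner product.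
\<close>

definition antisymmetric_fock_space ::
    "((real \<Rightarrow> 'k::real_inner \<times> 'k) list \<Rightarrow> 'h::complex_hilbert_space) \<Rightarrow> bool" where
  "antisymmetric_fock_space W \<longleftrightarrow>
    (\<forall>fs \<in> lists L2_halfline. \<forall>gs \<in> lists L2_halfline.
       cinner (W fs) (W gs) = (if length fs = length gs then gram_determinant fs gs else 0)) \<and>
    closure (complex_vector.span (W ` lists L2_halfline)) = UNIV"

definition creation_operator ::
    "((real \<Rightarrow> 'k::real_inner \<times> 'k) list \<Rightarrow> 'h::complex_hilbert_space) \<Rightarrow>
      (real \<Rightarrow> 'k \<times> 'k) \<Rightarrow> 'h \<Rightarrow> 'h" where
  "creation_operator W f =
    (THE A. A \<in> bounded_operators \<and> (\<forall>gs \<in> lists L2_halfline. A (W gs) = W (f # gs)))"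

definition clifford_generator ::
    "((real \<Rightarrow> 'k::real_inner \<times> 'k) list \<Rightarrow> 'h::complex_hilbert_space) \<Rightarrow>
      (real \<Rightarrow> 'k) \<Rightarrow> 'h \<Rightarrow> 'h" where
  "clifford_generator W f =
    (let a = creation_operator W (\<lambda>s. (f s, 0))
     in (\<lambda>x. (1 / sqrt 2) *\<^sub>R (hilbert_adjoint a x + a x)))"

definition clifford_product ::
    "((real \<Rightarrow> 'k::real_inner \<times> 'k) list \<Rightarrow> 'h::complex_hilbert_space) \<Rightarrow>
      (real \<Rightarrow> 'k) list \<Rightarrow> 'h \<Rightarrow> 'h" where
  "clifford_product W fs = foldr (\<circ>) (map (clifford_generator W) fs) id"

definition clifford_algebra ::
    "((real \<Rightarrow> 'k::real_inner \<times> 'k) list \<Rightarrow> 'h::complex_hilbert_space) \<Rightarrow> ('h \<Rightarrow> 'h) set" where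
  "clifford_algebra W = commutant (commutant (clifford_generator W ` L2_halfline))"

text \<open>The even products form a self-adjoint set, so they generate their bicommutant.\<close>

definition even_clifford_algebra ::
    "((real \<Rightarrow> 'k::real_inner \<times> 'k) list \<Rightarrow> 'h::complex_hilbert_space) \<Rightarrow> ('h \<Rightarrow> 'h) set" where
  "even_clifford_algebra W =
    commutant (commutant (clifford_product W ` {fs \<in> lists L2_halfline. even (length fs)}))"

definition vacuum_trace ::
    "((real \<Rightarrow> 'k::real_inner \<times> 'k) list \<Rightarrow> 'h::complex_hilbert_space) \<Rightarrow>
      ('h \<Rightarrow> 'h) \<Rightarrow> complex" where
  "vacuum_trace W A = cinner (W []) (A (W []))"

definition shift :: "real \<Rightarrow> (real \<Rightarrow> 'v::zero) \<Rightarrow> real \<Rightarrow> 'v" where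
  "shift t f = (\<lambda>s. if s < t then 0 else f (s - t))"

definition clifford_flow ::
    "((real \<Rightarrow> 'k::real_inner \<times> 'k) list \<Rightarrow> 'h::complex_hilbert_space) \<Rightarrow>
      (real \<Rightarrow> ('h \<Rightarrow> 'h) \<Rightarrow> 'h \<Rightarrow> 'h) \<Rightarrow> bool" where
  "clifford_flow W \<alpha> \<longleftrightarrow>
    E0_semigroup (clifford_algebra W) \<alpha> \<and>
    (\<forall>t\<ge>0. \<forall>fs \<in> lists L2_halfline.
       \<alpha> t (clifford_product W fs) = clifford_product W (map (shift t) fs))"

definition even_clifford_flow ::
    "((real \<Rightarrow> 'k::real_inner \<times> 'k) list \<Rightarrow> 'h::complex_hilbert_space) \<Rightarrow>
      (real \<Rightarrow> ('h \<Rightarrow> 'h) \<Rightarrow> 'h \<Rightarrow> 'h) \<Rightarrow> real \<Rightarrow> ('h \<Rightarrow> 'h) \<Rightarrow> 'h \<Rightarrow> 'h" where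
  "even_clifford_flow W \<alpha> = (\<lambda>t. restrict (\<alpha> t) (even_clifford_algebra W))"

end

theory Submission
  imports Defs "Jordan_Normal_Form.Determinant"
begin

text \<open>
  Let \<open>U\<close> be a gauge cocycle and \<open>\<xi>\<^sub>t = U\<^sub>t\<Omega>\<close>.  As \<open>U\<^sub>t\<close> commutes with the products \<open>u(F) u(G)\<close> for \<open>F, G\<close> in
  \<open>L\<^sup>2(t, \<infinity>)\<close>, the vector \<open>\<xi>\<^sub>t\<close> is annihilated by \<open>a(F)\<close>: it has no particles in \<open>(t, \<infinity>)\<close>.  As \<open>\<alpha>\<^sub>s\<close> is
  normal, \<open>\<alpha>\<^sub>s(U\<^sub>t)\<Omega>\<close> is a limit of vectors \<open>p\<Omega>\<close> with \<open>p\<close> an even polynomial in the fields on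
  \<open>(s, \<infinity>)\<close>, and \<open>U\<^sub>s p\<Omega> = p\<xi>\<^sub>s\<close>; so \<open>\<xi>\<^bsub>s+t\<^esub> = U\<^sub>s\<alpha>\<^sub>s(U\<^sub>t)\<Omega>\<close> has an even number of particles in \<open>(s, \<infinity>)\<close>.
  Hence \<open>\<xi>\<^sub>t\<close> is fixed, for every \<open>s\<close>, by the second quantization \<open>\<Gamma>\<close> of multiplication by the function
  that is \<open>1\<close> before \<open>s\<close> and \<open>-1\<close> after \<open>s\<close>.  Products \<open>\<psi>\<^sub>n\<close> of such functions tend weakly to \<open>0\<close>, which
  gives \<open>\<parallel>a(f)\<xi>\<^sub>t\<parallel> = \<parallel>\<Gamma>(\<psi>\<^sub>n) a(f)\<xi>\<^sub>t\<parallel> = \<parallel>a(\<psi>\<^sub>n f)\<xi>\<^sub>t\<parallel> \<rightarrow> 0\<close>.  So \<open>\<xi>\<^sub>t\<close> is a multiple of \<open>\<Omega>\<close>, \<open>U\<^sub>t = e\<^bsup>\<mu>t\<^esup>\<close>,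
  and \<open>c\<^sub>*(U, V) = \<mu>(V) - \<mu>(U)\<close>, whose form vanishes on functions of sum zero.
\<close>

section \<open>Complex Hilbert spaces\<close>

text \<open>The Fock space is never factored at time s. Having no particles after s means being
  annihilated by a(F) for all F supported there, and parity after s is the self-adjoint operator
  \<open>sign_change (sign_at s)\<close>. One sign change sees only parity; it is the products of
  many of them, weakly null as multiplication operators, that exclude particles altogether. The same
  sequence of waves also proves that a(F) annihilates the vacuum image of a gauge cocycle. Normality
  has to be turned into a statement about vectors. Even products are dense in the even algebra only
  in a weak sense, so von Neumann's argument on \<open>ell2\<close> carries the vanishing of a
  normal functional from the products to the whole algebra. Passing from the vector
  \<open>U t (W [])\<close> to the operator \<open>U t\<close> relies on right multiplication by
  fields: it commutes with the even algebra and builds every wedge product from the vacuum.\<close>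

lemma cinner_add_left: "cinner (x + y) z = cinner x z + cinner y z"
  by (metis cinner_add_right cinner_commute complex_cnj_add)

lemma cinner_scaleC_left: "cinner (c *\<^sub>C x) y = cnj c * cinner x y"
  by (metis cinner_scaleC_right cinner_commute complex_cnj_mult)

lemma norm_scaleC: "norm (c *\<^sub>C x) = cmod c * norm x"
proof -
  have "complex_of_real ((norm (c *\<^sub>C x))\<^sup>2) = cinner (c *\<^sub>C x) (c *\<^sub>C x)"
    by (simp only: cinner_self)
  also have "\<dots> = (c * cnj c) * cinner x x"
    by (simp add: cinner_scaleC_left cinner_scaleC_right)
  also have "\<dots> = complex_of_real ((cmod c * norm x)\<^sup>2)"
    by (simp add: cinner_self complex_norm_square[symmetric] power_mult_distrib)
  finally show ?thesis
    by (metis of_real_eq_iff norm_ge_zero power2_eq_imp_eq mult_nonneg_nonneg)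
qed

lemma scaleR_scaleC: "r *\<^sub>R x = complex_of_real r *\<^sub>C x"
  by (simp add: scaleC_of_real)

lemma cinner_zero [simp]: "cinner 0 x = 0" "cinner x 0 = 0"
  by (metis cinner_scaleC_left complex_cnj_zero complex_vector.scale_zero_left mult_zero_left)
    (metis cinner_scaleC_right complex_vector.scale_zero_left mult_zero_left)

lemma cinner_minus [simp]: "cinner (- x) y = - cinner x y" "cinner x (- y) = - cinner x y"
  by (metis add.right_inverse cinner_add_left cinner_zero(1) minus_unique)
    (metis add.right_inverse cinner_add_right cinner_zero(2) minus_unique)

lemma cinner_diff_left: "cinner (x - y) z = cinner x z - cinner y z"
  using cinner_add_left[of x "- y" z] by simp

lemma cinner_diff_right: "cinner x (y - z) = cinner x y - cinner x z"
  using cinner_add_right[of x y "- z"] by simp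

lemma cinner_sum_left: "cinner (\<Sum>i\<in>I. f i) y = (\<Sum>i\<in>I. cinner (f i) y)"
  by (induction I rule: infinite_finite_induct) (simp_all add: cinner_add_left)

lemma cinner_sum_right: "cinner y (\<Sum>i\<in>I. f i) = (\<Sum>i\<in>I. cinner y (f i))"
  by (induction I rule: infinite_finite_induct) (simp_all add: cinner_add_right)

lemma norm_eq_cinner: "(norm x)\<^sup>2 = Re (cinner x x)"
  by (simp add: cinner_self)

lemma cinner_eq_zero_iff [simp]: "cinner x x = 0 \<longleftrightarrow> x = 0"
  by (simp add: cinner_self)

text \<open>Minimising this quadratic in \<open>c\<close> yields both the Cauchy-Schwarz inequality
  and the orthogonality of closest points.\<close>

lemma norm_diff_scaleC_square:
  "(norm (x - c *\<^sub>C y))\<^sup>2 = (norm x)\<^sup>2 - 2 * Re (c * cinner x y) + (cmod c)\<^sup>2 * (norm y)\<^sup>2"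
proof -
  have "Re (cinner (c *\<^sub>C y) x) = Re (c * cinner x y)"
    by (subst cinner_commute) (simp add: cinner_scaleC_right)
  moreover have "cinner (c *\<^sub>C y) (c *\<^sub>C y) = of_real ((cmod c * norm y)\<^sup>2)"
    by (simp add: cinner_self norm_scaleC)
  moreover have "cinner (x - z) (x - z) = cinner x x - cinner x z - cinner z x + cinner z z" for z
    by (simp add: cinner_diff_left cinner_diff_right)
  ultimately show ?thesis
    by (simp only: norm_eq_cinner[of "x - _"] cinner_scaleC_right[of x] cinner_self[of x]
        minus_complex.sel plus_complex.sel Re_complex_of_real power_mult_distrib)
qed

lemma norm_cinner_le: "cmod (cinner x y) \<le> norm x * norm y"
proof (cases "y = 0")
  case False
  \<comment> \<open>With this coefficient \<open>c *\<^sub>C y\<close> is the projection of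
    \<open>x\<close> onto the line through \<open>y\<close>.\<close>
  define c where "c = cnj (cinner x y) / of_real ((norm y)\<^sup>2)"
  have y: "(norm y)\<^sup>2 > 0"
    using False by simp
  have "c * cinner x y = of_real ((cmod (cinner x y))\<^sup>2 / (norm y)\<^sup>2)"
    unfolding c_def of_real_divide complex_norm_square by simp
  moreover have "(cmod c)\<^sup>2 * (norm y)\<^sup>2 = (cmod (cinner x y))\<^sup>2 / (norm y)\<^sup>2"
    using y by (simp add: c_def norm_divide norm_power power_divide)
      (simp add: power2_eq_square power4_eq_xxxx)
  moreover have "Re (c * cinner x y) = (cmod (cinner x y))\<^sup>2 / (norm y)\<^sup>2"
    using calculation(1) by (simp only: Re_complex_of_real)
  ultimately have "0 \<le> (norm x)\<^sup>2 - (cmod (cinner x y))\<^sup>2 / (norm y)\<^sup>2"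
    using norm_diff_scaleC_square[of x c y] zero_le_power2[of "norm (x - c *\<^sub>C y)"]
    by linarith
  then have "(cmod (cinner x y))\<^sup>2 \<le> (norm x * norm y)\<^sup>2"
    using y by (simp add: field_simps power_mult_distrib)
  then show ?thesis
    by (rule power2_le_imp_le) simp
qed simp

lemma bounded_bilinear_cinner: "bounded_bilinear cinner"
proof
  show "\<exists>K. \<forall>a b. norm (cinner a b) \<le> norm a * norm b * K"
    using norm_cinner_le by (intro exI[of _ 1]) auto
qed (simp_all add: cinner_add_left cinner_add_right scaleR_scaleC cinner_scaleC_left
    cinner_scaleC_right scaleR_conv_of_real)

lemma bounded_bilinear_scaleC: "bounded_bilinear scaleC"
proof
  show "(r *\<^sub>R a) *\<^sub>C b = r *\<^sub>R a *\<^sub>C b" for r a and b :: 'a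
    by (simp add: scaleR_scaleC scaleC_scaleC scaleR_conv_of_real)
  show "a *\<^sub>C (r *\<^sub>R b) = r *\<^sub>R a *\<^sub>C b" for r a and b :: 'a
    by (simp add: scaleR_scaleC scaleC_scaleC mult.commute)
  show "\<exists>K. \<forall>a (b :: 'a). norm (a *\<^sub>C b) \<le> norm a * norm b * K"
    by (intro exI[of _ 1]) (simp add: norm_scaleC)
qed (simp_all add: scaleC_add_left scaleC_add_right)

lemmas tendsto_scaleC = bounded_bilinear.tendsto[OF bounded_bilinear_scaleC]
lemmas continuous_on_cinner [continuous_intros] =
  bounded_bilinear.continuous_on[OF bounded_bilinear_cinner]
lemmas continuous_on_scaleC [continuous_intros] =
  bounded_bilinear.continuous_on[OF bounded_bilinear_scaleC]

section \<open>Bounded operators, commutants and total families\<close>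

abbreviation dense_family :: "'i set \<Rightarrow> ('i \<Rightarrow> 'h::complex_hilbert_space) \<Rightarrow> bool" where
  "dense_family I w \<equiv> closure (complex_vector.span (w ` I)) = UNIV"

lemma bounded_operators_add: "A \<in> bounded_operators \<Longrightarrow> A (x + y) = A x + A y"
  and bounded_operators_scaleC: "A \<in> bounded_operators \<Longrightarrow> A (c *\<^sub>C x) = c *\<^sub>C A x"
  by (auto simp: bounded_operators_def bounded_linear.linear linear_add)

lemma bounded_operators_bounded_linear: "A \<in> bounded_operators \<Longrightarrow> bounded_linear A"
  by (simp add: bounded_operators_def)

lemma bounded_operators_diff: "A \<in> bounded_operators \<Longrightarrow> A (x - y) = A x - A y"
  and bounded_operators_minus: "A \<in> bounded_operators \<Longrightarrow> A (- x) = - A x"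
  and bounded_operators_zero: "A \<in> bounded_operators \<Longrightarrow> A 0 = 0"
  and bounded_operators_sum: "A \<in> bounded_operators \<Longrightarrow> A (\<Sum>i\<in>J. f i) = (\<Sum>i\<in>J. A (f i))"
  by (auto dest!: bounded_operators_bounded_linear bounded_linear.linear
      simp: linear_diff linear_neg linear_0 linear_sum)

lemma bounded_operators_comp:
  "A \<in> bounded_operators \<Longrightarrow> B \<in> bounded_operators \<Longrightarrow> (\<lambda>x. A (B x)) \<in> bounded_operators"
  by (auto simp: bounded_operators_def intro: bounded_linear_compose)

lemma bounded_operators_id: "(\<lambda>x. x) \<in> bounded_operators"
  by (simp add: bounded_operators_def)

lemma bounded_operators_plus:
  "A \<in> bounded_operators \<Longrightarrow> B \<in> bounded_operators \<Longrightarrow> (\<lambda>x. A x + B x) \<in> bounded_operators"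
  by (auto simp: bounded_operators_def scaleC_add_right intro: bounded_linear_add)

lemma bounded_operators_scale:
  "A \<in> bounded_operators \<Longrightarrow> (\<lambda>x. c *\<^sub>C A x) \<in> bounded_operators"
  by (auto simp: bounded_operators_def scaleC_scaleC mult.commute
      intro: bounded_linear_compose[OF bounded_bilinear.bounded_linear_right[OF bounded_bilinear_scaleC]])

lemma bounded_operators_minus_op:
  assumes "A \<in> bounded_operators" "B \<in> bounded_operators"
  shows "(\<lambda>x. A x - B x) \<in> bounded_operators"
  using bounded_operators_plus[OF assms(1) bounded_operators_scale[OF assms(2), of "- 1"]] by simp

lemma bounded_operators_continuous: "A \<in> bounded_operators \<Longrightarrow> continuous_on S A"
  by (simp add: bounded_operators_bounded_linear linear_continuous_on)

lemma commutant_bounded: "commutant S \<subseteq> bounded_operators"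
  by (auto simp: commutant_def)

lemma commutant_antimono: "S \<subseteq> T \<Longrightarrow> commutant T \<subseteq> commutant S"
  by (auto simp: commutant_def)

lemma commutant_commutant_superset: "S \<subseteq> bounded_operators \<Longrightarrow> S \<subseteq> commutant (commutant S)"
  by (auto simp: commutant_def)

lemma commutantD: "A \<in> commutant S \<Longrightarrow> B \<in> S \<Longrightarrow> A (B x) = B (A x)"
  by (auto simp: commutant_def o_def fun_eq_iff)

lemma commutantI:
  "A \<in> bounded_operators \<Longrightarrow> (\<And>B x. B \<in> S \<Longrightarrow> A (B x) = B (A x)) \<Longrightarrow> A \<in> commutant S"
  by (auto simp: commutant_def o_def fun_eq_iff)

text \<open>A closed subspace that contains a total family is everything. As an induction rule this
  reduces identities between continuous operators to the vectors \<open>w i\<close>.\<close>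

lemma dense_family_induct:
  assumes "dense_family I w"
    and closed: "closed {x. P x}" and zero: "P 0"
    and add: "\<And>x y. P x \<Longrightarrow> P y \<Longrightarrow> P (x + y)"
    and scale: "\<And>c x. P x \<Longrightarrow> P (c *\<^sub>C x)"
    and base: "\<And>i. i \<in> I \<Longrightarrow> P (w i)"
  shows "P x"
proof -
  have "complex_vector.subspace {x. P x}"
    by (rule complex_vector.subspaceI) (use zero add scale in auto)
  then have "complex_vector.span (w ` I) \<subseteq> {x. P x}"
    by (intro complex_vector.span_minimal) (use base in auto)
  then have "closure (complex_vector.span (w ` I)) \<subseteq> {x. P x}"
    by (rule closure_minimal[OF _ closed])
  then show ?thesis
    using assms(1) by auto
qed

lemma eq_on_dense_family:
  assumes "dense_family I w" "A \<in> bounded_operators" "B \<in> bounded_operators"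
    and "\<And>i. i \<in> I \<Longrightarrow> A (w i) = B (w i)"
  shows "A x = B x"
  using assms(1)
proof (rule dense_family_induct[where P = "\<lambda>x. A x = B x"])
  show "closed {x. A x = B x}"
    by (intro closed_Collect_eq bounded_operators_continuous assms)
qed (simp_all add: assms bounded_operators_add bounded_operators_scaleC bounded_operators_zero)

lemma cinner_eq_on_dense_family:
  assumes "dense_family I w" "\<And>i. i \<in> I \<Longrightarrow> cinner (w i) x = cinner (w i) y"
  shows "x = y"
proof -
  have "cinner z x = cinner z y" for z
    using assms(1)
  proof (rule dense_family_induct[where P = "\<lambda>z. cinner z x = cinner z y"])
    show "closed {z. cinner z x = cinner z y}"
      by (intro closed_Collect_eq continuous_intros)
  qed (simp_all add: assms cinner_add_left cinner_scaleC_left)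
  then have "cinner (x - y) (x - y) = 0"
    by (simp add: cinner_diff_right)
  then show ?thesis
    by simp
qed

lemma adjoint_on_dense_family:
  assumes "dense_family I w" "A \<in> bounded_operators" "B \<in> bounded_operators"
    and base: "\<And>i j. i \<in> I \<Longrightarrow> j \<in> I \<Longrightarrow> cinner (A (w i)) (w j) = cinner (w i) (B (w j))"
  shows "cinner (A x) y = cinner x (B y)"
proof -
  have *: "cinner (A x) (w j) = cinner x (B (w j))" if "j \<in> I" for x j
    using assms(1)
  proof (rule dense_family_induct[where P = "\<lambda>x. cinner (A x) (w j) = cinner x (B (w j))"])
    show "closed {x. cinner (A x) (w j) = cinner x (B (w j))}"
      by (intro closed_Collect_eq continuous_intros bounded_operators_continuous assms)
  qed (simp_all add: assms that bounded_operators_add bounded_operators_scaleC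
      bounded_operators_zero cinner_add_left cinner_scaleC_left)
  show ?thesis
    using assms(1)
  proof (rule dense_family_induct[where P = "\<lambda>y. cinner (A x) y = cinner x (B y)"])
    show "closed {y. cinner (A x) y = cinner x (B y)}"
      by (intro closed_Collect_eq continuous_intros bounded_operators_continuous assms)
  qed (simp_all add: assms * bounded_operators_add bounded_operators_scaleC
      bounded_operators_zero cinner_add_right cinner_scaleC_right)
qed

text \<open>Exhibiting an adjoint resolves the definite description; uniqueness comes from testing a
  competitor on the difference of the two values.\<close>

lemma hilbert_adjoint_eqI:
  assumes "B \<in> bounded_operators" "\<And>x y. cinner (B x) y = cinner x (A y)"
  shows "hilbert_adjoint A = B"
  unfolding hilbert_adjoint_def
proof (rule the_equality)
  fix B' assume B': "B' \<in> bounded_operators \<and> (\<forall>x y. cinner (B' x) y = cinner x (A y))"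
  have "B' x = B x" for x
  proof -
    have "cinner (B' x - B x) (B' x - B x) = 0"
      by (simp add: B' assms cinner_diff_left)
    then show ?thesis
      by simp
  qed
  then show "B' = B"
    by auto
qed (use assms in auto)

section \<open>Extending maps from a total family to bounded operators\<close>

lemma span_image_eq_sums:
  assumes "x \<in> complex_vector.span (w ` I)"
  shows "\<exists>J c. finite J \<and> J \<subseteq> I \<and> x = (\<Sum>i\<in>J. c i *\<^sub>C w i)"
  using assms
proof (induction rule: complex_vector.span_induct_alt)
  case base
  then show ?case
    by (intro exI[of _ "{}"]) simp
next
  case (step a v y)
  then obtain i J c where i: "i \<in> I" "v = w i" and J: "finite J" "J \<subseteq> I" "y = (\<Sum>i\<in>J. c i *\<^sub>C w i)"
    by blast
  \<comment> \<open>The index \<open>i\<close> may already lie in \<open>J\<close>; its new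
    coefficient is then added to the old one.\<close>
  define d where "d = (\<lambda>j. (if j \<in> J then c j else 0) + (if j = i then a else 0))"
  have "(\<Sum>j\<in>insert i J. d j *\<^sub>C w j) =
      (\<Sum>j\<in>insert i J. (if j \<in> J then c j else 0) *\<^sub>C w j) + (\<Sum>j\<in>insert i J. (if j = i then a else 0) *\<^sub>C w j)"
    by (simp add: d_def scaleC_add_left sum.distrib)
  also have "(\<Sum>j\<in>insert i J. (if j \<in> J then c j else 0) *\<^sub>C w j) = (\<Sum>j\<in>J. c j *\<^sub>C w j)"
    by (rule sum.mono_neutral_cong_right) (use J in auto)
  also have "(\<Sum>j\<in>insert i J. (if j = i then a else 0) *\<^sub>C w j) = (\<Sum>j\<in>{i}. a *\<^sub>C w j)"
    by (rule sum.mono_neutral_cong_right) (use J in auto)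
  finally show ?case
    using i J by (intro exI[of _ "insert i J"] exI[of _ d]) (simp add: add.commute)
qed

text \<open>The family \<open>w\<close> may be linearly dependent, so sending \<open>w i\<close> to
  \<open>v i\<close> is not obviously well defined. The bound on all finite combinations settles
  this, makes the map on the span Lipschitz, and so extends it to the closure.\<close>

lemma bounded_extension:
  fixes w v :: "'i \<Rightarrow> 'h::complex_hilbert_space"
  assumes dense: "dense_family I w"
    and bound: "\<And>J c. finite J \<Longrightarrow> J \<subseteq> I \<Longrightarrow>
      norm (\<Sum>i\<in>J. c i *\<^sub>C v i) \<le> C * norm (\<Sum>i\<in>J. c i *\<^sub>C w i)"
  obtains A where "A \<in> bounded_operators" "\<And>i. i \<in> I \<Longrightarrow> A (w i) = v i"
proof -
  let ?S = "complex_vector.span (w ` I)"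
  \<comment> \<open>The graph of the future map, as a relation: a vector of the span has many
    representations.\<close>
  define R where "R = (\<lambda>x y. \<exists>J c. finite J \<and> J \<subseteq> I \<and> x = (\<Sum>i\<in>J. c i *\<^sub>C w i) \<and> y = (\<Sum>i\<in>J. c i *\<^sub>C v i))"
  have R_add: "R (x + a *\<^sub>C x') (y + a *\<^sub>C y')" if xy: "R x y" "R x' y'" for x y x' y' a
  proof -
    from that obtain J c J' c' where J: "finite J" "J \<subseteq> I" "x = (\<Sum>i\<in>J. c i *\<^sub>C w i)" "y = (\<Sum>i\<in>J. c i *\<^sub>C v i)"
      and J': "finite J'" "J' \<subseteq> I" "x' = (\<Sum>i\<in>J'. c' i *\<^sub>C w i)" "y' = (\<Sum>i\<in>J'. c' i *\<^sub>C v i)"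
      unfolding R_def by blast
    define d where "d = (\<lambda>j. (if j \<in> J then c j else 0) + a * (if j \<in> J' then c' j else 0))"
    have "(\<Sum>j\<in>J \<union> J'. d j *\<^sub>C u j) = (\<Sum>i\<in>J. c i *\<^sub>C u i) + a *\<^sub>C (\<Sum>i\<in>J'. c' i *\<^sub>C u i)"
      for u :: "'i \<Rightarrow> 'h"
    proof -
      have "(\<Sum>j\<in>J \<union> J'. d j *\<^sub>C u j) = (\<Sum>j\<in>J \<union> J'. (if j \<in> J then c j else 0) *\<^sub>C u j)
          + a *\<^sub>C (\<Sum>j\<in>J \<union> J'. (if j \<in> J' then c' j else 0) *\<^sub>C u j)"
        by (simp add: d_def scaleC_add_left sum.distrib complex_vector.scale_sum_right scaleC_scaleC)
      also have "(\<Sum>j\<in>J \<union> J'. (if j \<in> J then c j else 0) *\<^sub>C u j) = (\<Sum>i\<in>J. c i *\<^sub>C u i)"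
        by (rule sum.mono_neutral_cong_right) (use J J' in auto)
      also have "(\<Sum>j\<in>J \<union> J'. (if j \<in> J' then c' j else 0) *\<^sub>C u j) = (\<Sum>i\<in>J'. c' i *\<^sub>C u i)"
        by (rule sum.mono_neutral_cong_right) (use J J' in auto)
      finally show ?thesis .
    qed
    then show ?thesis
      unfolding R_def using J J' by (intro exI[of _ "J \<union> J'"] exI[of _ d]) simp
  qed
  have R_bound: "norm y \<le> C * norm x" if "R x y" for x y
    using that bound unfolding R_def by blast
  \<comment> \<open>The difference of two images of \<open>x\<close> is an image of 0, and the bound
    makes it vanish.\<close>
  have R_unique: "y = y'" if "R x y" "R x y'" for x y y'
    using R_bound[OF R_add[OF that, of "- 1"]] by simp
  have R_ex: "\<exists>y. R x y" if "x \<in> ?S" for x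
    using span_image_eq_sums[OF that] unfolding R_def by blast
  define g where "g x = (THE y. R x y)" for x
  have g: "g x = y" if "R x y" for x y
    unfolding g_def using that R_unique by blast
  have Rg: "R x (g x)" if "x \<in> ?S" for x
    using R_ex[OF that] g by blast
  have g_add: "g (x + a *\<^sub>C y) = g x + a *\<^sub>C g y" if "x \<in> ?S" "y \<in> ?S" for x y a
    by (intro g R_add Rg that)
  have g_bound: "norm (g x) \<le> C * norm x" if "x \<in> ?S" for x
    by (intro R_bound Rg that)
  have "lipschitz_on \<bar>C\<bar> ?S g"
  proof (rule lipschitz_onI)
    fix x y assume "x \<in> ?S" "y \<in> ?S"
    then have "g (x - y) = g x - g y" "x - y \<in> ?S"
      using g_add[of x y "- 1"] by (simp_all add: complex_vector.span_diff)
    then have "norm (g x - g y) \<le> C * norm (x - y)"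
      using g_bound by metis
    also have "\<dots> \<le> \<bar>C\<bar> * norm (x - y)"
      by (intro mult_right_mono) auto
    finally show "dist (g x) (g y) \<le> \<bar>C\<bar> * dist x y"
      by (simp add: dist_norm)
  qed simp
  then have "uniformly_continuous_on ?S g"
    by (rule lipschitz_on_uniformly_continuous)
  then obtain A where A: "uniformly_continuous_on (closure ?S) A" "\<And>x. x \<in> ?S \<Longrightarrow> g x = A x"
    using uniformly_continuous_on_extension_on_closure by metis
  have lim: "\<exists>s. (\<forall>n. s n \<in> ?S) \<and> s \<longlonglongrightarrow> x" for x
    using dense closure_sequential[of x ?S] by auto
  have cont: "(\<lambda>n. A (s n)) \<longlonglongrightarrow> A x" if "s \<longlonglongrightarrow> x" for s x
  proof -
    have "continuous_on UNIV A"
      using uniformly_continuous_imp_continuous[OF A(1)] dense by simp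
    then have "isCont A x"
      by (simp add: continuous_on_eq_continuous_at)
    then show ?thesis
      by (rule isCont_tendsto_compose) (rule that)
  qed
  have A_add: "A (x + a *\<^sub>C y) = A x + a *\<^sub>C A y" for x y a
  proof -
    obtain s t where s: "\<forall>n. s n \<in> ?S" "s \<longlonglongrightarrow> x" and t: "\<forall>n. t n \<in> ?S" "t \<longlonglongrightarrow> y"
      using lim by metis
    have eq: "A (s n + a *\<^sub>C t n) = A (s n) + a *\<^sub>C A (t n)" for n
    proof -
      have "s n + a *\<^sub>C t n \<in> ?S"
        using s t by (intro complex_vector.span_add complex_vector.span_scale) auto
      then show ?thesis
        using g_add[of "s n" "t n" a] A(2) s t by simp
    qed
    have "(\<lambda>n. A (s n + a *\<^sub>C t n)) \<longlonglongrightarrow> A x + a *\<^sub>C A y"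
      unfolding eq by (intro tendsto_add tendsto_scaleC tendsto_const cont s t)
    moreover have "(\<lambda>n. A (s n + a *\<^sub>C t n)) \<longlonglongrightarrow> A (x + a *\<^sub>C y)"
      by (intro cont tendsto_add tendsto_scaleC tendsto_const s t)
    ultimately show ?thesis
      by (rule LIMSEQ_unique[symmetric])
  qed
  have A_bound: "norm (A x) \<le> C * norm x" for x
  proof -
    obtain s where s: "\<forall>n. s n \<in> ?S" "s \<longlonglongrightarrow> x"
      using lim by metis
    show ?thesis
    proof (rule LIMSEQ_le)
      show "(\<lambda>n. norm (A (s n))) \<longlonglongrightarrow> norm (A x)"
        by (intro tendsto_norm cont s)
      show "(\<lambda>n. C * norm (s n)) \<longlonglongrightarrow> C * norm x"
        by (intro tendsto_intros s)
      show "\<exists>N. \<forall>n\<ge>N. norm (A (s n)) \<le> C * norm (s n)"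
        using g_bound A(2) s by metis
    qed
  qed
  have A0: "A 0 = 0"
    using A_bound[of 0] by simp
  have "A \<in> bounded_operators"
    unfolding bounded_operators_def
  proof (intro CollectI conjI allI)
    show "bounded_linear A"
    proof (rule bounded_linear_intro)
      show "A (x + y) = A x + A y" for x y
        using A_add[of x 1 y] by simp
      show "A (r *\<^sub>R x) = r *\<^sub>R A x" for r x
        using A_add[of 0 "of_real r" x] A0 by (simp add: scaleR_scaleC)
      show "norm (A x) \<le> norm x * C" for x
        using A_bound[of x] by (simp add: mult.commute)
    qed
    show "A (c *\<^sub>C x) = c *\<^sub>C A x" for c x
      using A_add[of 0 c x] A0 by simp
  qed
  moreover have "A (w i) = v i" if "i \<in> I" for i
  proof -
    have "R (w i) (v i)"
      unfolding R_def by (intro exI[of _ "{i}"] exI[of _ "\<lambda>_. 1"]) (use that in simp)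
    moreover have "w i \<in> ?S"
      using that by (intro complex_vector.span_base) auto
    ultimately show ?thesis
      using g A(2) by metis
  qed
  ultimately show ?thesis
    by (rule that)
qed

text \<open>Equal Gram matrices give equal norms of all finite combinations, so the extension exists
  with constant 1.\<close>

lemma isometric_extension:
  fixes w v :: "'i \<Rightarrow> 'h::complex_hilbert_space"
  assumes dense: "dense_family I w"
    and gram: "\<And>i j. i \<in> I \<Longrightarrow> j \<in> I \<Longrightarrow> cinner (v i) (v j) = cinner (w i) (w j)"
  obtains A where "A \<in> bounded_operators" "\<And>i. i \<in> I \<Longrightarrow> A (w i) = v i"
proof (rule bounded_extension[OF dense, of v 1])
  fix J :: "'i set" and c :: "'i \<Rightarrow> complex"
  assume J: "finite J" "J \<subseteq> I"
  have "cinner (\<Sum>i\<in>J. c i *\<^sub>C v i) (\<Sum>i\<in>J. c i *\<^sub>C v i)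
      = cinner (\<Sum>i\<in>J. c i *\<^sub>C w i) (\<Sum>i\<in>J. c i *\<^sub>C w i)"
    unfolding cinner_sum_left cinner_sum_right cinner_scaleC_left cinner_scaleC_right
    using J gram by (intro sum.cong refl) (auto simp: subset_iff)
  then have "(norm (\<Sum>i\<in>J. c i *\<^sub>C v i))\<^sup>2 = (norm (\<Sum>i\<in>J. c i *\<^sub>C w i))\<^sup>2"
    by (simp add: norm_eq_cinner)
  then show "norm (\<Sum>i\<in>J. c i *\<^sub>C v i) \<le> 1 * norm (\<Sum>i\<in>J. c i *\<^sub>C w i)"
    by simp
qed (use that in blast)

section \<open>Orthogonal projections\<close>

lemma parallelogram_law:
  fixes x y :: "'h::complex_hilbert_space"
  shows "(norm (x + y))\<^sup>2 + (norm (x - y))\<^sup>2 = 2 * (norm x)\<^sup>2 + 2 * (norm y)\<^sup>2"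
  unfolding norm_eq_cinner by (simp add: cinner_add_left cinner_add_right cinner_diff_left cinner_diff_right)

text \<open>Moving \<open>y\<close> by the best multiple of \<open>z\<close> lowers the squared
  distance by |\<open>cinner (x - y) z\<close>|^2 / |z|^2, so minimality forces this quantity to be
  0.\<close>

lemma closest_point_orthogonal:
  fixes x :: "'h::complex_hilbert_space"
  assumes K: "complex_vector.subspace K" and y: "y \<in> K" and z: "z \<in> K"
    and closest: "\<And>w. w \<in> K \<Longrightarrow> norm (x - y) \<le> norm (x - w)"
  shows "cinner (x - y) z = 0"
proof (cases "z = 0")
  case False
  let ?a = "cinner (x - y) z"
  define c where "c = cnj ?a / of_real ((norm z)\<^sup>2)"
  have z': "(norm z)\<^sup>2 > 0"
    using False by simp
  have "norm (x - y) \<le> norm (x - (y + c *\<^sub>C z))"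
    by (intro closest complex_vector.subspace_add[OF K] complex_vector.subspace_scale[OF K] y z)
  then have "(norm (x - y))\<^sup>2 \<le> (norm (x - y - c *\<^sub>C z))\<^sup>2"
    by (intro power_mono) (simp_all add: algebra_simps)
  moreover have "c * ?a = of_real ((cmod ?a)\<^sup>2 / (norm z)\<^sup>2)"
    unfolding c_def of_real_divide complex_norm_square by simp
  then have "Re (c * ?a) = (cmod ?a)\<^sup>2 / (norm z)\<^sup>2"
    by (simp only: Re_complex_of_real)
  moreover have "(cmod c)\<^sup>2 * (norm z)\<^sup>2 = (cmod ?a)\<^sup>2 / (norm z)\<^sup>2"
    using False by (simp add: c_def norm_divide norm_power power_divide)
      (simp add: power2_eq_square power4_eq_xxxx)
  ultimately have "(cmod ?a)\<^sup>2 / (norm z)\<^sup>2 \<le> 0"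
    using norm_diff_scaleC_square[of "x - y" c z] by linarith
  then show ?thesis
    using z' by (simp add: divide_le_0_iff)
qed simp

text \<open>A minimising sequence is Cauchy by the parallelogram law, because midpoints stay in
  \<open>K\<close> and hence at distance at least \<open>d\<close> from \<open>x\<close>. The
  tolerance 1/(n+1) is put on the squared distance, the quantity in that law.\<close>

lemma closest_point_exists:
  fixes x :: "'h::complex_hilbert_space"
  assumes K: "complex_vector.subspace K" "closed K"
  obtains y where "y \<in> K" "\<And>w. w \<in> K \<Longrightarrow> norm (x - y) \<le> norm (x - w)"
proof -
  have ne: "K \<noteq> {}"
    using complex_vector.subspace_0[OF K(1)] by auto
  define d where "d = infdist x K"
  have d: "0 \<le> d" "\<And>w. w \<in> K \<Longrightarrow> d \<le> norm (x - w)"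
    by (auto simp: d_def infdist_nonneg infdist_le dist_norm[symmetric])
  have "\<exists>z\<in>K. (norm (x - z))\<^sup>2 < d\<^sup>2 + inverse (real (Suc n))" for n
  proof -
    have "d\<^sup>2 < d\<^sup>2 + inverse (real (Suc n))"
      by simp
    then have "d < sqrt (d\<^sup>2 + inverse (real (Suc n)))"
      using d(1) by (intro real_less_rsqrt)
    then obtain z where "z \<in> K" "dist x z < sqrt (d\<^sup>2 + inverse (real (Suc n)))"
      using ne unfolding d_def infdist_def by (auto simp: cINF_less_iff)
    moreover from this have "(dist x z)\<^sup>2 < (sqrt (d\<^sup>2 + inverse (real (Suc n))))\<^sup>2"
      by (intro power_strict_mono) auto
    ultimately show ?thesis
      by (intro bexI[of _ z]) (simp_all add: dist_norm add_nonneg_nonneg)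
  qed
  then obtain z where z: "\<And>n. z n \<in> K" "\<And>n. (norm (x - z n))\<^sup>2 < d\<^sup>2 + inverse (real (Suc n))"
    by metis
  have diff: "(norm (z m - z n))\<^sup>2 \<le> 2 * inverse (real (Suc m)) + 2 * inverse (real (Suc n))" for m n
  proof -
    have "(1/2) *\<^sub>C (z m + z n) \<in> K"
      by (intro complex_vector.subspace_add[OF K(1)] complex_vector.subspace_scale[OF K(1)] z)
    then have "d \<le> norm (x - (1/2) *\<^sub>C (z m + z n))"
      by (rule d)
    moreover have "(x - z m) + (x - z n) = 2 *\<^sub>C (x - (1/2) *\<^sub>C (z m + z n))"
      using scaleC_of_real[of 2 x] by (simp add: complex_vector.scale_right_diff_distrib scaleR_2 algebra_simps)
    ultimately have "2 * d \<le> norm ((x - z m) + (x - z n))"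
      by (simp add: norm_scaleC)
    then have "(2 * d)\<^sup>2 \<le> (norm ((x - z m) + (x - z n)))\<^sup>2"
      using d(1) by (intro power_mono) auto
    moreover have "norm ((x - z m) - (x - z n)) = norm (z m - z n)"
      by (simp add: norm_minus_commute)
    ultimately show ?thesis
      using parallelogram_law[of "x - z m" "x - z n"] z(2)[of m] z(2)[of n]
      by (simp add: power_mult_distrib)
  qed
  have "Cauchy z"
  proof (rule metric_CauchyI)
    fix e :: real assume e: "0 < e"
    then obtain N where N: "inverse (real (Suc N)) < e\<^sup>2 / 4"
      using reals_Archimedean[of "e\<^sup>2 / 4"] by auto
    have "dist (z m) (z n) < e" if "m \<ge> N" "n \<ge> N" for m n
    proof -
      have "inverse (real (Suc m)) \<le> inverse (real (Suc N))" "inverse (real (Suc n)) \<le> inverse (real (Suc N))"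
        using that by (auto intro!: le_imp_inverse_le)
      then have "(norm (z m - z n))\<^sup>2 < e\<^sup>2"
        using diff[of m n] N by linarith
      then show ?thesis
        using e by (simp add: dist_norm power_less_imp_less_base)
    qed
    then show "\<exists>M. \<forall>m\<ge>M. \<forall>n\<ge>M. dist (z m) (z n) < e"
      by blast
  qed
  then obtain y where y: "z \<longlonglongrightarrow> y"
    using Cauchy_convergent unfolding convergent_def by blast
  have "y \<in> K"
    using K(2) z(1) y closed_sequentially by blast
  moreover have "norm (x - y) \<le> norm (x - w)" if "w \<in> K" for w
  proof -
    have "(norm (x - y))\<^sup>2 \<le> d\<^sup>2 + 0"
    proof (rule LIMSEQ_le)
      show "(\<lambda>n. (norm (x - z n))\<^sup>2) \<longlonglongrightarrow> (norm (x - y))\<^sup>2"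
        by (intro tendsto_intros y)
      show "(\<lambda>n. d\<^sup>2 + inverse (real (Suc n))) \<longlonglongrightarrow> d\<^sup>2 + 0"
        by (intro tendsto_intros LIMSEQ_inverse_real_of_nat)
      show "\<exists>N. \<forall>n\<ge>N. (norm (x - z n))\<^sup>2 \<le> d\<^sup>2 + inverse (real (Suc n))"
      proof (intro exI allI impI)
        show "(norm (x - z n))\<^sup>2 \<le> d\<^sup>2 + inverse (real (Suc n))" for n
          by (rule less_imp_le, rule z(2))
      qed
    qed
    then have "norm (x - y) \<le> d"
      using power2_le_imp_le[OF _ d(1)] by simp
    then show ?thesis
      using d(2)[OF that] by simp
  qed
  ultimately show ?thesis
    by (rule that)
qed

lemma orthogonal_projection_exists:
  fixes x :: "'h::complex_hilbert_space"
  assumes K: "complex_vector.subspace K" "closed K"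
  obtains y where "y \<in> K" "\<And>z. z \<in> K \<Longrightarrow> cinner z (x - y) = 0"
proof -
  obtain y where y: "y \<in> K" "\<And>w. w \<in> K \<Longrightarrow> norm (x - y) \<le> norm (x - w)"
    using closest_point_exists[OF K] by blast
  have "cinner z (x - y) = 0" if "z \<in> K" for z
    using closest_point_orthogonal[OF K(1) y(1) that y(2)] by (subst cinner_commute) simp
  with y(1) show ?thesis
    by (rule that)
qed

lemma closure_span_subspace:
  fixes S :: "'h::complex_hilbert_space set"
  shows "complex_vector.subspace (closure (complex_vector.span S))"
proof (rule complex_vector.subspaceI)
  show "0 \<in> closure (complex_vector.span S)"
    using closure_subset complex_vector.span_zero by blast
next
  fix x y assume "x \<in> closure (complex_vector.span S)" "y \<in> closure (complex_vector.span S)"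
  then obtain f g where "\<forall>n. f n \<in> complex_vector.span S" "f \<longlonglongrightarrow> x"
    "\<forall>n. g n \<in> complex_vector.span S" "g \<longlonglongrightarrow> y"
    unfolding closure_sequential by blast
  then show "x + y \<in> closure (complex_vector.span S)"
    unfolding closure_sequential
    by (intro exI[of _ "\<lambda>n. f n + g n"]) (auto intro: complex_vector.span_add tendsto_add)
next
  fix c and x assume "x \<in> closure (complex_vector.span S)"
  then obtain f where "\<forall>n. f n \<in> complex_vector.span S" "f \<longlonglongrightarrow> x"
    unfolding closure_sequential by blast
  then show "c *\<^sub>C x \<in> closure (complex_vector.span S)"
    unfolding closure_sequential
    by (intro exI[of _ "\<lambda>n. c *\<^sub>C f n"]) (auto intro: complex_vector.span_scale tendsto_scaleC)
qed

text \<open>The remainder of \<open>x\<close> after projection onto the closed span is orthogonal to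
  every \<open>w i\<close>, hence 0.\<close>

lemma dense_familyI:
  assumes "\<And>z. (\<And>i. i \<in> I \<Longrightarrow> cinner (w i) z = 0) \<Longrightarrow> z = 0"
  shows "dense_family I w"
proof -
  have "x \<in> closure (complex_vector.span (w ` I))" for x
  proof -
    obtain y where y: "y \<in> closure (complex_vector.span (w ` I))"
      "\<And>z. z \<in> closure (complex_vector.span (w ` I)) \<Longrightarrow> cinner z (x - y) = 0"
      using orthogonal_projection_exists[OF closure_span_subspace closed_closure] by blast
    have "cinner (w i) (x - y) = 0" if "i \<in> I" for i
      by (rule y(2), rule subsetD[OF closure_subset], rule complex_vector.span_base, rule imageI, rule that)
    then have "x - y = 0"
      by (rule assms)
    then show ?thesis
      using y(1) by simp
  qed
  then show ?thesis
    by auto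
qed

section \<open>Square summable sequences and normal functionals\<close>

text \<open>The direct sum of countably many copies of a Hilbert space. A functional given by two
  square summable sequences becomes a single vector functional on this space.\<close>

typedef (overloaded) 'a ell2 =
  "{f :: nat \<Rightarrow> 'a::complex_hilbert_space. summable (\<lambda>i. (norm (f i))\<^sup>2)}"
  morphisms ell2_nth Abs_ell2
  by (intro exI[of _ "\<lambda>_. 0"]) simp

setup_lifting type_definition_ell2

lemma norm_add_square_le: "(norm (x + y))\<^sup>2 \<le> 2 * (norm x)\<^sup>2 + 2 * (norm (y :: 'a::real_normed_vector))\<^sup>2"
proof -
  have "(norm (x + y))\<^sup>2 \<le> (norm x + norm y)\<^sup>2"
    by (intro power_mono norm_triangle_ineq) simp
  also have "\<dots> \<le> 2 * (norm x)\<^sup>2 + 2 * (norm y)\<^sup>2"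
    using zero_le_power2[of "norm x - norm y"] by (simp add: power2_sum power2_diff)
  finally show ?thesis .
qed

lemma summable_square_add:
  fixes f g :: "nat \<Rightarrow> 'a::real_normed_vector"
  assumes "summable (\<lambda>i. (norm (f i))\<^sup>2)" "summable (\<lambda>i. (norm (g i))\<^sup>2)"
  shows "summable (\<lambda>i. (norm (f i + g i))\<^sup>2)"
proof (rule summable_comparison_test)
  show "\<exists>N. \<forall>n\<ge>N. norm ((norm (f n + g n))\<^sup>2) \<le> 2 * (norm (f n))\<^sup>2 + 2 * (norm (g n))\<^sup>2"
    by (simp add: norm_add_square_le)
qed (intro summable_add summable_mult assms)

lemma summable_cinner:
  fixes f g :: "nat \<Rightarrow> 'a::complex_hilbert_space"
  assumes "summable (\<lambda>i. (norm (f i))\<^sup>2)" "summable (\<lambda>i. (norm (g i))\<^sup>2)"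
  shows "summable (\<lambda>i. cinner (f i) (g i))"
proof (rule summable_comparison_test)
  have "norm (cinner x y) \<le> (norm x)\<^sup>2 + (norm y)\<^sup>2" for x y :: 'a
  proof -
    have "2 * (norm x * norm y) \<le> (norm x)\<^sup>2 + (norm y)\<^sup>2"
      using sum_squares_bound[of "norm x" "norm y"] by (simp add: mult.assoc)
    then show ?thesis
      using norm_cinner_le[of x y] mult_nonneg_nonneg[OF norm_ge_zero[of x] norm_ge_zero[of y]]
      by linarith
  qed
  then show "\<exists>N. \<forall>n\<ge>N. norm (cinner (f n) (g n)) \<le> (norm (f n))\<^sup>2 + (norm (g n))\<^sup>2"
    by blast
qed (intro summable_add assms)

lemma L2_set_le_sqrt_suminf:
  assumes "summable (\<lambda>i. (f i)\<^sup>2)"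
  shows "L2_set f {..<n} \<le> sqrt (\<Sum>i. (f i)\<^sup>2)"
  unfolding L2_set_def by (intro real_sqrt_le_mono sum_le_suminf assms) auto

text \<open>Together with \<open>L2_set_le_sqrt_suminf\<close> this reduces norm inequalities for
  sequences to finite partial sums, where the triangle inequality of \<open>L2_set\<close>
  applies.\<close>

lemma sqrt_suminf_le:
  assumes "summable (\<lambda>i. (f i)\<^sup>2)" "\<And>n. L2_set f {..<n} \<le> C"
  shows "sqrt (\<Sum>i. (f i)\<^sup>2) \<le> C"
proof (rule LIMSEQ_le_const2)
  show "(\<lambda>n. L2_set f {..<n}) \<longlonglongrightarrow> sqrt (\<Sum>i. (f i)\<^sup>2)"
    unfolding L2_set_def by (intro tendsto_real_sqrt summable_LIMSEQ assms)
qed (use assms in auto)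

instantiation ell2 :: (complex_hilbert_space) real_vector
begin

lift_definition zero_ell2 :: "'a ell2" is "\<lambda>_. 0" by simp
lift_definition plus_ell2 :: "'a ell2 \<Rightarrow> 'a ell2 \<Rightarrow> 'a ell2" is "\<lambda>f g i. f i + g i"
  by (rule summable_square_add)
lift_definition uminus_ell2 :: "'a ell2 \<Rightarrow> 'a ell2" is "\<lambda>f i. - f i" by simp
lift_definition minus_ell2 :: "'a ell2 \<Rightarrow> 'a ell2 \<Rightarrow> 'a ell2" is "\<lambda>f g i. f i - g i"
  using summable_square_add[of _ "\<lambda>i. - g i" for g] by simp
lift_definition scaleR_ell2 :: "real \<Rightarrow> 'a ell2 \<Rightarrow> 'a ell2" is "\<lambda>r f i. r *\<^sub>R f i"
  by (simp add: power_mult_distrib summable_mult)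

instance
  by standard (transfer; simp add: scaleR_add_left scaleR_add_right add.assoc fun_eq_iff; fail)+

end

instantiation ell2 :: (complex_hilbert_space) real_normed_vector
begin

lift_definition norm_ell2 :: "'a ell2 \<Rightarrow> real" is "\<lambda>f. sqrt (\<Sum>i. (norm (f i))\<^sup>2)" .
definition dist_ell2 :: "'a ell2 \<Rightarrow> 'a ell2 \<Rightarrow> real" where "dist_ell2 x y = norm (x - y)"
definition sgn_ell2 :: "'a ell2 \<Rightarrow> 'a ell2" where "sgn_ell2 x = x /\<^sub>R norm x"
definition uniformity_ell2 :: "('a ell2 \<times> 'a ell2) filter" where
  "uniformity_ell2 = (INF e\<in>{0<..}. principal {(x, y). dist x y < e})"
definition open_ell2 :: "'a ell2 set \<Rightarrow> bool" where
  "open_ell2 U \<longleftrightarrow> (\<forall>x\<in>U. eventually (\<lambda>(x', y). x' = x \<longrightarrow> y \<in> U) uniformity)"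

instance
proof
  fix x y :: "'a ell2" and r :: real
  show "norm x = 0 \<longleftrightarrow> x = 0"
    by transfer (auto simp: suminf_eq_zero_iff)
  show "norm (x + y) \<le> norm x + norm y"
  proof (transfer, rule sqrt_suminf_le)
    fix f g :: "nat \<Rightarrow> 'a" and n
    assume f: "summable (\<lambda>i. (norm (f i))\<^sup>2)" and g: "summable (\<lambda>i. (norm (g i))\<^sup>2)"
    show "summable (\<lambda>i. (norm (f i + g i))\<^sup>2)"
      by (intro summable_square_add f g)
    have "L2_set (\<lambda>i. norm (f i + g i)) {..<n} \<le> L2_set (\<lambda>i. norm (f i) + norm (g i)) {..<n}"
      by (intro L2_set_mono norm_triangle_ineq norm_ge_zero)
    also have "\<dots> \<le> L2_set (\<lambda>i. norm (f i)) {..<n} + L2_set (\<lambda>i. norm (g i)) {..<n}"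
      by (rule L2_set_triangle_ineq)
    also have "\<dots> \<le> sqrt (\<Sum>i. (norm (f i))\<^sup>2) + sqrt (\<Sum>i. (norm (g i))\<^sup>2)"
      by (intro add_mono L2_set_le_sqrt_suminf f g)
    finally show "L2_set (\<lambda>i. norm (f i + g i)) {..<n} \<le> \<dots>" .
  qed
  show "norm (r *\<^sub>R x) = \<bar>r\<bar> * norm x"
    by transfer (simp add: power_mult_distrib suminf_mult real_sqrt_mult)
qed (simp_all add: dist_ell2_def sgn_ell2_def uniformity_ell2_def open_ell2_def)

end

text \<open>Coordinates are contractions, so a Cauchy sequence converges coordinatewise. The Cauchy
  bound survives the limit on the first \<open>k\<close> coordinates, uniformly in \<open>k\<close>;
  this makes the limit square summable and the convergence one in norm.\<close>

instance ell2 :: (complex_hilbert_space) banach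
proof
  fix X :: "nat \<Rightarrow> 'a ell2"
  assume X: "Cauchy X"
  have nth_summable: "summable (\<lambda>i. (norm (ell2_nth x i))\<^sup>2)" for x :: "'a ell2"
    by transfer
  have L2_le: "L2_set (\<lambda>i. norm (ell2_nth x i)) {..<n} \<le> norm x" for x :: "'a ell2" and n
    by transfer (rule L2_set_le_sqrt_suminf)
  have nth_le: "norm (ell2_nth x i) \<le> norm x" for x :: "'a ell2" and i
    using member_le_L2_set[of "{..<Suc i}" i "\<lambda>i. norm (ell2_nth x i)"] L2_le[of x "Suc i"] by simp
  have "Cauchy (\<lambda>n. ell2_nth (X n) i)" for i
  proof (rule metric_CauchyI)
    fix e :: real assume "0 < e"
    then obtain M where M: "\<And>m n. m \<ge> M \<Longrightarrow> n \<ge> M \<Longrightarrow> dist (X m) (X n) < e"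
      using X by (meson metric_CauchyD)
    have "dist (ell2_nth (X m) i) (ell2_nth (X n) i) < e" if "m \<ge> M" "n \<ge> M" for m n
      using nth_le[of "X m - X n" i] M[OF that]
      by (simp add: dist_ell2_def dist_norm minus_ell2.rep_eq)
    then show "\<exists>M. \<forall>m\<ge>M. \<forall>n\<ge>M. dist (ell2_nth (X m) i) (ell2_nth (X n) i) < e"
      by blast
  qed
  then have "\<exists>l. (\<lambda>n. ell2_nth (X n) i) \<longlonglongrightarrow> l" for i
    using Cauchy_convergent unfolding convergent_def by blast
  then obtain l where l: "\<And>i. (\<lambda>n. ell2_nth (X n) i) \<longlonglongrightarrow> l i"
    by metis
  have bound: "L2_set (\<lambda>i. norm (ell2_nth (X m) i - l i)) {..<k} \<le> e"
    if "\<And>n. n \<ge> M \<Longrightarrow> dist (X m) (X n) < e" for m M k e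
  proof (rule LIMSEQ_le_const2)
    show "(\<lambda>n. L2_set (\<lambda>i. norm (ell2_nth (X m) i - ell2_nth (X n) i)) {..<k})
        \<longlonglongrightarrow> L2_set (\<lambda>i. norm (ell2_nth (X m) i - l i)) {..<k}"
      unfolding L2_set_def by (intro tendsto_intros l)
    have "L2_set (\<lambda>i. norm (ell2_nth (X m) i - ell2_nth (X n) i)) {..<k} \<le> e" if "n \<ge> M" for n
      using L2_le[of "X m - X n" k] \<open>\<And>n. n \<ge> M \<Longrightarrow> dist (X m) (X n) < e\<close>[OF that]
      by (simp add: dist_ell2_def minus_ell2.rep_eq)
    then show "\<exists>N. \<forall>n\<ge>N. L2_set (\<lambda>i. norm (ell2_nth (X m) i - ell2_nth (X n) i)) {..<k} \<le> e"
      by blast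
  qed
  have summable_diff': "summable (\<lambda>i. (norm (ell2_nth (X m) i - l i))\<^sup>2)"
    if "\<And>n. n \<ge> M \<Longrightarrow> dist (X m) (X n) < e" for m M e
  proof (rule bounded_imp_summable)
    fix n
    have "L2_set (\<lambda>i. norm (ell2_nth (X m) i - l i)) {..<Suc n} \<le> e"
      by (rule bound) (rule that)
    then have "sqrt (\<Sum>i<Suc n. (norm (ell2_nth (X m) i - l i))\<^sup>2) \<le> e"
      by (simp add: L2_set_def)
    then have "(\<Sum>i<Suc n. (norm (ell2_nth (X m) i - l i))\<^sup>2) \<le> e\<^sup>2"
      by (rule sqrt_le_D)
    then show "(\<Sum>i\<le>n. (norm (ell2_nth (X m) i - l i))\<^sup>2) \<le> e\<^sup>2"
      by (simp add: lessThan_Suc_atMost)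
  qed simp
  obtain M1 where "\<forall>m\<ge>M1. \<forall>n\<ge>M1. dist (X m) (X n) < 1"
    using metric_CauchyD[OF X, of 1] by auto
  then have M1: "\<And>n. n \<ge> M1 \<Longrightarrow> dist (X M1) (X n) < 1"
    by blast
  have "summable (\<lambda>i. (norm (l i - ell2_nth (X M1) i))\<^sup>2)"
    using summable_diff'[of M1 M1 1, OF M1] by (simp add: norm_minus_commute)
  then have "summable (\<lambda>i. (norm (l i))\<^sup>2)"
    using summable_square_add[OF nth_summable[of "X M1"]] by fastforce
  then obtain L where L: "\<And>i. ell2_nth L i = l i"
    by (metis (mono_tags, lifting) Abs_ell2_inverse mem_Collect_eq)
  have "X \<longlonglongrightarrow> L"
  proof (rule LIMSEQ_I)
    fix r :: real assume "0 < r"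
    then obtain M where M: "\<And>m n. m \<ge> M \<Longrightarrow> n \<ge> M \<Longrightarrow> dist (X m) (X n) < r / 2"
      using X by (meson metric_CauchyD half_gt_zero)
    have "norm (X m - L) < r" if "m \<ge> M" for m
    proof -
      have "norm (X m - L) \<le> r / 2"
        unfolding norm_ell2.rep_eq minus_ell2.rep_eq L
        by (intro sqrt_suminf_le summable_diff'[of M _ "r / 2"] bound[of M] M that)
      then show ?thesis
        using \<open>0 < r\<close> by simp
    qed
    then show "\<exists>no. \<forall>n\<ge>no. norm (X n - L) < r"
      by blast
  qed
  then show "convergent X"
    by (auto simp: convergent_def)
qed

instantiation ell2 :: (complex_hilbert_space) complex_hilbert_space
begin

lift_definition scaleC_ell2 :: "complex \<Rightarrow> 'a ell2 \<Rightarrow> 'a ell2" is "\<lambda>c f i. c *\<^sub>C f i"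
  by (simp add: norm_scaleC power_mult_distrib summable_mult)
lift_definition cinner_ell2 :: "'a ell2 \<Rightarrow> 'a ell2 \<Rightarrow> complex" is "\<lambda>f g. \<Sum>i. cinner (f i) (g i)" .

instance
proof
  fix x y z :: "'a ell2" and c d :: complex and r :: real
  show "c *\<^sub>C (x + y) = c *\<^sub>C x + c *\<^sub>C y"
    by transfer (simp add: scaleC_add_right)
  show "(c + d) *\<^sub>C x = c *\<^sub>C x + d *\<^sub>C x"
    by transfer (simp add: scaleC_add_left)
  show "c *\<^sub>C d *\<^sub>C x = (c * d) *\<^sub>C x"
    by transfer (simp add: scaleC_scaleC)
  show "complex_of_real r *\<^sub>C x = r *\<^sub>R x"
    by transfer (simp add: scaleC_of_real)
  show "cinner x y = cnj (cinner y x)"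
  proof transfer
    fix f g :: "nat \<Rightarrow> 'a"
    assume f: "summable (\<lambda>i. (norm (f i))\<^sup>2)" and g: "summable (\<lambda>i. (norm (g i))\<^sup>2)"
    have "(\<lambda>i. cnj (cinner (g i) (f i))) sums cnj (\<Sum>i. cinner (g i) (f i))"
      unfolding sums_cnj by (intro summable_sums summable_cinner f g)
    then have "(\<lambda>i. cinner (f i) (g i)) sums cnj (\<Sum>i. cinner (g i) (f i))"
      by (subst cinner_commute)
    then show "(\<Sum>i. cinner (f i) (g i)) = cnj (\<Sum>i. cinner (g i) (f i))"
      by (rule sums_unique[symmetric])
  qed
  show "cinner x (y + z) = cinner x y + cinner x z"
    by transfer (simp add: cinner_add_right suminf_add summable_cinner)
  show "cinner x (c *\<^sub>C y) = c * cinner x y"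
    by transfer (simp add: cinner_scaleC_right suminf_mult summable_cinner)
  show "cinner x x = complex_of_real ((norm x)\<^sup>2)"
    by transfer (simp add: cinner_self suminf_of_real suminf_nonneg del: of_real_power)
qed

end

section \<open>Coordinates, amplifications and the bicommutant\<close>

lift_definition ell2_single :: "nat \<Rightarrow> 'h \<Rightarrow> 'h::complex_hilbert_space ell2" is
  "\<lambda>j x i. if i = j then x else 0"
proof -
  fix j and x :: 'h
  show "summable (\<lambda>i. (norm (if i = j then x else 0))\<^sup>2)"
    by (rule summable_finite[of "{j}"]) auto
qed

lemma ell2_nth_summable: "summable (\<lambda>i. (norm (ell2_nth x i))\<^sup>2)"
  by transfer

lemma norm_ell2_nth_le: "norm (ell2_nth x i) \<le> norm x"
proof -
  have "L2_set (\<lambda>i. norm (ell2_nth x i)) {..<Suc i} \<le> norm x"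
    by transfer (rule L2_set_le_sqrt_suminf)
  then show ?thesis
    using member_le_L2_set[of "{..<Suc i}" i "\<lambda>i. norm (ell2_nth x i)"] by simp
qed

lemma cinner_ell2_single: "cinner (ell2_single j x) z = cinner x (ell2_nth z j)"
proof -
  have "(\<lambda>i. cinner (ell2_nth (ell2_single j x) i) (ell2_nth z i)) sums
      (\<Sum>i\<in>{j}. cinner (ell2_nth (ell2_single j x) i) (ell2_nth z i))"
    by (rule sums_finite) (auto simp: ell2_single.rep_eq)
  then show ?thesis
    by (simp add: cinner_ell2.rep_eq sums_iff ell2_single.rep_eq)
qed

lemma norm_ell2_single: "norm (ell2_single j x) = norm x"
proof -
  have "cinner (ell2_single j x) (ell2_single j x) = cinner x x"
    by (simp add: cinner_ell2_single ell2_single.rep_eq)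
  then have "(norm (ell2_single j x))\<^sup>2 = (norm x)\<^sup>2"
    by (simp add: norm_eq_cinner)
  then show ?thesis
    by simp
qed

lemma ell2_eqI: "(\<And>i. ell2_nth x i = ell2_nth y i) \<Longrightarrow> x = y"
  by (metis ell2_nth_inject ext)

lemma ell2_single_linear:
  "ell2_single j (x + y) = ell2_single j x + ell2_single j y"
  "ell2_single j (c *\<^sub>C x) = c *\<^sub>C ell2_single j x"
  by (rule ell2_eqI; simp add: ell2_single.rep_eq plus_ell2.rep_eq scaleC_ell2.rep_eq)+

lemma ell2_single_dense: "dense_family UNIV (\<lambda>(j, x). ell2_single j x)"
proof (rule dense_familyI)
  fix z :: "'h::complex_hilbert_space ell2"
  assume *: "\<And>i. i \<in> UNIV \<Longrightarrow> cinner (case i of (j, x) \<Rightarrow> ell2_single j x) z = 0"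
  have "ell2_nth z j = 0" for j
    using *[of "(j, ell2_nth z j)"] by (simp add: cinner_ell2_single)
  then show "z = 0"
    by (intro ell2_eqI) (simp add: zero_ell2.rep_eq)
qed

text \<open>The operator A \<otimes> 1 acting on every coordinate. It is meaningful for bounded
  \<open>A\<close>, which preserve square summability; otherwise \<open>Abs_ell2\<close> may return
  an unspecified value.\<close>

definition amplification :: "('h \<Rightarrow> 'h) \<Rightarrow> 'h::complex_hilbert_space ell2 \<Rightarrow> 'h ell2" where
  "amplification A x = Abs_ell2 (\<lambda>i. A (ell2_nth x i))"

context
  fixes A :: "'h::complex_hilbert_space \<Rightarrow> 'h"
  assumes A: "A \<in> bounded_operators"
begin

lemma amplification_summable_le:
  assumes "\<And>x. norm (A x) \<le> norm x * C"
  shows "summable (\<lambda>i. (norm (A (ell2_nth x i)))\<^sup>2)"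
    and "(\<Sum>i. (norm (A (ell2_nth x i)))\<^sup>2) \<le> (\<Sum>i. (norm (ell2_nth x i))\<^sup>2) * C\<^sup>2"
proof -
  have le: "(norm (A y))\<^sup>2 \<le> (norm y)\<^sup>2 * C\<^sup>2" for y
    unfolding power_mult_distrib[symmetric] by (intro power_mono assms) simp
  have s: "summable (\<lambda>i. (norm (ell2_nth x i))\<^sup>2 * C\<^sup>2)"
    by (intro summable_mult2 ell2_nth_summable)
  show 1: "summable (\<lambda>i. (norm (A (ell2_nth x i)))\<^sup>2)"
    by (rule summable_comparison_test[OF _ s]) (simp add: le)
  show "(\<Sum>i. (norm (A (ell2_nth x i)))\<^sup>2) \<le> (\<Sum>i. (norm (ell2_nth x i))\<^sup>2) * C\<^sup>2"
    unfolding suminf_mult2[OF ell2_nth_summable] by (intro suminf_le le 1 s)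
qed

lemma ell2_nth_amplification: "ell2_nth (amplification A x) i = A (ell2_nth x i)"
proof -
  obtain C where "\<And>x. norm (A x) \<le> norm x * C"
    using bounded_linear.bounded[OF bounded_operators_bounded_linear[OF A]] by blast
  then show ?thesis
    unfolding amplification_def by (subst Abs_ell2_inverse) (auto intro: amplification_summable_le)
qed

lemma amplification_bounded: "amplification A \<in> bounded_operators"
proof -
  obtain C where C: "\<And>x. norm (A x) \<le> norm x * C"
    using bounded_linear.bounded[OF bounded_operators_bounded_linear[OF A]] by blast
  have scale: "amplification A (c *\<^sub>C x) = c *\<^sub>C amplification A x" for c x
    by (rule ell2_eqI) (simp add: ell2_nth_amplification scaleC_ell2.rep_eq bounded_operators_scaleC[OF A])
  have "bounded_linear (amplification A)"
  proof (rule bounded_linear_intro)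
    show "amplification A (x + y) = amplification A x + amplification A y" for x y
      by (rule ell2_eqI) (simp add: ell2_nth_amplification plus_ell2.rep_eq bounded_operators_add[OF A])
    show "amplification A (r *\<^sub>R x) = r *\<^sub>R amplification A x" for r x
      by (simp add: scaleR_scaleC scale)
    show "norm (amplification A x) \<le> norm x * \<bar>C\<bar>" for x
      using real_sqrt_le_mono[OF amplification_summable_le(2)[OF C, of x]]
      by (simp add: norm_ell2.rep_eq ell2_nth_amplification real_sqrt_mult)
  qed
  then show ?thesis
    by (simp add: bounded_operators_def scale)
qed

end

text \<open>Von Neumann's argument: the projection onto the closed span of the orbit of \<open>\<eta>\<close> in \<open>\<ell>\<^sup>2(H)\<close> has
  matrix entries in the commutant of \<open>P\<close>, so it commutes with the amplification of \<open>A\<close>.\<close>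

theorem normal_functional_vanishes_on_bicommutant:
  fixes P :: "('h::complex_hilbert_space \<Rightarrow> 'h) set"
  assumes P: "P \<subseteq> bounded_operators" and P_id: "(\<lambda>x. x) \<in> P"
    and P_comp: "\<And>p q. p \<in> P \<Longrightarrow> q \<in> P \<Longrightarrow> (\<lambda>x. p (q x)) \<in> P"
    and P_adj: "\<And>p. p \<in> P \<Longrightarrow> \<exists>q\<in>P. \<forall>x y. cinner (q x) y = cinner x (p y)"
    and A: "A \<in> commutant (commutant P)"
    and \<xi>: "summable (\<lambda>i. (norm (\<xi> i))\<^sup>2)" and \<eta>: "summable (\<lambda>i. (norm (\<eta> i))\<^sup>2)"
    and vanish: "\<And>p. p \<in> P \<Longrightarrow> (\<Sum>i. cinner (\<xi> i) (p (\<eta> i))) = 0"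
  shows "(\<Sum>i. cinner (\<xi> i) (A (\<eta> i))) = 0"
proof -
  have A': "A \<in> bounded_operators"
    using A commutant_bounded by blast
  note Pb = subsetD[OF P]
  \<comment> \<open>The sum in question is now \<open>cinner x (amplification A y)\<close>.\<close>
  define x y where "x = Abs_ell2 \<xi>" and "y = Abs_ell2 \<eta>"
  have x: "ell2_nth x i = \<xi> i" and y: "ell2_nth y i = \<eta> i" for i
    using \<xi> \<eta> by (simp_all add: x_def y_def Abs_ell2_inverse)
  define K where "K = closure (complex_vector.span ((\<lambda>p. amplification p y) ` P))"
  have K: "complex_vector.subspace K" "closed K"
    by (simp_all add: K_def closure_span_subspace)
  have K_induct: "Q z" if "z \<in> K" "closed {z. Q z}" "Q 0" "\<And>u v. Q u \<Longrightarrow> Q v \<Longrightarrow> Q (u + v)"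
    "\<And>c u. Q u \<Longrightarrow> Q (c *\<^sub>C u)" "\<And>p. p \<in> P \<Longrightarrow> Q (amplification p y)" for z Q
  proof -
    have "complex_vector.span ((\<lambda>p. amplification p y) ` P) \<subseteq> {z. Q z}"
      by (intro complex_vector.span_minimal complex_vector.subspaceI) (use that in auto)
    then have "K \<subseteq> {z. Q z}"
      unfolding K_def by (rule closure_minimal) (rule that)
    then show ?thesis
      using that(1) by auto
  qed
  have orbit: "amplification p y \<in> K" if "p \<in> P" for p
    unfolding K_def
    by (rule subsetD[OF closure_subset], rule complex_vector.span_base, rule imageI, rule that)
  have invariant: "amplification p z \<in> K" if "p \<in> P" "z \<in> K" for p z
    using that(2)
  proof (rule K_induct[where Q = "\<lambda>z. amplification p z \<in> K"])
    note p = amplification_bounded[OF Pb[OF that(1)]]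
    show "closed {z. amplification p z \<in> K}"
      using continuous_closed_vimage[OF K(2), of "amplification p"] linear_continuous_at[OF bounded_operators_bounded_linear[OF p]]
      by (simp add: vimage_def)
    show "amplification p 0 \<in> K"
      by (simp add: bounded_operators_zero[OF p] complex_vector.subspace_0[OF K(1)])
    show "amplification p (u + v) \<in> K" if "amplification p u \<in> K" "amplification p v \<in> K" for u v
      using that by (simp add: bounded_operators_add[OF p] complex_vector.subspace_add[OF K(1)])
    show "amplification p (c *\<^sub>C u) \<in> K" if "amplification p u \<in> K" for c u
      using that by (simp add: bounded_operators_scaleC[OF p] complex_vector.subspace_scale[OF K(1)])
    show "amplification p (amplification q y) \<in> K" if q: "q \<in> P" for q
    proof -
      have "amplification p (amplification q y) = amplification (\<lambda>x. p (q x)) y"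
        using \<open>p \<in> P\<close> q by (intro ell2_eqI) (simp add: ell2_nth_amplification Pb P_comp)
      then show ?thesis
        using orbit[OF P_comp[OF \<open>p \<in> P\<close> q]] by simp
    qed
  qed
  define Q where "Q z = (SOME u. u \<in> K \<and> (\<forall>v\<in>K. cinner v (z - u) = 0))" for z
  have Q': "Q z \<in> K \<and> (\<forall>v\<in>K. cinner v (z - Q z) = 0)" for z
  proof -
    have "\<exists>u. u \<in> K \<and> (\<forall>v\<in>K. cinner v (z - u) = 0)"
      by (rule orthogonal_projection_exists[OF K, of z]) auto
    then show ?thesis
      unfolding Q_def by (rule someI_ex)
  qed
  have Q: "Q z \<in> K" "v \<in> K \<Longrightarrow> cinner v (z - Q z) = 0" for z v
    using Q'[of z] by blast+
  have Q_eqI: "Q z = u" if u: "u \<in> K" "\<And>v. v \<in> K \<Longrightarrow> cinner v (z - u) = 0" for z u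
  proof -
    have d: "Q z - u \<in> K"
      by (intro complex_vector.subspace_diff[OF K(1)] Q u)
    have "cinner (Q z - u) ((z - u) - (z - Q z)) = 0"
      using Q(2)[OF d, of z] u(2)[OF d] by (subst cinner_diff_right) simp
    then have "cinner (Q z - u) (Q z - u) = 0"
      by simp
    then show ?thesis
      by simp
  qed
  have Q_scale: "Q (c *\<^sub>C z) = c *\<^sub>C Q z" for c z
    by (rule Q_eqI) (auto simp: complex_vector.scale_right_diff_distrib[symmetric] cinner_scaleC_right Q
        intro: complex_vector.subspace_scale[OF K(1)])
  have Q_add: "Q (z + w) = Q z + Q w" for z w
  proof (rule Q_eqI)
    fix v assume "v \<in> K"
    then have "cinner v ((z - Q z) + (w - Q w)) = 0"
      by (simp only: cinner_add_right Q) simp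
    then show "cinner v (z + w - (Q z + Q w)) = 0"
      by (simp add: algebra_simps)
  qed (intro complex_vector.subspace_add[OF K(1)] Q)
  have Q_norm: "norm (Q z) \<le> norm z" for z
  proof -
    have "cinner (Q z) (Q z) = cinner (Q z) z"
      using Q(2)[OF Q(1)[of z], of z] by (simp add: cinner_diff_right)
    then have "norm (Q z) * norm (Q z) = Re (cinner (Q z) z)"
      by (metis norm_eq_cinner power2_eq_square)
    also have "\<dots> \<le> norm (Q z) * norm z"
      using complex_Re_le_cmod norm_cinner_le order_trans by blast
    finally show ?thesis
      by (cases "norm (Q z) = 0") (simp_all add: mult_le_cancel_left)
  qed
  have Q_bounded: "Q \<in> bounded_operators"
    unfolding bounded_operators_def
    by (auto intro!: bounded_linear_intro[of _ 1] simp: Q_add scaleR_scaleC Q_scale Q_norm)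
  \<comment> \<open>The projection commutes with the amplification of \<open>p\<close> because the
    adjoint \<open>q\<close> also lies in \<open>P\<close> and leaves \<open>K\<close>
    invariant.\<close>
  have QP: "Q (amplification p z) = amplification p (Q z)" if p: "p \<in> P" for p z
  proof (rule Q_eqI)
    note pb = amplification_bounded[OF Pb[OF p]]
    show "amplification p (Q z) \<in> K"
      by (intro invariant p Q)
    fix v assume v: "v \<in> K"
    obtain q where q: "q \<in> P" "\<And>x y. cinner (q x) y = cinner x (p y)"
      using P_adj[OF p] by blast
    have "cinner v (amplification p w) = cinner (amplification q v) w" for w
      by (simp add: cinner_ell2.rep_eq ell2_nth_amplification Pb p q)
    then show "cinner v (amplification p z - amplification p (Q z)) = 0"
      using Q(2)[OF invariant[OF q(1) v], of z] by (simp add: cinner_diff_right)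
  qed
  define T where "T i j u = ell2_nth (Q (ell2_single j u)) i" for i j and u :: 'h
  have T: "T i j \<in> commutant P" for i j
  proof (rule commutantI)
    have scale: "T i j (c *\<^sub>C u) = c *\<^sub>C T i j u" for c u
      by (simp add: T_def ell2_single_linear Q_scale scaleC_ell2.rep_eq)
    have "bounded_linear (T i j)"
    proof (rule bounded_linear_intro)
      show "T i j (u + v) = T i j u + T i j v" for u v
        by (simp add: T_def ell2_single_linear Q_add plus_ell2.rep_eq)
      show "T i j (r *\<^sub>R u) = r *\<^sub>R T i j u" for r u
        by (simp add: scaleR_scaleC scale)
      show "norm (T i j u) \<le> norm u * 1" for u
        using norm_ell2_nth_le[of "Q (ell2_single j u)" i] Q_norm[of "ell2_single j u"]
        by (simp add: T_def norm_ell2_single)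
    qed
    then show "T i j \<in> bounded_operators"
      by (simp add: bounded_operators_def scale)
    fix p u assume p: "p \<in> P"
    have "ell2_single j (p u) = amplification p (ell2_single j u)"
      using p by (intro ell2_eqI)
        (simp add: ell2_nth_amplification Pb ell2_single.rep_eq bounded_operators_zero)
    then show "T i j (p u) = p (T i j u)"
      using p by (simp add: T_def QP ell2_nth_amplification Pb)
  qed
  \<comment> \<open>It suffices to compare on vectors with one nonzero coordinate, where the claim
    says that \<open>A\<close> commutes with each matrix entry \<open>T i j\<close>.\<close>
  have "Q (amplification A z) = amplification A (Q z)" for z
  proof (rule eq_on_dense_family[OF ell2_single_dense, where A = "\<lambda>z. Q (amplification A z)"
        and B = "\<lambda>z. amplification A (Q z)"])
    fix ju :: "nat \<times> 'h" assume "ju \<in> UNIV"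
    obtain j u where ju: "ju = (j, u)"
      by (cases ju)
    have "amplification A (ell2_single j u) = ell2_single j (A u)"
      by (intro ell2_eqI)
        (simp add: ell2_nth_amplification A' ell2_single.rep_eq bounded_operators_zero)
    moreover have "Q (ell2_single j (A u)) = amplification A (Q (ell2_single j u))"
    proof (rule ell2_eqI)
      show "ell2_nth (Q (ell2_single j (A u))) i = ell2_nth (amplification A (Q (ell2_single j u))) i" for i
        using commutantD[OF A T, of i j u] by (simp add: ell2_nth_amplification A' T_def)
    qed
    ultimately show "Q (amplification A (case ju of (j, x) \<Rightarrow> ell2_single j x)) =
        amplification A (Q (case ju of (j, x) \<Rightarrow> ell2_single j x))"
      by (simp add: ju)
  qed (rule bounded_operators_comp[OF Q_bounded amplification_bounded[OF A']]
        bounded_operators_comp[OF amplification_bounded[OF A'] Q_bounded])+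
  \<comment> \<open>The identity in \<open>P\<close> puts \<open>y\<close> in its own orbit. Hence
    \<open>amplification A y\<close> lies in \<open>K\<close>, where the functional
    \<open>cinner x\<close> vanishes.\<close>
  moreover have "Q y = y"
  proof (rule Q_eqI)
    have "amplification (\<lambda>x. x) y = y"
      by (rule ell2_eqI) (simp add: ell2_nth_amplification bounded_operators_id)
    then show "y \<in> K"
      using orbit[OF P_id] by simp
  qed simp
  ultimately have "amplification A y \<in> K"
    using Q(1)[of "amplification A y"] by simp
  then have "cinner x (amplification A y) = 0"
  proof (rule K_induct[where Q = "\<lambda>z. cinner x z = 0"])
    show "closed {z. cinner x z = 0}"
      by (intro closed_Collect_eq continuous_intros)
    show "cinner x (amplification p y) = 0" if "p \<in> P" for p
      using vanish[OF that] that by (simp add: cinner_ell2.rep_eq ell2_nth_amplification Pb x y)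
  qed (simp_all add: cinner_add_right cinner_scaleC_right)
  then show ?thesis
    by (simp add: cinner_ell2.rep_eq ell2_nth_amplification A' x y)
qed

section \<open>Square integrable functions on the half line\<close>

lemma space_halfline [simp]: "space halfline = {0..}"
  by (simp add: space_restrict_space)

lemma integrable_halfline_iff:
  fixes f :: "real \<Rightarrow> 'b::{banach, second_countable_topology}"
  shows "integrable halfline f \<longleftrightarrow> integrable lborel (\<lambda>x. indicator {0..} x *\<^sub>R f x)"
  by (rule integrable_restrict_space) simp

lemma integral_halfline_eq:
  fixes f :: "real \<Rightarrow> 'b::{banach, second_countable_topology}"
  shows "integral\<^sup>L halfline f = (LINT x|lborel. indicator {0..} x *\<^sub>R f x)"
  by (rule integral_restrict_space) simp

lemma measurable_halfline_iff:
  fixes f :: "real \<Rightarrow> 'b::real_normed_vector"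
  shows "f \<in> borel_measurable halfline \<longleftrightarrow> (\<lambda>x. indicator {0..} x *\<^sub>R f x) \<in> borel_measurable borel"
  using borel_measurable_restrict_space_iff[of "{0..}" lborel f] by simp

text \<open>Square integrability is moved to the cut-off function on the whole line, where Lebesgue
  measure is translation invariant.\<close>

lemma L2_halfline_iff:
  fixes f :: "real \<Rightarrow> 'v::real_normed_vector"
  shows "f \<in> L2_halfline \<longleftrightarrow> (\<lambda>x. indicator {0..} x *\<^sub>R f x) \<in> borel_measurable borel \<and>
    integrable lborel (\<lambda>x. (norm (indicator {0..} x *\<^sub>R f x))\<^sup>2)"
proof -
  have "(\<lambda>x. indicator {0..} x *\<^sub>R (norm (f x))\<^sup>2) = (\<lambda>x. (norm (indicator {0..} x *\<^sub>R f x))\<^sup>2)"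
    by (auto simp: fun_eq_iff indicator_def)
  then show ?thesis
    unfolding L2_halfline_def measurable_halfline_iff integrable_halfline_iff by simp
qed

lemma L2_halfline_comparison:
  fixes f :: "real \<Rightarrow> 'v::real_normed_vector" and g :: "real \<Rightarrow> 'w::real_normed_vector"
  assumes "f \<in> L2_halfline" "g \<in> borel_measurable halfline" "\<And>s. 0 \<le> s \<Longrightarrow> norm (g s) \<le> C * norm (f s)"
  shows "g \<in> L2_halfline"
proof -
  have [measurable]: "g \<in> borel_measurable halfline"
    by (rule assms)
  have "integrable halfline (\<lambda>s. (norm (g s))\<^sup>2)"
  proof (rule Bochner_Integration.integrable_bound)
    show "integrable halfline (\<lambda>s. C\<^sup>2 * (norm (f s))\<^sup>2)"
      using assms(1) by (simp add: L2_halfline_def)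
    show "AE s in halfline. norm ((norm (g s))\<^sup>2) \<le> norm (C\<^sup>2 * (norm (f s))\<^sup>2)"
    proof (rule AE_I2)
      fix s assume "s \<in> space halfline"
      then have "(norm (g s))\<^sup>2 \<le> (C * norm (f s))\<^sup>2"
        by (intro power_mono assms) auto
      then show "norm ((norm (g s))\<^sup>2) \<le> norm (C\<^sup>2 * (norm (f s))\<^sup>2)"
        by (simp add: power_mult_distrib)
    qed
  qed measurable
  then show ?thesis
    using assms(2) by (simp add: L2_halfline_def)
qed

lemma L2_halfline_compose:
  fixes f :: "real \<Rightarrow> 'v::real_normed_vector" and h :: "'v \<Rightarrow> 'w::real_normed_vector"
  assumes "f \<in> L2_halfline" "bounded_linear h"
  shows "(\<lambda>s. h (f s)) \<in> L2_halfline"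
proof -
  have f: "f \<in> borel_measurable halfline"
    using assms(1) by (simp add: L2_halfline_def)
  obtain K where K: "\<And>x. norm (h x) \<le> norm x * K"
    using bounded_linear.bounded[OF assms(2)] by blast
  show ?thesis
  proof (rule L2_halfline_comparison[OF assms(1)])
    have "h \<in> borel_measurable borel"
      by (intro borel_measurable_continuous_onI linear_continuous_on assms)
    then show "(\<lambda>s. h (f s)) \<in> borel_measurable halfline"
      by (rule measurable_compose[OF f])
    show "norm (h (f s)) \<le> K * norm (f s)" for s
      using K[of "f s"] by (simp add: mult.commute)
  qed
qed

lemma L2_halfline_sign:
  fixes f :: "real \<Rightarrow> 'v::{real_normed_vector, second_countable_topology}"
  assumes "f \<in> L2_halfline" and [measurable]: "\<phi> \<in> borel_measurable borel" and "\<And>s. \<bar>\<phi> s\<bar> \<le> C"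
  shows "(\<lambda>s. \<phi> s *\<^sub>R f s) \<in> L2_halfline"
proof -
  have [measurable]: "f \<in> borel_measurable halfline" "\<phi> \<in> borel_measurable halfline"
    using assms(1) by (simp_all add: L2_halfline_def measurable_restrict_space1)
  show ?thesis
    by (rule L2_halfline_comparison[OF assms(1), of _ C]) (auto intro: mult_right_mono assms)
qed

lemma lborel_translate_measurable:
  fixes f :: "real \<Rightarrow> 'v::topological_space"
  shows "f \<in> borel_measurable borel \<Longrightarrow> (\<lambda>s. f (s + t)) \<in> borel_measurable borel"
  by (rule measurable_compose[where f = "\<lambda>s. s + t" and N = borel]) simp_all

lemma L2_halfline_shift:
  fixes f :: "real \<Rightarrow> 'v::real_normed_vector"
  assumes f: "f \<in> L2_halfline" and t: "0 \<le> t"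
  shows "shift t f \<in> L2_halfline"
proof -
  let ?f = "\<lambda>x. indicator {0..} x *\<^sub>R f x"
  have eq: "indicator {0..} s *\<^sub>R shift t f s = ?f (s + (- t))" for s
    using t by (auto simp: shift_def indicator_def)
  have "integrable lborel (\<lambda>s. (norm (?f (- t + 1 * s)))\<^sup>2)"
    using f by (intro lborel_integrable_real_affine) (auto simp: L2_halfline_iff)
  then show ?thesis
    using f lborel_translate_measurable[of ?f "- t"]
    unfolding L2_halfline_iff eq by (simp add: add.commute)
qed

text \<open>The backward shift; it is used to write the part of a function after time
  \<open>t\<close> as a forward shift.\<close>

lemma L2_halfline_unshift:
  fixes f :: "real \<Rightarrow> 'v::{real_normed_vector, second_countable_topology}"
  assumes f: "f \<in> L2_halfline" and t: "0 \<le> t"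
  shows "(\<lambda>s. f (s + t)) \<in> L2_halfline"
proof -
  let ?f = "\<lambda>x. indicator {0..} x *\<^sub>R f x"
  have eq: "indicator {0..} s *\<^sub>R f (s + t) = indicator {0..} s *\<^sub>R ?f (s + t)"
    "(norm (indicator {0..} s *\<^sub>R ?f (s + t)))\<^sup>2 = indicator {0..} s *\<^sub>R (norm (?f (s + t)))\<^sup>2" for s
    using t by (auto simp: indicator_def)
  have "integrable lborel (\<lambda>s. (norm (?f (t + 1 * s)))\<^sup>2)"
    using f by (intro lborel_integrable_real_affine) (auto simp: L2_halfline_iff)
  then have "integrable lborel (\<lambda>s. indicator {0..} s *\<^sub>R (norm (?f (s + t)))\<^sup>2)"
    by (intro integrable_mult_indicator) (simp_all add: add.commute)
  moreover have "(\<lambda>s. ?f (s + t)) \<in> borel_measurable borel"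
    using f lborel_translate_measurable[of ?f t] by (simp add: L2_halfline_iff)
  then have "(\<lambda>s. indicator {0..} s *\<^sub>R ?f (s + t)) \<in> borel_measurable borel"
    by (rule borel_measurable_scaleR[rotated]) simp
  ultimately show ?thesis
    unfolding L2_halfline_iff eq by blast
qed

section \<open>The inner product of the complexified one-particle space\<close>

lemma complexified_inner_add_left:
  "complexified_inner (v + v') w = complexified_inner v w + complexified_inner v' w"
  by (simp add: complexified_inner_def complex_eq_iff inner_add_left inner_add_right)

lemma complexified_inner_scaleR:
  "complexified_inner (r *\<^sub>R v) w = of_real r * complexified_inner v w"
  "complexified_inner v (r *\<^sub>R w) = of_real r * complexified_inner v w"
  by (simp_all add: complexified_inner_def complex_eq_iff algebra_simps)

text \<open>The form is conjugate linear on the left, so the imaginary part of \<open>v\<close>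
  enters with -i.\<close>

lemma complexified_inner_split:
  "complexified_inner v w = complexified_inner (fst v, 0) w - \<i> * complexified_inner (snd v, 0) w"
  by (simp add: complexified_inner_def complex_eq_iff)

text \<open>The imaginary part is the real inner product of \<open>v\<close> with -i times
  \<open>w\<close>, that is with \<open>(snd w, - fst w)\<close>, so Cauchy-Schwarz bounds both
  parts. A sum of squares is the form in which integrability is checked.\<close>

lemma norm_complexified_inner_le: "cmod (complexified_inner v w) \<le> (norm v)\<^sup>2 + (norm w)\<^sup>2"
proof -
  have "\<bar>inner v w\<bar> \<le> norm v * norm w" "\<bar>inner v (snd w, - fst w)\<bar> \<le> norm v * norm (snd w, - fst w)"
    by (rule Cauchy_Schwarz_ineq2)+
  moreover have "norm (snd w, - fst w) = norm w"
    by (cases w) (simp add: norm_Pair add.commute)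
  moreover have "cmod (complexified_inner v w) \<le>
      \<bar>Re (complexified_inner v w)\<bar> + \<bar>Im (complexified_inner v w)\<bar>"
    by (rule cmod_le)
  moreover have "Re (complexified_inner v w) = inner v w"
    "Im (complexified_inner v w) = inner v (snd w, - fst w)"
    by (simp_all add: complexified_inner_def inner_prod_def)
  moreover have "2 * (norm v * norm w) \<le> (norm v)\<^sup>2 + (norm w)\<^sup>2"
    using sum_squares_bound[of "norm v" "norm w"] by (simp add: mult.assoc)
  ultimately show ?thesis
    by simp
qed

lemma complexified_inner_integrable:
  fixes f g :: "real \<Rightarrow> 'k::{real_inner, second_countable_topology} \<times> 'k"
  assumes f: "f \<in> L2_halfline" and g: "g \<in> L2_halfline"
  shows "integrable halfline (\<lambda>s. complexified_inner (f s) (g s))"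
proof (rule Bochner_Integration.integrable_bound)
  have f': "f \<in> borel_measurable halfline" and g': "g \<in> borel_measurable halfline"
    using f g by (simp_all add: L2_halfline_def)
  note comp = measurable_compose[OF f' borel_measurable_continuous_onI]
    measurable_compose[OF g' borel_measurable_continuous_onI]
  have [measurable]: "(\<lambda>s. fst (f s)) \<in> borel_measurable halfline" "(\<lambda>s. snd (f s)) \<in> borel_measurable halfline"
    "(\<lambda>s. fst (g s)) \<in> borel_measurable halfline" "(\<lambda>s. snd (g s)) \<in> borel_measurable halfline"
    by (auto intro!: comp continuous_intros)
  show "(\<lambda>s. complexified_inner (f s) (g s)) \<in> borel_measurable halfline"
    unfolding complexified_inner_def borel_measurable_complex_iff by simp
  show "integrable halfline (\<lambda>s. (norm (f s))\<^sup>2 + (norm (g s))\<^sup>2)"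
    using f g by (simp add: L2_halfline_def)
  show "AE s in halfline. cmod (complexified_inner (f s) (g s)) \<le> norm ((norm (f s))\<^sup>2 + (norm (g s))\<^sup>2)"
    by (intro AE_I2) (simp add: norm_complexified_inner_le)
qed

lemma L2_inner_add_left:
  fixes f f' g :: "real \<Rightarrow> 'k::{real_inner, second_countable_topology} \<times> 'k"
  assumes "f \<in> L2_halfline" "f' \<in> L2_halfline" "g \<in> L2_halfline"
  shows "L2_inner (\<lambda>s. f s + f' s) g = L2_inner f g + L2_inner f' g"
  unfolding L2_inner_def complexified_inner_add_left
  by (intro Bochner_Integration.integral_add complexified_inner_integrable assms)

definition embed_real :: "(real \<Rightarrow> 'k::real_inner) \<Rightarrow> real \<Rightarrow> 'k \<times> 'k" where
  "embed_real f = (\<lambda>s. (f s, 0))"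

lemma embed_real_L2: "f \<in> L2_halfline \<Longrightarrow> embed_real f \<in> L2_halfline"
  unfolding embed_real_def
  by (rule L2_halfline_compose[where h = "\<lambda>x. (x, 0)"]) (auto intro: bounded_linear_intros)

lemma fst_L2: "f \<in> L2_halfline \<Longrightarrow> (\<lambda>s. fst (f s)) \<in> L2_halfline"
  and snd_L2: "f \<in> L2_halfline \<Longrightarrow> (\<lambda>s. snd (f s)) \<in> L2_halfline"
  by (rule L2_halfline_compose; auto intro: bounded_linear_intros)+

lemma L2_inner_split:
  fixes f g :: "real \<Rightarrow> 'k::{real_inner, second_countable_topology} \<times> 'k"
  assumes f: "f \<in> L2_halfline" and g: "g \<in> L2_halfline"
  shows "L2_inner f g = L2_inner (embed_real (\<lambda>s. fst (f s))) g
    + (- \<i>) * L2_inner (embed_real (\<lambda>s. snd (f s))) g"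
proof -
  have "integrable halfline (\<lambda>s. complexified_inner (fst (f s), 0) (g s))"
    "integrable halfline (\<lambda>s. complexified_inner (snd (f s), 0) (g s))"
    using complexified_inner_integrable[OF embed_real_L2[OF fst_L2[OF f]] g]
      complexified_inner_integrable[OF embed_real_L2[OF snd_L2[OF f]] g]
    by (simp_all add: embed_real_def)
  moreover have "L2_inner f g = (LINT s|halfline. complexified_inner (fst (f s), 0) (g s) -
      \<i> * complexified_inner (snd (f s), 0) (g s))"
    unfolding L2_inner_def by (subst complexified_inner_split) simp
  ultimately show ?thesis
    by (simp add: L2_inner_def embed_real_def)
qed

text \<open>This symmetry on real vectors makes left and right multiplication by fields compatible;
  see \<open>field_difference_anticommute\<close>.\<close>

lemma L2_inner_embed_real_commute:
  "L2_inner (embed_real f) (embed_real g) = L2_inner (embed_real g) (embed_real f)"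
  by (simp add: L2_inner_def embed_real_def complexified_inner_def inner_commute)

lemma L2_inner_sign:
  assumes "\<And>s. \<phi> s * \<phi> s = 1"
  shows "L2_inner (\<lambda>s. \<phi> s *\<^sub>R f s) (\<lambda>s. \<phi> s *\<^sub>R g s) = L2_inner f g"
proof -
  have *: "complex_of_real (\<phi> s) * (complex_of_real (\<phi> s) * z) = z" for s z
    by (metis assms mult.assoc mult_1 of_real_1 of_real_mult)
  then show ?thesis
    by (simp only: L2_inner_def complexified_inner_scaleR *)
qed

section \<open>A weakly null sequence of sign functions\<close>

definition sign_at :: "real \<Rightarrow> real \<Rightarrow> real" where
  "sign_at r x = (if x < r then 1 else - 1)"

text \<open>It alternates between 1 and -1 on intervals of length \<open>h\<close> up to
  \<open>m * h\<close> and is constant afterwards. The product form matches what is known about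
  cocycles, namely invariance under one sign function at a time.\<close>

definition square_wave :: "real \<Rightarrow> nat \<Rightarrow> real \<Rightarrow> real" where
  "square_wave h m x = (\<Prod>j\<in>{1..m}. sign_at (real j * h) x)"

lemma sign_at_measurable [measurable]: "sign_at r \<in> borel_measurable borel"
  unfolding sign_at_def by measurable

lemma square_wave_measurable [measurable]: "square_wave h m \<in> borel_measurable borel"
  unfolding square_wave_def by measurable

lemma sign_at_square: "sign_at r x * sign_at r x = 1"
  by (simp add: sign_at_def)

lemma square_wave_square: "square_wave h m x * square_wave h m x = 1"
  by (simp add: square_wave_def prod.distrib[symmetric] sign_at_square)

lemma abs_square_wave: "\<bar>square_wave h m x\<bar> = 1"
  unfolding square_wave_def abs_prod by (intro prod.neutral) (simp add: sign_at_def)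

lemma square_wave_Suc: "square_wave h (Suc m) x = square_wave h m x * sign_at (real (Suc m) * h) x"
  by (simp add: square_wave_def)

lemma square_wave_tail:
  assumes "0 \<le> h" "real m * h \<le> x"
  shows "square_wave h m x = (- 1) ^ m"
proof -
  have "sign_at (real j * h) x = - 1" if "j \<in> {1..m}" for j
  proof -
    have "real j * h \<le> real m * h"
      using that assms by (intro mult_right_mono) auto
    then show ?thesis
      using assms by (simp add: sign_at_def)
  qed
  then show ?thesis
    by (simp add: square_wave_def)
qed

text \<open>The primitive is a triangle wave with values between 0 and \<open>h\<close>. Its value
  at the right end of the range is recorded because the induction step continues from there.\<close>

lemma square_wave_has_integral:
  assumes h: "0 < h"
  shows "x \<in> {0..real (Suc m) * h} \<Longrightarrow> \<exists>G. (square_wave h m has_integral G) {0..x} \<and> G \<in> {0..h} \<and>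
    (x = real (Suc m) * h \<longrightarrow> G = (if even m then h else 0))"
proof (induction m arbitrary: x)
  case 0
  have "((\<lambda>x. 1 :: real) has_integral x) {0..x}"
    using has_integral_const_real[of "1 :: real" 0 x] 0 by simp
  then show ?case
    using 0 by (intro exI[of _ x]) (simp add: square_wave_def[abs_def])
next
  case (Suc m)
  let ?b = "real (Suc m) * h"
  have b: "0 \<le> ?b"
    using h by simp
  \<comment> \<open>The additional sign factor is 1 to the left of \<open>?b\<close>, so the two
    waves differ at most at that single point.\<close>
  have restrict: "(square_wave h (Suc m) has_integral G) {0..y}"
    if "(square_wave h m has_integral G) {0..y}" "y \<le> ?b" for G y
    using that(1)
  proof (rule has_integral_spike_finite[of "{?b}", rotated 2])
    fix z assume "z \<in> {0..y} - {?b}"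
    then have "z < ?b"
      using that by auto
    then show "square_wave h (Suc m) z = square_wave h m z"
      unfolding square_wave_Suc by (simp add: sign_at_def)
  qed simp
  show ?case
  proof (cases "x \<le> ?b")
    case True
    then obtain G where "(square_wave h m has_integral G) {0..x}" "G \<in> {0..h}"
      using Suc.IH[of x] Suc.prems by auto
    moreover have "x \<noteq> real (Suc (Suc m)) * h"
      using True h by (auto simp: algebra_simps)
    ultimately show ?thesis
      using restrict True by blast
  next
    case False
    obtain G where G: "(square_wave h m has_integral G) {0..?b}" "G = (if even m then h else 0)"
      using Suc.IH[of ?b] b by auto
    \<comment> \<open>All \<open>Suc m\<close> sign factors are -1 from \<open>?b\<close>
      on.\<close>
    have "((\<lambda>z. (- 1) ^ Suc m :: real) has_integral (x - ?b) * (- 1) ^ Suc m) {?b..x}"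
      using has_integral_const_real[of "(- 1) ^ Suc m :: real" ?b x] False by simp
    then have "(square_wave h (Suc m) has_integral (x - ?b) * (- 1) ^ Suc m) {?b..x}"
    proof (rule has_integral_eq[rotated])
      fix z assume "z \<in> {?b..x}"
      then show "(- 1) ^ Suc m = square_wave h (Suc m) z"
        using h by (subst square_wave_tail) auto
    qed
    then have "(square_wave h (Suc m) has_integral (G + (x - ?b) * (- 1) ^ Suc m)) {0..x}"
      using False b by (intro has_integral_combine[OF _ _ restrict[OF G(1)]]) auto
    moreover have "G + (x - ?b) * (- 1) ^ Suc m = (if even m then h - (x - ?b) else x - ?b)"
      using G(2) by simp
    ultimately show ?thesis
      using False Suc.prems by (intro exI[of _ "if even m then h - (x - ?b) else x - ?b"])
        (auto simp: algebra_simps)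
  qed
qed

text \<open>Intervals of length 1/(n+1) and (n+1)^2 switches: the oscillation becomes finer and at
  the same time extends over [0, n+1].\<close>

definition fast_wave :: "nat \<Rightarrow> real \<Rightarrow> real" where
  "fast_wave n = square_wave (inverse (real (Suc n))) (Suc n * Suc n)"

lemma fast_wave_measurable [measurable]: "fast_wave n \<in> borel_measurable borel"
  by (simp add: fast_wave_def)

lemma fast_wave_measurable_halfline [measurable]: "fast_wave n \<in> borel_measurable halfline"
  by (simp add: measurable_restrict_space1)

lemma abs_fast_wave [simp]: "\<bar>fast_wave n x\<bar> = 1"
  by (simp add: fast_wave_def abs_square_wave)

section \<open>The Riemann-Lebesgue lemma for square waves\<close>

definition annihilated_by_waves :: "(real \<Rightarrow> 'b::{banach, second_countable_topology}) \<Rightarrow> bool" where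
  "annihilated_by_waves F \<longleftrightarrow> (\<lambda>n. LINT x|halfline. fast_wave n x *\<^sub>R F x) \<longlonglongrightarrow> 0"

lemma fast_wave_integrable:
  fixes F :: "real \<Rightarrow> 'b::{banach, second_countable_topology}"
  assumes "integrable halfline F"
  shows "integrable halfline (\<lambda>x. fast_wave n x *\<^sub>R F x)"
  using assms by (rule Bochner_Integration.integrable_bound)
    (use assms in \<open>auto intro!: borel_measurable_scaleR borel_measurable_integrable\<close>)

lemma annihilated_by_waves_add:
  assumes "integrable halfline F" "integrable halfline G" "annihilated_by_waves F" "annihilated_by_waves G"
  shows "annihilated_by_waves (\<lambda>x. F x + G x)"
  using tendsto_add[OF assms(3,4)[unfolded annihilated_by_waves_def]] assms(1,2)
  by (simp add: annihilated_by_waves_def scaleR_add_right fast_wave_integrable)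

lemma annihilated_by_waves_diff:
  assumes "integrable halfline F" "integrable halfline G" "annihilated_by_waves F" "annihilated_by_waves G"
  shows "annihilated_by_waves (\<lambda>x. F x - G x)"
  using tendsto_diff[OF assms(3,4)[unfolded annihilated_by_waves_def]] assms(1,2)
  by (simp add: annihilated_by_waves_def scaleR_diff_right fast_wave_integrable)

text \<open>Dominated convergence gives approximation in L1, and since the waves have modulus 1 the
  resulting error in the integrals is uniform in the index of the wave.\<close>

lemma annihilated_by_waves_dominated:
  fixes F :: "real \<Rightarrow> 'b::{banach, second_countable_topology}"
  assumes F: "F \<in> borel_measurable halfline" and s: "\<And>i. s i \<in> borel_measurable halfline"
    and lim: "\<And>x. 0 \<le> x \<Longrightarrow> (\<lambda>i. s i x) \<longlonglongrightarrow> F x"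
    and w: "integrable halfline w" "\<And>i x. 0 \<le> x \<Longrightarrow> norm (s i x) \<le> w x"
    and waves: "\<And>i. annihilated_by_waves (s i)"
  shows "annihilated_by_waves F"
proof -
  have bound: "norm (F x) \<le> w x" if "0 \<le> x" for x
    using tendsto_norm[OF lim[OF that]] w(2)[OF that] by (intro LIMSEQ_le_const2) auto
  have si: "integrable halfline (s i)" for i
    by (rule Bochner_Integration.integrable_bound[OF w(1) s]) (auto intro!: AE_I2 order_trans[OF w(2)])
  have Fi: "integrable halfline F"
    by (rule Bochner_Integration.integrable_bound[OF w(1) F]) (auto intro!: AE_I2 order_trans[OF bound])
  have "(\<lambda>i. LINT x|halfline. norm (s i x - F x)) \<longlonglongrightarrow> (LINT x|halfline. 0)"
  proof (rule integral_dominated_convergence[where w = "\<lambda>x. 2 * w x"])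
    show "AE x in halfline. (\<lambda>i. norm (s i x - F x)) \<longlonglongrightarrow> 0"
      using tendsto_norm_zero[OF LIM_zero[OF lim]] by (intro AE_I2) simp
    have "norm (s i x - F x) \<le> 2 * w x" if "0 \<le> x" for i x
      using norm_triangle_ineq4[of "s i x" "F x"] w(2)[OF that, of i] bound[OF that] by linarith
    then show "AE x in halfline. norm (norm (s i x - F x)) \<le> 2 * w x" for i
      by (intro AE_I2) auto
    show "(\<lambda>x. norm (s i x - F x)) \<in> borel_measurable halfline" for i
      using si[of i] Fi by (intro borel_measurable_norm borel_measurable_integrable) simp
  qed (use w in auto)
  then have L1: "(\<lambda>i. LINT x|halfline. norm (s i x - F x)) \<longlonglongrightarrow> 0"
    by simp
  show ?thesis
    unfolding annihilated_by_waves_def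
  proof (rule LIMSEQ_I)
    fix e :: real assume e: "0 < e"
    obtain i where i: "norm (LINT x|halfline. norm (s i x - F x)) < e / 2"
      using LIMSEQ_D[OF L1, of "e / 2"] e by auto
    obtain N where N: "\<And>n. n \<ge> N \<Longrightarrow> norm (LINT x|halfline. fast_wave n x *\<^sub>R s i x) < e / 2"
      using LIMSEQ_D[OF waves[of i, unfolded annihilated_by_waves_def], of "e / 2"] e by auto
    have "norm (LINT x|halfline. fast_wave n x *\<^sub>R F x) < e" if "n \<ge> N" for n
    proof -
      have "(LINT x|halfline. fast_wave n x *\<^sub>R F x) =
          (LINT x|halfline. fast_wave n x *\<^sub>R s i x) - (LINT x|halfline. fast_wave n x *\<^sub>R (s i x - F x))"
        using si[of i] Fi by (simp add: scaleR_diff_right fast_wave_integrable)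
      also have "norm \<dots> \<le> norm (LINT x|halfline. fast_wave n x *\<^sub>R s i x) +
          norm (LINT x|halfline. fast_wave n x *\<^sub>R (s i x - F x))"
        by (rule norm_triangle_ineq4)
      also have "norm (LINT x|halfline. fast_wave n x *\<^sub>R (s i x - F x)) \<le>
          (LINT x|halfline. norm (fast_wave n x *\<^sub>R (s i x - F x)))"
        by (rule integral_norm_bound)
      also have "(LINT x|halfline. norm (fast_wave n x *\<^sub>R (s i x - F x))) < e / 2"
        using i by simp
      finally show ?thesis
        using N[OF that] by simp
    qed
    then show "\<exists>no. \<forall>n\<ge>no. norm ((LINT x|halfline. fast_wave n x *\<^sub>R F x) - 0) < e"
      by auto
  qed
qed

lemma indicator_interval_integrable:
  "A \<in> sets borel \<Longrightarrow> integrable halfline (\<lambda>x. indicator (A \<inter> {..b}) x :: real)"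
proof -
  assume A: "A \<in> sets borel"
  have "integrable lborel (indicator (A \<inter> {0..b}) :: real \<Rightarrow> real)"
    using emeasure_mono[of "A \<inter> {0..b}" "{0..b}" lborel] A
    by (intro integrable_real_indicator) (auto simp: order_le_less_trans emeasure_lborel_Icc_eq)
  moreover have "(\<lambda>x. indicator {0..} x *\<^sub>R (indicator (A \<inter> {..b}) x :: real)) = indicator (A \<inter> {0..b})"
    by (auto simp: fun_eq_iff indicator_def)
  ultimately show ?thesis
    by (simp only: integrable_halfline_iff)
qed

lemma annihilated_by_waves_interval: "annihilated_by_waves (\<lambda>x. indicator {..b} x :: real)"
proof -
  have bound: "norm (LINT x|halfline. fast_wave n x *\<^sub>R (indicator {..b} x :: real)) \<le> inverse (real (Suc n))"
    if "b \<le> real n" for n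
  proof (cases "0 \<le> b")
    case True
    let ?h = "inverse (real (Suc n))"
    \<comment> \<open>The integral bound for the wave reaches up to n + 1 + 1/(n+1), hence beyond
      \<open>b\<close>.\<close>
    have "b \<le> real (Suc (Suc n * Suc n)) * ?h"
    proof -
      have "real (Suc (Suc n * Suc n)) * ?h = real (Suc n) + ?h"
        by (simp add: field_simps del: of_nat_Suc) (simp add: algebra_simps)
      then show ?thesis
        using that by (simp add: add_increasing2)
    qed
    then obtain G where G: "(fast_wave n has_integral G) {0..b}" "G \<in> {0..?h}"
      using square_wave_has_integral[of ?h b "Suc n * Suc n"] True unfolding fast_wave_def by auto
    have "set_integrable lborel {0..b} (fast_wave n)"
      unfolding set_integrable_def
    proof (rule Bochner_Integration.integrable_bound)
      show "integrable lborel (indicator {0..b} :: real \<Rightarrow> real)"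
        by (intro integrable_real_indicator) (auto simp: emeasure_lborel_Icc_eq)
    qed (auto intro!: borel_measurable_scaleR AE_I2 simp: abs_mult)
    then have "(LINT x:{0..b}|lborel. fast_wave n x) = G"
      using set_borel_integral_eq_integral(2) integral_unique[OF G(1)] by metis
    moreover have "(LINT x|halfline. fast_wave n x *\<^sub>R (indicator {..b} x :: real)) =
        (LINT x:{0..b}|lborel. fast_wave n x)"
      unfolding integral_halfline_eq set_lebesgue_integral_def
      by (intro Bochner_Integration.integral_cong) (auto simp: indicator_def)
    ultimately show ?thesis
      using G(2) by simp
  next
    case False
    have "(\<lambda>x. indicator {0..} x *\<^sub>R (fast_wave n x *\<^sub>R (indicator {..b} x :: real))) = (\<lambda>x. 0)"
      using False by (auto simp: fun_eq_iff indicator_def)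
    then show ?thesis
      by (simp only: integral_halfline_eq) simp
  qed
  obtain N where N: "b \<le> real N"
    using real_arch_simple by blast
  have "\<forall>\<^sub>F n in sequentially.
      norm (LINT x|halfline. fast_wave n x *\<^sub>R (indicator {..b} x :: real)) \<le> inverse (real (Suc n))"
    using eventually_ge_at_top[of N] by eventually_elim (use N bound in force)
  then show ?thesis
    unfolding annihilated_by_waves_def
    by (rule Lim_null_comparison) (rule LIMSEQ_inverse_real_of_nat)
qed

text \<open>The rays \<open>{..a}\<close> form an intersection-stable generator of the Borel sets.
  Truncation at \<open>b\<close> keeps all measures on the half line finite, so complements can be
  handled as differences.\<close>

lemma annihilated_by_waves_bounded_set:
  assumes "A \<in> sets borel"
  shows "annihilated_by_waves (\<lambda>x. indicator (A \<inter> {..b}) x :: real)"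
proof -
  have borel: "sets borel = sigma_sets UNIV (range (\<lambda>a :: real. {..a}))"
    by (subst borel_eq_atMost) (simp add: sets_measure_of)
  have "Int_stable (range (\<lambda>a :: real. {..a}))" "range (\<lambda>a :: real. {..a}) \<subseteq> Pow UNIV"
    by (auto simp: Int_stable_def intro!: exI[of _ "min _ _"])
  then show ?thesis
    using assms unfolding borel
  proof (induction rule: sigma_sets_induct_disjoint)
    case (basic A)
    then obtain a where "A \<inter> {..b} = {..min a b}"
      by auto
    then show ?case
      using annihilated_by_waves_interval by simp
  next
    case empty
    show ?case
      by (simp add: annihilated_by_waves_def)
  next
    case (compl A)
    then have "A \<in> sets borel"
      by (simp add: borel)
    then have "annihilated_by_waves (\<lambda>x. indicator (UNIV \<inter> {..b}) x - indicator (A \<inter> {..b}) x :: real)"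
      by (intro annihilated_by_waves_diff indicator_interval_integrable compl)
        (simp_all add: annihilated_by_waves_interval)
    moreover have "(\<lambda>x. indicator (UNIV \<inter> {..b}) x - indicator (A \<inter> {..b}) x :: real) =
        (\<lambda>x. indicator ((UNIV - A) \<inter> {..b}) x)"
      by (auto simp: fun_eq_iff indicator_def)
    ultimately show ?case
      by simp
  next
    case (union A)
    have A: "A i \<in> sets borel" for i
      using union(2) by (auto simp: borel)
    have waves: "annihilated_by_waves (\<lambda>x. indicator ((\<Union>i<k. A i) \<inter> {..b}) x :: real)" for k
    proof (induction k)
      case 0
      then show ?case
        by (simp add: annihilated_by_waves_def)
    next
      case (Suc k)
      have "annihilated_by_waves (\<lambda>x. indicator ((\<Union>i<k. A i) \<inter> {..b}) x + indicator (A k \<inter> {..b}) x :: real)"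
        by (intro annihilated_by_waves_add indicator_interval_integrable Suc union) (auto intro: A)
      moreover have "indicator ((\<Union>i<k. A i) \<inter> {..b}) x + indicator (A k \<inter> {..b}) x =
          (indicator ((\<Union>i<Suc k. A i) \<inter> {..b}) x :: real)" for x
      proof -
        have "(\<Union>i<k. A i) \<inter> A k = {}"
          using disjoint_family_onD[OF union(1), of _ k] by (force simp: disjoint_iff)
        then show ?thesis
          by (auto simp: indicator_def lessThan_Suc)
      qed
      ultimately show ?case
        by simp
    qed
    show ?case
    proof (rule annihilated_by_waves_dominated[where w = "\<lambda>x. indicator (UNIV \<inter> {..b}) x", OF _ _ _ _ _ waves])
      show "(\<lambda>k. indicator ((\<Union>i<k. A i) \<inter> {..b}) x) \<longlonglongrightarrow> (indicator ((\<Union>i. A i) \<inter> {..b}) x :: real)" for x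
        using LIMSEQ_indicator_UN[of "\<lambda>i. A i \<inter> {..b}" x] by simp
      show "(\<lambda>x. indicator ((\<Union>i. A i) \<inter> {..b}) x :: real) \<in> borel_measurable halfline"
        using A by (intro borel_measurable_integrable indicator_interval_integrable) auto
      show "(\<lambda>x. indicator ((\<Union>i<k. A i) \<inter> {..b}) x :: real) \<in> borel_measurable halfline" for k
        using A by (intro borel_measurable_integrable indicator_interval_integrable) auto
      show "integrable halfline (\<lambda>x. indicator (UNIV \<inter> {..b}) x :: real)"
        by (rule indicator_interval_integrable) simp
    qed (auto simp: indicator_def)
  qed
qed

text \<open>Induction over integrable functions. A set of finite measure can be unbounded, so its
  indicator is first approximated by its truncations at \<open>n\<close>.\<close>

theorem riemann_lebesgue_waves:
  fixes F :: "real \<Rightarrow> 'b::{banach, second_countable_topology}"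
  assumes "integrable halfline F"
  shows "annihilated_by_waves F"
  using assms
proof (induction rule: integrable_induct)
  case (base A c)
  then have A: "A \<in> sets borel" "A \<subseteq> {0..}"
    by (auto simp: sets_restrict_space_iff)
  have int: "integrable halfline (\<lambda>x. indicator A x *\<^sub>R c)"
    using base by simp
  have waves: "annihilated_by_waves (\<lambda>x. indicator (A \<inter> {..b}) x *\<^sub>R c)" for b
  proof -
    have "(LINT x|halfline. fast_wave n x *\<^sub>R indicator (A \<inter> {..b}) x *\<^sub>R c) =
        (LINT x|halfline. fast_wave n x *\<^sub>R (indicator (A \<inter> {..b}) x :: real)) *\<^sub>R c" for n
      using fast_wave_integrable[OF indicator_interval_integrable[OF A(1)]]
      by (simp flip: integral_scaleR_left)
    then show ?thesis
      using tendsto_scaleR[OF annihilated_by_waves_bounded_set[OF A(1), of b, unfolded annihilated_by_waves_def] tendsto_const[of c]]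
      by (simp add: annihilated_by_waves_def)
  qed
  show ?case
  proof (rule annihilated_by_waves_dominated[where s = "\<lambda>n x. indicator (A \<inter> {..real n}) x *\<^sub>R c"
        and w = "\<lambda>x. norm (indicator A x *\<^sub>R c)"])
    show "(\<lambda>n. indicator (A \<inter> {..real n}) x *\<^sub>R c) \<longlonglongrightarrow> indicator A x *\<^sub>R c" for x
    proof (rule tendsto_eventually)
      obtain N where N: "x \<le> real N"
        using real_arch_simple by blast
      show "\<forall>\<^sub>F n in sequentially. indicator (A \<inter> {..real n}) x *\<^sub>R c = indicator A x *\<^sub>R c"
        by (rule eventually_mono[OF eventually_ge_at_top[of N]]) (use N in \<open>auto simp: indicator_def\<close>)
    qed
    show "(\<lambda>x. indicator A x *\<^sub>R c) \<in> borel_measurable halfline"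
      "integrable halfline (\<lambda>x. norm (indicator A x *\<^sub>R c))"
      by (intro borel_measurable_integrable integrable_norm int)+
    show "(\<lambda>x. indicator (A \<inter> {..real n}) x *\<^sub>R c) \<in> borel_measurable halfline" for n
      by (intro borel_measurable_scaleR borel_measurable_const
          borel_measurable_integrable[OF indicator_interval_integrable[OF A(1)]])
  qed (use waves in \<open>auto simp: indicator_def\<close>)
next
  case (lim f s)
  show ?case
  proof (rule annihilated_by_waves_dominated[where s = s and w = "\<lambda>x. 2 * norm (f x)"])
  qed (use lim in auto)
qed (auto intro: annihilated_by_waves_add)

text \<open>Modulation by the waves keeps the norm of \<open>f\<close> but tends weakly to 0; every
  vanishing of an annihilated vector below rests on this contrast.\<close>

lemma L2_inner_fast_wave_tendsto:
  fixes f g :: "real \<Rightarrow> 'k::{real_inner, second_countable_topology} \<times> 'k"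
  assumes "f \<in> L2_halfline" "g \<in> L2_halfline"
  shows "(\<lambda>n. L2_inner (\<lambda>s. fast_wave n s *\<^sub>R f s) g) \<longlonglongrightarrow> 0"
  using riemann_lebesgue_waves[OF complexified_inner_integrable[OF assms]]
  by (simp add: annihilated_by_waves_def L2_inner_def complexified_inner_scaleR scaleR_conv_of_real)

section \<open>Creation and annihilation operators\<close>

definition remove_nth :: "nat \<Rightarrow> 'a list \<Rightarrow> 'a list" where
  "remove_nth j xs = take j xs @ drop (Suc j) xs"

lemma length_remove_nth: "j < length xs \<Longrightarrow> length (remove_nth j xs) = length xs - 1"
  by (simp add: remove_nth_def)

lemma nth_remove_nth:
  "j < length xs \<Longrightarrow> i < length xs - 1 \<Longrightarrow> remove_nth j xs ! i = xs ! (if i < j then i else Suc i)"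
  by (simp add: remove_nth_def nth_append min_def)

lemma remove_nth_in_lists: "xs \<in> lists S \<Longrightarrow> remove_nth j xs \<in> lists S"
  using set_take_subset[of j xs] set_drop_subset[of "Suc j" xs] by (auto simp: remove_nth_def)

lemma remove_nth_Cons:
  "remove_nth 0 (x # xs) = xs" "remove_nth (Suc j) (x # xs) = x # remove_nth j xs"
  by (simp_all add: remove_nth_def)

definition gram_matrix where
  "gram_matrix fs gs = Matrix.mat (length fs) (length gs) (\<lambda>(i, j). L2_inner (fs ! i) (gs ! j))"

lemma gram_determinant_eq_det:
  assumes "length fs = length gs"
  shows "gram_determinant fs gs = Determinant.det (gram_matrix fs gs)"
proof -
  have "(\<Prod>i<length fs. L2_inner (fs ! i) (gs ! p i)) =
      (\<Prod>i = 0..<length fs. gram_matrix fs gs $$ (i, p i))" if "p permutes {..<length fs}" for p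
    using permutes_in_image[OF that] assms
    by (intro prod.cong) (auto simp: gram_matrix_def atLeast0LessThan)
  then show ?thesis
    using assms unfolding gram_determinant_def Determinant.det_def
    by (auto simp: gram_matrix_def atLeast0LessThan intro!: sum.cong)
qed

text \<open>Laplace expansion along the row of \<open>f\<close>; each minor is the Gram matrix with
  one of the \<open>gs\<close> removed.\<close>

lemma gram_determinant_Cons:
  assumes "length gs = Suc (length fs)"
  shows "gram_determinant (f # fs) gs =
    (\<Sum>j<length gs. ((- 1) ^ j * L2_inner f (gs ! j)) * gram_determinant fs (remove_nth j gs))"
proof -
  let ?A = "gram_matrix (f # fs) gs"
  have A: "?A \<in> carrier_mat (length gs) (length gs)"
    using assms by (simp add: gram_matrix_def)
  have "mat_delete ?A 0 j = gram_matrix fs (remove_nth j gs)" if "j < length gs" for j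
    by (rule eq_matI)
      (use that assms in \<open>auto simp: mat_delete_def gram_matrix_def length_remove_nth nth_remove_nth\<close>)
  then have "?A $$ (0, j) * cofactor ?A 0 j =
      ((- 1) ^ j * L2_inner f (gs ! j)) * gram_determinant fs (remove_nth j gs)" if "j < length gs" for j
    using that assms by (simp add: cofactor_def gram_determinant_eq_det length_remove_nth)
      (simp add: gram_matrix_def)
  then show ?thesis
    using laplace_expansion_row[OF A, of 0] assms by (simp add: gram_determinant_eq_det)
qed

locale fock =
  fixes W :: "(real \<Rightarrow> 'k::{real_inner, complete_space, second_countable_topology} \<times> 'k) list
    \<Rightarrow> 'h::complex_hilbert_space"
  assumes fock_space: "antisymmetric_fock_space W"
begin

lemma cinner_W:
  "fs \<in> lists L2_halfline \<Longrightarrow> gs \<in> lists L2_halfline \<Longrightarrow>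
    cinner (W fs) (W gs) = (if length fs = length gs then gram_determinant fs gs else 0)"
  and W_dense: "dense_family (lists L2_halfline) W"
  using fock_space by (auto simp: antisymmetric_fock_space_def)

text \<open>The value of a(f) on a wedge product, with the signs of the Laplace expansion.\<close>

definition contraction :: "(real \<Rightarrow> 'k \<times> 'k) \<Rightarrow> (real \<Rightarrow> 'k \<times> 'k) list \<Rightarrow> 'h" where
  "contraction f gs = (\<Sum>j<length gs. ((- 1) ^ j * L2_inner f (gs ! j)) *\<^sub>C W (remove_nth j gs))"

text \<open>Contraction by \<open>f\<close> is the formal adjoint of wedging with \<open>f\<close>:
  this is the Laplace expansion of the Gram determinant.\<close>

lemma cinner_W_Cons:
  assumes "f \<in> L2_halfline" and fs: "fs \<in> lists L2_halfline" and gs: "gs \<in> lists L2_halfline"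
  shows "cinner (W (f # fs)) (W gs) = cinner (W fs) (contraction f gs)"
proof -
  note rem = remove_nth_in_lists[OF gs]
  have eq: "cinner (W fs) (contraction f gs) =
      (\<Sum>j<length gs. ((- 1) ^ j * L2_inner f (gs ! j)) *
        (if length gs = Suc (length fs) then gram_determinant fs (remove_nth j gs) else 0))"
    unfolding contraction_def cinner_sum_right cinner_scaleC_right
    using cinner_W[OF fs rem] by (intro sum.cong refl) (auto simp: length_remove_nth)
  show ?thesis
  proof (cases "length gs = Suc (length fs)")
    case True
    then have "cinner (W (f # fs)) (W gs) = gram_determinant (f # fs) gs"
      using assms cinner_W[of "f # fs" gs] by simp
    then show ?thesis
      unfolding eq gram_determinant_Cons[OF True] by (simp only: True if_True simp_thms)
  next
    case False
    then show ?thesis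
      unfolding eq using assms cinner_W[of "f # fs" gs] by auto
  qed
qed

text \<open>The anticommutation relation in weak form, before the operators exist. Contracting
  \<open>g\<close> itself gives the first term; contracting a later factor moves past
  \<open>g\<close> and changes the sign.\<close>

lemma cinner_W_Cons_Cons:
  assumes f: "f \<in> L2_halfline" and g: "g \<in> L2_halfline"
    and fs: "fs \<in> lists L2_halfline" and gs: "gs \<in> lists L2_halfline"
  shows "cinner (W (f # fs)) (W (g # gs)) =
    L2_inner f g * cinner (W fs) (W gs) - cinner (contraction g fs) (contraction f gs)"
proof -
  note rem = remove_nth_in_lists[OF gs]
  have "contraction f (g # gs) = L2_inner f g *\<^sub>C W gs -
      (\<Sum>j<length gs. ((- 1) ^ j * L2_inner f (gs ! j)) *\<^sub>C W (g # remove_nth j gs))"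
    unfolding contraction_def length_Cons sum.lessThan_Suc_shift
    by (simp add: remove_nth_Cons sum_negf)
  moreover have "cinner (W fs) (W (g # remove_nth j gs)) = cinner (contraction g fs) (W (remove_nth j gs))" for j
    using cinner_W_Cons[OF g rem fs, of j] by (metis cinner_commute)
  ultimately show ?thesis
    using cinner_W_Cons[OF f fs, of "g # gs"] g gs
    by (simp add: cinner_diff_right cinner_scaleC_right cinner_sum_right contraction_def[of f gs])
qed

text \<open>The identity a(f) a*(f) + a*(f) a(f) = |f|^2 on finite combinations. It bounds wedging
  and contraction at once, which is what \<open>bounded_extension\<close> asks for.\<close>

lemma norm_combination_Cons:
  assumes f: "f \<in> L2_halfline" and J: "finite J" "J \<subseteq> lists L2_halfline"
  shows "(norm (\<Sum>gs\<in>J. c gs *\<^sub>C W (f # gs)))\<^sup>2 + (norm (\<Sum>gs\<in>J. c gs *\<^sub>C contraction f gs))\<^sup>2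
    = Re (L2_inner f f) * (norm (\<Sum>gs\<in>J. c gs *\<^sub>C W gs))\<^sup>2"
proof -
  let ?x = "\<Sum>gs\<in>J. c gs *\<^sub>C W gs"
  have "cinner (\<Sum>gs\<in>J. c gs *\<^sub>C W (f # gs)) (\<Sum>gs\<in>J. c gs *\<^sub>C W (f # gs)) =
      (\<Sum>gs\<in>J. \<Sum>hs\<in>J. cnj (c gs) * c hs * (L2_inner f f * cinner (W gs) (W hs) -
        cinner (contraction f gs) (contraction f hs)))"
    unfolding cinner_sum_left unfolding cinner_sum_right cinner_scaleC_left cinner_scaleC_right
    using J(2) by (intro sum.cong refl) (auto simp: cinner_W_Cons_Cons f subset_iff)
  also have "\<dots> = L2_inner f f * cinner ?x ?x -
      cinner (\<Sum>gs\<in>J. c gs *\<^sub>C contraction f gs) (\<Sum>gs\<in>J. c gs *\<^sub>C contraction f gs)"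
    unfolding cinner_sum_left unfolding cinner_sum_right cinner_scaleC_left cinner_scaleC_right
    by (simp add: sum_distrib_left sum_subtractf algebra_simps)
  finally show ?thesis
    unfolding norm_eq_cinner[of "\<Sum>gs\<in>J. c gs *\<^sub>C W (f # gs)"]
      norm_eq_cinner[of "\<Sum>gs\<in>J. c gs *\<^sub>C contraction f gs"]
    by (simp add: cinner_self[of ?x])
qed

lemma norm_combination_le:
  assumes f: "f \<in> L2_halfline" and J: "finite J" "J \<subseteq> lists L2_halfline"
  shows "norm (\<Sum>gs\<in>J. c gs *\<^sub>C W (f # gs)) \<le> sqrt (Re (L2_inner f f)) * norm (\<Sum>gs\<in>J. c gs *\<^sub>C W gs)"
    and "norm (\<Sum>gs\<in>J. c gs *\<^sub>C contraction f gs) \<le> sqrt (Re (L2_inner f f)) * norm (\<Sum>gs\<in>J. c gs *\<^sub>C W gs)"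
proof -
  let ?R = "Re (L2_inner f f) * (norm (\<Sum>gs\<in>J. c gs *\<^sub>C W gs))\<^sup>2"
  have "(norm (\<Sum>gs\<in>J. c gs *\<^sub>C W (f # gs)))\<^sup>2 \<le> ?R" "(norm (\<Sum>gs\<in>J. c gs *\<^sub>C contraction f gs))\<^sup>2 \<le> ?R"
    unfolding norm_combination_Cons[OF assms, of c, symmetric] by simp_all
  then show "norm (\<Sum>gs\<in>J. c gs *\<^sub>C W (f # gs)) \<le> sqrt (Re (L2_inner f f)) * norm (\<Sum>gs\<in>J. c gs *\<^sub>C W gs)"
    and "norm (\<Sum>gs\<in>J. c gs *\<^sub>C contraction f gs) \<le> sqrt (Re (L2_inner f f)) * norm (\<Sum>gs\<in>J. c gs *\<^sub>C W gs)"
    by (auto dest!: real_le_rsqrt simp: real_sqrt_mult)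
qed

lemma creation_operator_exists:
  assumes f: "f \<in> L2_halfline"
  obtains A B where "A \<in> bounded_operators" "B \<in> bounded_operators"
    "\<And>gs. gs \<in> lists L2_halfline \<Longrightarrow> A (W gs) = W (f # gs)"
    "\<And>gs. gs \<in> lists L2_halfline \<Longrightarrow> B (W gs) = contraction f gs"
proof -
  obtain A where A: "A \<in> bounded_operators" "\<And>gs. gs \<in> lists L2_halfline \<Longrightarrow> A (W gs) = W (f # gs)"
    by (rule bounded_extension[OF W_dense norm_combination_le(1)[OF f]]) blast+
  obtain B where B: "B \<in> bounded_operators" "\<And>gs. gs \<in> lists L2_halfline \<Longrightarrow> B (W gs) = contraction f gs"
    by (rule bounded_extension[OF W_dense norm_combination_le(2)[OF f]]) blast+
  show ?thesis
    by (rule that[OF A(1) B(1) A(2) B(2)])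
qed

definition annihilation_operator :: "(real \<Rightarrow> 'k \<times> 'k) \<Rightarrow> 'h \<Rightarrow> 'h" where
  "annihilation_operator f = hilbert_adjoint (creation_operator W f)"

context
  fixes f :: "real \<Rightarrow> 'k \<times> 'k"
  assumes f: "f \<in> L2_halfline"
begin

text \<open>Wedging and contraction are extended separately; being adjoint on wedge products they
  are adjoint everywhere, which resolves both definite descriptions.\<close>

lemma creation_operator_bounded: "creation_operator W f \<in> bounded_operators"
  and creation_operator_W: "gs \<in> lists L2_halfline \<Longrightarrow> creation_operator W f (W gs) = W (f # gs)"
  and annihilation_operator_bounded: "annihilation_operator f \<in> bounded_operators"
  and annihilation_operator_W: "gs \<in> lists L2_halfline \<Longrightarrow> annihilation_operator f (W gs) = contraction f gs"
  and cinner_annihilation_operator: "cinner (annihilation_operator f x) y = cinner x (creation_operator W f y)"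
proof -
  obtain A B where A: "A \<in> bounded_operators" "\<And>gs. gs \<in> lists L2_halfline \<Longrightarrow> A (W gs) = W (f # gs)"
    and B: "B \<in> bounded_operators" "\<And>gs. gs \<in> lists L2_halfline \<Longrightarrow> B (W gs) = contraction f gs"
    using creation_operator_exists[OF f] by metis
  have "creation_operator W f = A"
    unfolding creation_operator_def
  proof (rule the_equality)
    fix A' assume A': "A' \<in> bounded_operators \<and> (\<forall>gs\<in>lists L2_halfline. A' (W gs) = W (f # gs))"
    have "A' x = A x" for x
    proof (rule eq_on_dense_family[OF W_dense, of A' A])
      show "A' (W gs) = A (W gs)" if "gs \<in> lists L2_halfline" for gs
        using A' A(2)[OF that] that by simp
    qed (use A' A(1) in auto)
    then show "A' = A"
      by (rule ext)
  qed (use A in auto)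
  moreover have adj: "cinner (B x) y = cinner x (A y)" for x y
  proof (rule adjoint_on_dense_family[OF W_dense B(1) A(1)])
    fix fs gs :: "(real \<Rightarrow> 'k \<times> 'k) list"
    assume fs: "fs \<in> lists L2_halfline" and gs: "gs \<in> lists L2_halfline"
    have "cinner (contraction f fs) (W gs) = cnj (cinner (W (f # gs)) (W fs))"
      by (subst cinner_commute) (simp only: cinner_W_Cons[OF f gs fs])
    also have "\<dots> = cinner (W fs) (W (f # gs))"
      by (rule cinner_commute[symmetric])
    finally show "cinner (B (W fs)) (W gs) = cinner (W fs) (A (W gs))"
      by (simp only: A(2)[OF gs] B(2)[OF fs])
  qed
  moreover have "hilbert_adjoint A = B"
    by (rule hilbert_adjoint_eqI[OF B(1) adj])
  ultimately show "creation_operator W f \<in> bounded_operators"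
    "gs \<in> lists L2_halfline \<Longrightarrow> creation_operator W f (W gs) = W (f # gs)"
    "annihilation_operator f \<in> bounded_operators"
    "gs \<in> lists L2_halfline \<Longrightarrow> annihilation_operator f (W gs) = contraction f gs"
    "cinner (annihilation_operator f x) y = cinner x (creation_operator W f y)"
    by (simp_all add: annihilation_operator_def A B)
qed

lemma cinner_creation_operator: "cinner (creation_operator W f x) y = cinner x (annihilation_operator f y)"
  using cinner_annihilation_operator[of y x] by (metis cinner_commute)

lemma annihilation_operator_vacuum [simp]: "annihilation_operator f (W []) = 0"
  by (simp add: annihilation_operator_W contraction_def)

end

section \<open>The canonical anticommutation relations and their consequences\<close>

lemmas creation_operator_linear =
  bounded_operators_add[OF creation_operator_bounded] bounded_operators_diff[OF creation_operator_bounded]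
  bounded_operators_minus[OF creation_operator_bounded] bounded_operators_scaleC[OF creation_operator_bounded]
  bounded_operators_zero[OF creation_operator_bounded]

lemmas annihilation_operator_linear =
  bounded_operators_add[OF annihilation_operator_bounded] bounded_operators_diff[OF annihilation_operator_bounded]
  bounded_operators_minus[OF annihilation_operator_bounded] bounded_operators_scaleC[OF annihilation_operator_bounded]
  bounded_operators_zero[OF annihilation_operator_bounded]

text \<open>The weak form \<open>cinner_W_Cons_Cons\<close>, lifted to operators by testing against
  wedge products on both sides.\<close>

lemma car:
  assumes f: "f \<in> L2_halfline" and g: "g \<in> L2_halfline"
  shows "annihilation_operator f (creation_operator W g x) =
    L2_inner f g *\<^sub>C x - creation_operator W g (annihilation_operator f x)"
proof (rule eq_on_dense_family[OF W_dense, where A = "\<lambda>x. annihilation_operator f (creation_operator W g x)"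
      and B = "\<lambda>x. L2_inner f g *\<^sub>C x - creation_operator W g (annihilation_operator f x)"])
  fix gs :: "(real \<Rightarrow> 'k \<times> 'k) list" assume gs: "gs \<in> lists L2_halfline"
  show "annihilation_operator f (creation_operator W g (W gs)) =
      L2_inner f g *\<^sub>C W gs - creation_operator W g (annihilation_operator f (W gs))"
  proof (rule cinner_eq_on_dense_family[OF W_dense])
    fix fs :: "(real \<Rightarrow> 'k \<times> 'k) list" assume fs: "fs \<in> lists L2_halfline"
    have "cinner (W fs) (annihilation_operator f (creation_operator W g (W gs))) =
        cinner (W (f # fs)) (W (g # gs))"
      by (simp add: f g fs gs creation_operator_W flip: cinner_creation_operator)
    also have "\<dots> = L2_inner f g * cinner (W fs) (W gs) -
        cinner (annihilation_operator g (W fs)) (annihilation_operator f (W gs))"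
      by (simp add: f g fs gs cinner_W_Cons_Cons annihilation_operator_W)
    also have "\<dots> = cinner (W fs) (L2_inner f g *\<^sub>C W gs - creation_operator W g (annihilation_operator f (W gs)))"
      by (simp add: g cinner_annihilation_operator cinner_diff_right cinner_scaleC_right)
    finally show "cinner (W fs) (annihilation_operator f (creation_operator W g (W gs))) =
        cinner (W fs) (L2_inner f g *\<^sub>C W gs - creation_operator W g (annihilation_operator f (W gs)))" .
  qed
qed (intro bounded_operators_comp[OF annihilation_operator_bounded creation_operator_bounded]
    bounded_operators_comp[OF creation_operator_bounded annihilation_operator_bounded]
    bounded_operators_minus_op bounded_operators_scale bounded_operators_id f g)+

text \<open>By \<open>car\<close>, annihilation operators commute with \<open>Z = a\<^sup>*(f) a\<^sup>*(g) + a\<^sup>*(g) a\<^sup>*(f)\<close>, and they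
  move any wedge product to the vacuum, which is orthogonal to the range of \<open>Z\<close>.\<close>

lemma creation_operator_anticommute:
  assumes f: "f \<in> L2_halfline" and g: "g \<in> L2_halfline"
  shows "creation_operator W f (creation_operator W g x) = - creation_operator W g (creation_operator W f x)"
proof -
  define Z where "Z x = creation_operator W f (creation_operator W g x) +
    creation_operator W g (creation_operator W f x)" for x
  have commute: "annihilation_operator h (Z x) = Z (annihilation_operator h x)" if "h \<in> L2_halfline" for h x
    using that f g by (simp add: Z_def car annihilation_operator_linear creation_operator_linear)
  have "cinner (W hs) (Z x) = 0" if "hs \<in> lists L2_halfline" for hs x
    using that
  proof (induction hs arbitrary: x)
    case Nil
    then show ?case
      using f g by (simp add: Z_def cinner_add_right flip: cinner_annihilation_operator)
  next
    case (Cons h hs)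
    then have "cinner (W (h # hs)) (Z x) = cinner (W hs) (annihilation_operator h (Z x))"
      by (simp flip: cinner_creation_operator creation_operator_W)
    then show ?case
      using Cons by (simp add: commute)
  qed
  then have "Z x = 0"
    by (intro cinner_eq_on_dense_family[OF W_dense]) simp
  then show ?thesis
    by (simp add: Z_def eq_neg_iff_add_eq_0)
qed

lemma annihilation_operator_anticommute:
  assumes f: "f \<in> L2_halfline" and g: "g \<in> L2_halfline"
  shows "annihilation_operator f (annihilation_operator g x) = - annihilation_operator g (annihilation_operator f x)"
proof (rule cinner_eq_on_dense_family[OF W_dense])
  fix hs :: "(real \<Rightarrow> 'k \<times> 'k) list"
  show "cinner (W hs) (annihilation_operator f (annihilation_operator g x)) =
      cinner (W hs) (- annihilation_operator g (annihilation_operator f x))"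
    using creation_operator_anticommute[OF f g, of "W hs"]
    by (simp add: f g flip: cinner_creation_operator)
qed

lemma annihilation_operator_twice:
  assumes "f \<in> L2_halfline"
  shows "annihilation_operator f (annihilation_operator f x) = 0"
  using annihilation_operator_anticommute[OF assms assms, of x] by (simp add: eq_neg_iff_add_eq_0 flip: scaleR_2)

lemma creation_operator_twice:
  assumes "f \<in> L2_halfline"
  shows "creation_operator W f (creation_operator W f x) = 0"
  using creation_operator_anticommute[OF assms assms, of x] by (simp add: eq_neg_iff_add_eq_0 flip: scaleR_2)

text \<open>Phrased through the functionals \<open>L2_inner f\<close>, since these are all that a
  contraction sees of \<open>f\<close>.\<close>

lemma annihilation_operator_combination:
  assumes L2: "f \<in> L2_halfline" "f1 \<in> L2_halfline" "f2 \<in> L2_halfline"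
    and eq: "\<And>g. g \<in> L2_halfline \<Longrightarrow> L2_inner f g = L2_inner f1 g + c * L2_inner f2 g"
  shows "annihilation_operator f x = annihilation_operator f1 x + c *\<^sub>C annihilation_operator f2 x"
proof (rule eq_on_dense_family[OF W_dense, where B = "\<lambda>x. annihilation_operator f1 x + c *\<^sub>C annihilation_operator f2 x"])
  fix gs :: "(real \<Rightarrow> 'k \<times> 'k) list" assume gs: "gs \<in> lists L2_halfline"
  have "contraction f gs = (\<Sum>j<length gs. ((- 1) ^ j * L2_inner f1 (gs ! j)) *\<^sub>C W (remove_nth j gs) +
      c *\<^sub>C (((- 1) ^ j * L2_inner f2 (gs ! j)) *\<^sub>C W (remove_nth j gs)))"
    unfolding contraction_def
  proof (rule sum.cong[OF refl])
    fix j assume "j \<in> {..<length gs}"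
    then have "gs ! j \<in> L2_halfline"
      using gs nth_mem by auto
    then show "((- 1) ^ j * L2_inner f (gs ! j)) *\<^sub>C W (remove_nth j gs) =
        ((- 1) ^ j * L2_inner f1 (gs ! j)) *\<^sub>C W (remove_nth j gs) +
        c *\<^sub>C (((- 1) ^ j * L2_inner f2 (gs ! j)) *\<^sub>C W (remove_nth j gs))"
      by (simp add: eq distrib_left scaleC_add_left scaleC_scaleC mult.left_commute)
  qed
  then show "annihilation_operator f (W gs) = annihilation_operator f1 (W gs) + c *\<^sub>C annihilation_operator f2 (W gs)"
    using gs L2 by (simp add: annihilation_operator_W contraction_def sum.distrib complex_vector.scale_sum_right)
qed (intro annihilation_operator_bounded bounded_operators_plus bounded_operators_scale L2)+

lemma norm_annihilation_operator_le:
  assumes f: "f \<in> L2_halfline"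
  shows "norm (annihilation_operator f x) \<le> sqrt (Re (L2_inner f f)) * norm x"
proof -
  have "cinner (annihilation_operator f x) (annihilation_operator f x) + cinner (creation_operator W f x) (creation_operator W f x)
      = L2_inner f f * cinner x x"
    by (simp add: f cinner_annihilation_operator cinner_creation_operator car cinner_diff_right cinner_scaleC_right)
  then have "(norm (annihilation_operator f x))\<^sup>2 + (norm (creation_operator W f x))\<^sup>2 = Re (L2_inner f f) * (norm x)\<^sup>2"
    by (simp add: cinner_self complex_eq_iff)
  then have "norm (annihilation_operator f x) \<le> sqrt (Re (L2_inner f f) * (norm x)\<^sup>2)"
    by (intro real_le_rsqrt) (metis le_add_same_cancel1 zero_le_power2)
  then show ?thesis
    by (simp add: real_sqrt_mult)
qed

text \<open>On a wedge product the contraction is a finite sum weighted by inner products with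
  \<open>f n\<close>, which tend to 0. The uniform norm bound carries the convergence to the closed
  span.\<close>

lemma annihilation_operator_weakly_null:
  assumes f: "\<And>n. f n \<in> L2_halfline" and bound: "\<And>n. Re (L2_inner (f n) (f n)) \<le> C"
    and weak: "\<And>g. g \<in> L2_halfline \<Longrightarrow> (\<lambda>n. L2_inner (f n) g) \<longlonglongrightarrow> 0"
  shows "(\<lambda>n. annihilation_operator (f n) x) \<longlonglongrightarrow> 0"
proof (rule dense_family_induct[OF W_dense, where P = "\<lambda>x. (\<lambda>n. annihilation_operator (f n) x) \<longlonglongrightarrow> 0"])
  have norm_le: "norm (annihilation_operator (f n) x) \<le> sqrt C * norm x" for n x
    using norm_annihilation_operator_le[OF f, of n x] bound[of n]
    by (meson mult_right_mono norm_ge_zero order_trans real_sqrt_le_mono)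
  show "closed {x. (\<lambda>n. annihilation_operator (f n) x) \<longlonglongrightarrow> 0}"
    unfolding closed_sequential_limits
  proof (intro allI impI, elim conjE)
    fix y l assume y: "\<forall>m. y m \<in> {x. (\<lambda>n. annihilation_operator (f n) x) \<longlonglongrightarrow> 0}" "y \<longlonglongrightarrow> l"
    have "(\<lambda>n. annihilation_operator (f n) l) \<longlonglongrightarrow> 0"
    proof (rule LIMSEQ_I)
      fix e :: real assume e: "0 < e"
      have "(\<lambda>m. sqrt C * norm (y m - l)) \<longlonglongrightarrow> sqrt C * norm (l - l)"
        by (intro tendsto_intros y)
      then have "\<forall>\<^sub>F m in sequentially. sqrt C * norm (y m - l) < e / 2"
        using e by (intro order_tendstoD(2)) auto
      then obtain m where m: "sqrt C * norm (y m - l) < e / 2"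
        using eventually_happens'[OF sequentially_bot] by blast
      have "(\<lambda>n. annihilation_operator (f n) (y m)) \<longlonglongrightarrow> 0"
        using y(1) by simp
      from LIMSEQ_D[OF this, of "e / 2"] e
      obtain N where N: "\<And>n. n \<ge> N \<Longrightarrow> norm (annihilation_operator (f n) (y m)) < e / 2"
        by (metis diff_zero half_gt_zero)
      have "norm (annihilation_operator (f n) l) < e" if "n \<ge> N" for n
      proof -
        have "annihilation_operator (f n) l = annihilation_operator (f n) (y m) - annihilation_operator (f n) (y m - l)"
          by (simp add: annihilation_operator_linear f)
        then have "norm (annihilation_operator (f n) l) \<le>
            norm (annihilation_operator (f n) (y m)) + norm (annihilation_operator (f n) (y m - l))"
          by (metis norm_triangle_ineq4)
        then show ?thesis
          using N[OF that] norm_le[of n "y m - l"] m by linarith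
      qed
      then show "\<exists>no. \<forall>n\<ge>no. norm (annihilation_operator (f n) l - 0) < e"
        by auto
    qed
    then show "l \<in> {x. (\<lambda>n. annihilation_operator (f n) x) \<longlonglongrightarrow> 0}"
      by simp
  qed
  show "(\<lambda>n. annihilation_operator (f n) (W gs)) \<longlonglongrightarrow> 0" if gs: "gs \<in> lists L2_halfline" for gs
  proof -
    have "(\<lambda>n. contraction (f n) gs) \<longlonglongrightarrow> (\<Sum>j<length gs. ((- 1) ^ j * 0) *\<^sub>C W (remove_nth j gs))"
      unfolding contraction_def
      by (intro tendsto_sum tendsto_scaleC tendsto_mult tendsto_const weak) (use gs nth_mem in auto)
    then show ?thesis
      by (simp add: annihilation_operator_W f gs)
  qed
  show "(\<lambda>n. annihilation_operator (f n) (x + y)) \<longlonglongrightarrow> 0"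
    if "(\<lambda>n. annihilation_operator (f n) x) \<longlonglongrightarrow> 0" "(\<lambda>n. annihilation_operator (f n) y) \<longlonglongrightarrow> 0" for x y
    using tendsto_add[OF that] by (simp add: annihilation_operator_linear f)
  show "(\<lambda>n. annihilation_operator (f n) (c *\<^sub>C x)) \<longlonglongrightarrow> 0"
    if "(\<lambda>n. annihilation_operator (f n) x) \<longlonglongrightarrow> 0" for c x
    using tendsto_scaleC[OF tendsto_const[of c] that] by (simp add: annihilation_operator_linear f)
qed (simp add: annihilation_operator_linear f)

lemma annihilation_operator_fast_wave:
  assumes f: "f \<in> L2_halfline"
  shows "(\<lambda>n. annihilation_operator (\<lambda>s. fast_wave n s *\<^sub>R f s) x) \<longlonglongrightarrow> 0"
proof (rule annihilation_operator_weakly_null)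
  show "(\<lambda>s. fast_wave n s *\<^sub>R f s) \<in> L2_halfline" for n
    by (rule L2_halfline_sign[OF f, where C = 1]) auto
  show "Re (L2_inner (\<lambda>s. fast_wave n s *\<^sub>R f s) (\<lambda>s. fast_wave n s *\<^sub>R f s)) \<le> Re (L2_inner f f)" for n
    by (subst L2_inner_sign) (auto simp: fast_wave_def square_wave_square)
qed (rule L2_inner_fast_wave_tendsto[OF f])

section \<open>Second quantization of sign functions\<close>

text \<open>The second quantization of multiplication by \<phi>. Once such an operator exists the
  choice is harmless, because wedge products are total.\<close>

definition sign_change :: "(real \<Rightarrow> real) \<Rightarrow> 'h \<Rightarrow> 'h" where
  "sign_change \<phi> = (SOME A. A \<in> bounded_operators \<and>
    (\<forall>fs\<in>lists L2_halfline. A (W fs) = W (map (\<lambda>f s. \<phi> s *\<^sub>R f s) fs)))"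

context
  fixes \<phi> :: "real \<Rightarrow> real"
  assumes \<phi>: "\<phi> \<in> borel_measurable borel" "\<And>s. \<phi> s * \<phi> s = 1"
begin

lemma sign_L2: "f \<in> L2_halfline \<Longrightarrow> (\<lambda>s. \<phi> s *\<^sub>R f s) \<in> L2_halfline" for f :: "real \<Rightarrow> 'k \<times> 'k"
proof (rule L2_halfline_sign[OF _ \<phi>(1), where C = 1])
  show "\<bar>\<phi> s\<bar> \<le> 1" for s
  proof -
    have "\<phi> s = 1 \<or> \<phi> s = - 1"
      using \<phi>(2)[of s] by (simp add: square_eq_1_iff)
    then show ?thesis
      by auto
  qed
qed

lemma sign_sign: "(\<lambda>s. \<phi> s *\<^sub>R \<phi> s *\<^sub>R f s) = (f :: real \<Rightarrow> 'k \<times> 'k)"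
  using \<phi>(2) by simp

text \<open>Multiplication by a function with values 1 and -1 preserves inner products, hence Gram
  determinants, so the map on wedge products extends isometrically.\<close>

lemma sign_change_bounded: "sign_change \<phi> \<in> bounded_operators"
  and sign_change_W: "fs \<in> lists L2_halfline \<Longrightarrow> sign_change \<phi> (W fs) = W (map (\<lambda>f s. \<phi> s *\<^sub>R f s) fs)"
proof -
  let ?m = "map (\<lambda>f s. \<phi> s *\<^sub>R f s :: 'k \<times> 'k)"
  have m: "?m fs \<in> lists L2_halfline" if "fs \<in> lists L2_halfline" for fs
    using that sign_L2 by auto
  have "gram_determinant (?m fs) (?m gs) = gram_determinant fs gs" if "length fs = length gs" for fs gs
  proof -
    have "(\<Prod>i<length fs. L2_inner (?m fs ! i) (?m gs ! p i)) = (\<Prod>i<length fs. L2_inner (fs ! i) (gs ! p i))"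
      if p: "p permutes {..<length fs}" for p
      using permutes_in_image[OF p] \<open>length fs = length gs\<close> by (intro prod.cong) (auto simp: L2_inner_sign \<phi>)
    then show ?thesis
      by (simp add: gram_determinant_def)
  qed
  then have gram: "cinner (W (?m fs)) (W (?m gs)) = cinner (W fs) (W gs)"
    if "fs \<in> lists L2_halfline" "gs \<in> lists L2_halfline" for fs gs
    using that m by (simp add: cinner_W)
  have "\<exists>A. A \<in> bounded_operators \<and> (\<forall>fs\<in>lists L2_halfline. A (W fs) = W (?m fs))"
    by (rule isometric_extension[OF W_dense, of "\<lambda>fs. W (?m fs)", OF gram]) blast+
  from someI_ex[OF this] show "sign_change \<phi> \<in> bounded_operators"
    "fs \<in> lists L2_halfline \<Longrightarrow> sign_change \<phi> (W fs) = W (?m fs)"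
    by (auto simp: sign_change_def)
qed

lemma sign_change_self_adjoint: "cinner (sign_change \<phi> x) y = cinner x (sign_change \<phi> y)"
proof (rule adjoint_on_dense_family[OF W_dense sign_change_bounded sign_change_bounded])
  fix fs gs :: "(real \<Rightarrow> 'k \<times> 'k) list" assume *: "fs \<in> lists L2_halfline" "gs \<in> lists L2_halfline"
  have "L2_inner (\<lambda>s. \<phi> s *\<^sub>R f s) g = L2_inner f (\<lambda>s. \<phi> s *\<^sub>R g s)" for f g :: "real \<Rightarrow> 'k \<times> 'k"
    using L2_inner_sign[of \<phi> "\<lambda>s. \<phi> s *\<^sub>R f s" g, OF \<phi>(2)] by (simp only: sign_sign)
  then have "(\<Prod>i<length fs. L2_inner (map (\<lambda>f s. \<phi> s *\<^sub>R f s) fs ! i) (gs ! p i)) =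
      (\<Prod>i<length fs. L2_inner (fs ! i) (map (\<lambda>f s. \<phi> s *\<^sub>R f s) gs ! p i))"
    if p: "p permutes {..<length fs}" and "length fs = length gs" for p
    using permutes_in_image[OF p] that(2) by (intro prod.cong) auto
  then have "gram_determinant (map (\<lambda>f s. \<phi> s *\<^sub>R f s) fs) gs = gram_determinant fs (map (\<lambda>f s. \<phi> s *\<^sub>R f s) gs)"
    if "length fs = length gs"
    using that by (simp add: gram_determinant_def)
  moreover have "map (\<lambda>f s. \<phi> s *\<^sub>R f s) fs \<in> lists L2_halfline" "map (\<lambda>f s. \<phi> s *\<^sub>R f s) gs \<in> lists L2_halfline"
    using * sign_L2 by auto
  ultimately show "cinner (sign_change \<phi> (W fs)) (W gs) = cinner (W fs) (sign_change \<phi> (W gs))"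
    using * by (simp add: sign_change_W cinner_W)
qed

lemma sign_change_creation:
  assumes f: "f \<in> L2_halfline"
  shows "sign_change \<phi> (creation_operator W f x) = creation_operator W (\<lambda>s. \<phi> s *\<^sub>R f s) (sign_change \<phi> x)"
proof (rule eq_on_dense_family[OF W_dense, where A = "\<lambda>x. sign_change \<phi> (creation_operator W f x)"
      and B = "\<lambda>x. creation_operator W (\<lambda>s. \<phi> s *\<^sub>R f s) (sign_change \<phi> x)"])
  fix gs :: "(real \<Rightarrow> 'k \<times> 'k) list" assume gs: "gs \<in> lists L2_halfline"
  moreover have "map (\<lambda>f s. \<phi> s *\<^sub>R f s) gs \<in> lists L2_halfline"
    using gs sign_L2 by auto
  ultimately show "sign_change \<phi> (creation_operator W f (W gs)) =
      creation_operator W (\<lambda>s. \<phi> s *\<^sub>R f s) (sign_change \<phi> (W gs))"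
    using f by (simp add: creation_operator_W sign_change_W sign_L2)
qed (intro bounded_operators_comp[OF sign_change_bounded creation_operator_bounded]
    bounded_operators_comp[OF creation_operator_bounded sign_change_bounded] f sign_L2)+

lemma sign_change_annihilation:
  assumes f: "f \<in> L2_halfline"
  shows "sign_change \<phi> (annihilation_operator f x) = annihilation_operator (\<lambda>s. \<phi> s *\<^sub>R f s) (sign_change \<phi> x)"
proof (rule cinner_eq_on_dense_family[OF W_dense])
  fix gs :: "(real \<Rightarrow> 'k \<times> 'k) list"
  have "creation_operator W f (sign_change \<phi> y) = sign_change \<phi> (creation_operator W (\<lambda>s. \<phi> s *\<^sub>R f s) y)" for y
    by (simp only: sign_change_creation[OF sign_L2[OF f]] sign_sign)
  then show "cinner (W gs) (sign_change \<phi> (annihilation_operator f x)) =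
      cinner (W gs) (annihilation_operator (\<lambda>s. \<phi> s *\<^sub>R f s) (sign_change \<phi> x))"
    by (simp add: f sign_L2 flip: cinner_creation_operator sign_change_self_adjoint)
qed

lemma norm_sign_change: "norm (sign_change \<phi> x) = norm x"
proof -
  have "sign_change \<phi> (sign_change \<phi> x) = x"
  proof (rule eq_on_dense_family[OF W_dense, where A = "\<lambda>x. sign_change \<phi> (sign_change \<phi> x)" and B = "\<lambda>x. x"])
    fix gs :: "(real \<Rightarrow> 'k \<times> 'k) list" assume gs: "gs \<in> lists L2_halfline"
    moreover have "map (\<lambda>f s. \<phi> s *\<^sub>R f s) gs \<in> lists L2_halfline"
      using gs sign_L2 by auto
    ultimately show "sign_change \<phi> (sign_change \<phi> (W gs)) = W gs"
      by (simp add: sign_change_W o_def \<phi>(2))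
  qed (rule bounded_operators_comp[OF sign_change_bounded sign_change_bounded] bounded_operators_id)+
  then have "cinner (sign_change \<phi> x) (sign_change \<phi> x) = cinner x x"
    by (simp add: sign_change_self_adjoint)
  then have "(norm (sign_change \<phi> x))\<^sup>2 = (norm x)\<^sup>2"
    by (simp add: norm_eq_cinner)
  then show ?thesis
    by simp
qed

lemma sign_change_vacuum: "sign_change \<phi> (W []) = W []"
  by (simp add: sign_change_W)

end

text \<open>Through this multiplicativity, invariance under single sign functions passes to the
  square waves.\<close>

lemma sign_change_mult:
  assumes "\<phi> \<in> borel_measurable borel" "\<And>s. \<phi> s * \<phi> s = 1"
    and "\<psi> \<in> borel_measurable borel" "\<And>s. \<psi> s * \<psi> s = 1"
  shows "sign_change (\<lambda>s. \<phi> s * \<psi> s) x = sign_change \<phi> (sign_change \<psi> x)"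
proof (rule eq_on_dense_family[OF W_dense, where B = "\<lambda>x. sign_change \<phi> (sign_change \<psi> x)"])
  have *: "(\<lambda>s. \<phi> s * \<psi> s) \<in> borel_measurable borel" "\<And>s. (\<phi> s * \<psi> s) * (\<phi> s * \<psi> s) = 1"
    using assms by (simp_all add: mult.assoc mult.left_commute[of "\<psi> _"])
  fix gs :: "(real \<Rightarrow> 'k \<times> 'k) list" assume gs: "gs \<in> lists L2_halfline"
  then have "map (\<lambda>f s. \<psi> s *\<^sub>R f s) gs \<in> lists L2_halfline"
    using sign_L2[OF assms(3,4)] by auto
  then show "sign_change (\<lambda>s. \<phi> s * \<psi> s) (W gs) = sign_change \<phi> (sign_change \<psi> (W gs))"
    using gs by (simp add: sign_change_W[OF *] sign_change_W[OF assms(1,2)] sign_change_W[OF assms(3,4)] o_def)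
next
  show "sign_change (\<lambda>s. \<phi> s * \<psi> s) \<in> bounded_operators"
    using assms by (intro sign_change_bounded) (simp_all add: mult.assoc mult.left_commute[of "\<psi> _"])
  show "(\<lambda>x. sign_change \<phi> (sign_change \<psi> x)) \<in> bounded_operators"
    by (intro bounded_operators_comp[OF sign_change_bounded sign_change_bounded] assms)
qed

end

section \<open>Even Clifford elements\<close>

context fock
begin

text \<open>Annihilation is conjugate linear in \<open>f\<close>, hence -i here and +i for creation
  operators.\<close>

lemma annihilation_operator_split:
  assumes f: "f \<in> L2_halfline"
  shows "annihilation_operator f x = annihilation_operator (embed_real (\<lambda>s. fst (f s))) x
    + (- \<i>) *\<^sub>C annihilation_operator (embed_real (\<lambda>s. snd (f s))) x"
  by (intro annihilation_operator_combination L2_inner_split embed_real_L2 fst_L2 snd_L2 f)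

lemma creation_operator_split:
  assumes f: "f \<in> L2_halfline"
  shows "creation_operator W f x = creation_operator W (embed_real (\<lambda>s. fst (f s))) x
    + \<i> *\<^sub>C creation_operator W (embed_real (\<lambda>s. snd (f s))) x"
proof (rule cinner_eq_on_dense_family[OF W_dense])
  note L2 = f embed_real_L2[OF fst_L2[OF f]] embed_real_L2[OF snd_L2[OF f]]
  show "cinner (W gs) (creation_operator W f x) = cinner (W gs)
      (creation_operator W (embed_real (\<lambda>s. fst (f s))) x + \<i> *\<^sub>C creation_operator W (embed_real (\<lambda>s. snd (f s))) x)" for gs
    unfolding cinner_annihilation_operator[OF f, symmetric] annihilation_operator_split[OF f]
    by (simp add: L2 cinner_diff_left cinner_add_right cinner_scaleC_left cinner_scaleC_right
        cinner_annihilation_operator)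
qed

text \<open>Up to the factor \<open>1 / \<surd>2\<close> and the parity operator, \<open>field_difference f\<close> is right multiplication
  by \<open>u(f)\<close>.  It anticommutes with all \<open>u(g)\<close>, and so it commutes with the even algebra.\<close>

definition field_difference :: "(real \<Rightarrow> 'k) \<Rightarrow> 'h \<Rightarrow> 'h" where
  "field_difference f x = creation_operator W (embed_real f) x - annihilation_operator (embed_real f) x"

lemma clifford_generator_eq:
  "clifford_generator W f x =
    (1 / sqrt 2) *\<^sub>R (annihilation_operator (embed_real f) x + creation_operator W (embed_real f) x)"
  by (simp add: clifford_generator_def annihilation_operator_def embed_real_def Let_def)

lemma field_difference_bounded: "f \<in> L2_halfline \<Longrightarrow> field_difference f \<in> bounded_operators"
  unfolding field_difference_def[abs_def]
  by (intro bounded_operators_minus_op creation_operator_bounded annihilation_operator_bounded embed_real_L2)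

lemma clifford_generator_bounded: "f \<in> L2_halfline \<Longrightarrow> clifford_generator W f \<in> bounded_operators"
  unfolding clifford_generator_eq[abs_def] scaleR_scaleC
  by (intro bounded_operators_scale bounded_operators_plus creation_operator_bounded
      annihilation_operator_bounded embed_real_L2)

lemma clifford_generator_self_adjoint:
  "f \<in> L2_halfline \<Longrightarrow> cinner (clifford_generator W f x) y = cinner x (clifford_generator W f y)"
  by (simp add: clifford_generator_eq scaleR_scaleC cinner_scaleC_left cinner_scaleC_right
      cinner_add_left cinner_add_right cinner_annihilation_operator cinner_creation_operator embed_real_L2)

lemma scaleR_half_sqrt: "(1 / sqrt 2) *\<^sub>R ((1 / sqrt 2) *\<^sub>R x) = (1 / 2) *\<^sub>R (x :: 'v::real_vector)"
  by simp

text \<open>Both a(f) and a*(f) square to 0, so only the anticommutator |f|^2 remains.\<close>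

lemma clifford_generator_square:
  assumes f: "f \<in> L2_halfline"
  shows "clifford_generator W f (clifford_generator W f x) =
    (1 / 2) *\<^sub>R (L2_inner (embed_real f) (embed_real f) *\<^sub>C x)"
proof -
  note e = embed_real_L2[OF f]
  note lin = annihilation_operator_linear[OF e] creation_operator_linear[OF e]
  have "clifford_generator W f (clifford_generator W f x) = (1 / 2) *\<^sub>R
      (annihilation_operator (embed_real f) (annihilation_operator (embed_real f) x + creation_operator W (embed_real f) x)
      + creation_operator W (embed_real f) (annihilation_operator (embed_real f) x + creation_operator W (embed_real f) x))"
    unfolding clifford_generator_eq scaleR_half_sqrt[symmetric]
    by (simp add: scaleR_scaleC lin scaleC_add_right)
  also have "\<dots> = (1 / 2) *\<^sub>R (L2_inner (embed_real f) (embed_real f) *\<^sub>C x)"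
    by (simp add: lin car[OF e e] annihilation_operator_twice[OF e] creation_operator_twice[OF e])
  finally show ?thesis .
qed

text \<open>Double creations and double annihilations cancel by anticommutation. The mixed terms
  leave the scalar <g, f> - <f, g>, which is 0 for real functions.\<close>

lemma field_difference_anticommute:
  assumes f: "f \<in> L2_halfline" and g: "g \<in> L2_halfline"
  shows "field_difference f (clifford_generator W g x) = - clifford_generator W g (field_difference f x)"
proof -
  note e = embed_real_L2[OF f] embed_real_L2[OF g]
  note lin = annihilation_operator_linear[OF e(1)] creation_operator_linear[OF e(1)]
    annihilation_operator_linear[OF e(2)] creation_operator_linear[OF e(2)]
  have "field_difference f (clifford_generator W g x) + clifford_generator W g (field_difference f x) =
    (1 / sqrt 2) *\<^sub>R
     ((creation_operator W (embed_real f) (annihilation_operator (embed_real g) x)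
       + creation_operator W (embed_real f) (creation_operator W (embed_real g) x)
       - annihilation_operator (embed_real f) (annihilation_operator (embed_real g) x)
       - annihilation_operator (embed_real f) (creation_operator W (embed_real g) x))
     + (annihilation_operator (embed_real g) (creation_operator W (embed_real f) x)
       + creation_operator W (embed_real g) (creation_operator W (embed_real f) x)
       - annihilation_operator (embed_real g) (annihilation_operator (embed_real f) x)
       - creation_operator W (embed_real g) (annihilation_operator (embed_real f) x)))"
    unfolding clifford_generator_eq field_difference_def
    by (simp add: scaleR_scaleC lin scaleC_add_right complex_vector.scale_right_diff_distrib)
  also have "\<dots> = 0"
    by (simp add: car[OF e] car[OF e(2) e(1)] creation_operator_anticommute[OF e]
        annihilation_operator_anticommute[OF e] L2_inner_embed_real_commute[of f g])
  finally show ?thesis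
    by (simp add: eq_neg_iff_add_eq_0)
qed

section \<open>Products of generators and the even algebra\<close>

lemma clifford_product_Nil: "clifford_product W [] = id"
  and clifford_product_Cons: "clifford_product W (f # fs) = clifford_generator W f \<circ> clifford_product W fs"
  by (simp_all add: clifford_product_def)

lemma clifford_product_append:
  "clifford_product W (fs @ gs) = clifford_product W fs \<circ> clifford_product W gs"
  by (induction fs) (simp_all add: clifford_product_Nil clifford_product_Cons o_assoc)

lemma clifford_product_bounded: "fs \<in> lists L2_halfline \<Longrightarrow> clifford_product W fs \<in> bounded_operators"
proof (induction fs)
  case Nil
  then show ?case
    using bounded_operators_id by (simp add: clifford_product_Nil id_def)
next
  case (Cons f fs)
  then show ?case
    using bounded_operators_comp[OF clifford_generator_bounded, of f "clifford_product W fs"]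
    by (simp add: clifford_product_Cons o_def)
qed

lemma clifford_product_rev_adjoint:
  "fs \<in> lists L2_halfline \<Longrightarrow> cinner (clifford_product W (rev fs) x) y = cinner x (clifford_product W fs y)"
proof (induction fs arbitrary: x y)
  case (Cons f fs)
  then show ?case
    by (simp add: clifford_product_append clifford_product_Cons clifford_product_Nil
        clifford_generator_self_adjoint)
qed (simp add: clifford_product_Nil)

lemma field_difference_clifford_product:
  assumes "f \<in> L2_halfline"
  shows "fs \<in> lists L2_halfline \<Longrightarrow>
    field_difference f (clifford_product W fs x) = (- 1) ^ length fs *\<^sub>C clifford_product W fs (field_difference f x)"
proof (induction fs)
  case (Cons g fs)
  then have "field_difference f (clifford_product W (g # fs) x) =
      - clifford_generator W g ((- 1) ^ length fs *\<^sub>C clifford_product W fs (field_difference f x))"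
    using assms by (simp add: clifford_product_Cons field_difference_anticommute)
  also have "\<dots> = - ((- 1) ^ length fs *\<^sub>C clifford_generator W g (clifford_product W fs (field_difference f x)))"
    using Cons by (simp add: bounded_operators_scaleC[OF clifford_generator_bounded])
  finally show ?case
    by (simp add: clifford_product_Cons)
qed (simp add: clifford_product_Nil)

definition even_products :: "('h \<Rightarrow> 'h) set" where
  "even_products = clifford_product W ` {fs \<in> lists L2_halfline. even (length fs)}"

lemma even_productsE:
  assumes "p \<in> even_products"
  obtains fs where "fs \<in> lists L2_halfline" "even (length fs)" "p = clifford_product W fs"
  using assms unfolding even_products_def by blast

lemma even_clifford_algebra_eq: "even_clifford_algebra W = commutant (commutant even_products)"
  by (simp add: even_clifford_algebra_def even_products_def)

lemma even_products_bounded: "even_products \<subseteq> bounded_operators"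
  by (auto simp: even_products_def intro!: clifford_product_bounded)

lemma even_products_subset: "even_products \<subseteq> even_clifford_algebra W"
  unfolding even_clifford_algebra_eq by (rule commutant_commutant_superset[OF even_products_bounded])

lemma id_in_even_products: "id \<in> even_products"
  unfolding even_products_def by (rule image_eqI[of _ _ "[]"]) (simp_all add: clifford_product_Nil)

text \<open>The flow is an endomorphism semigroup of the full algebra; this inclusion makes its
  normality available on even elements.\<close>

lemma even_clifford_algebra_subset: "even_clifford_algebra W \<subseteq> clifford_algebra W"
  unfolding even_clifford_algebra_eq clifford_algebra_def
proof (rule commutant_antimono, rule subsetI)
  fix B assume B: "B \<in> commutant (clifford_generator W ` L2_halfline)"
  have "B (clifford_product W fs x) = clifford_product W fs (B x)" if "fs \<in> lists L2_halfline" for fs x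
    using that by (induction fs) (simp_all add: clifford_product_Nil clifford_product_Cons commutantD[OF B])
  then show "B \<in> commutant even_products"
    using B by (intro commutantI) (auto simp: even_products_def commutant_def)
qed

text \<open>Passing an even product costs an even number of signs, so the field differences lie in
  the commutant of the even products, and \<open>U\<close> lies in the commutant of that.\<close>

lemma even_clifford_algebra_commutes_field_difference:
  assumes U: "U \<in> even_clifford_algebra W" and f: "f \<in> L2_halfline"
  shows "U (field_difference f x) = field_difference f (U x)"
proof -
  have "field_difference f \<in> commutant even_products"
  proof (rule commutantI[OF field_difference_bounded[OF f]])
    fix B x assume "B \<in> even_products"
    then obtain fs where fs: "fs \<in> lists L2_halfline" "even (length fs)" "B = clifford_product W fs"
      by (rule even_productsE)
    then show "field_difference f (B x) = B (field_difference f x)"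
      using field_difference_clifford_product[OF f fs(1), of x] by simp
  qed
  then show ?thesis
    using U unfolding even_clifford_algebra_eq by (intro commutantD)
qed

section \<open>Localization of relative commutants\<close>

text \<open>The modulated function is exhibited as a shift again because a relative commutant is
  only known to commute with even products of shifted functions.\<close>

lemma shift_sign_L2:
  fixes f :: "real \<Rightarrow> 'k"
  assumes "f \<in> L2_halfline" and [measurable]: "\<phi> \<in> borel_measurable borel" and "\<And>s. \<bar>\<phi> s\<bar> \<le> C"
  obtains g where "g \<in> L2_halfline" "(\<lambda>x. \<phi> x *\<^sub>R shift s f x) = shift s g"
proof (rule that)
  show "(\<lambda>x. \<phi> (x + s) *\<^sub>R f x) \<in> L2_halfline"
    by (rule L2_halfline_sign[OF assms(1), where C = C]) (use assms in measurable)
qed (auto simp: shift_def)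

text \<open>Conjugation of \<open>U\<close> by \<open>u(F)\<close> does not depend on the choice of the vector \<open>F\<close> of given norm in
  \<open>L\<^sup>2(s, \<infinity>)\<close>.  On the vacuum this says that \<open>a\<^sup>*(F) a(F) U\<Omega>\<close> does not depend on \<open>F\<close>, and \<open>F\<close> may be
  replaced by a weakly null sequence.\<close>

lemma relative_commutant_localized:
  assumes U: "U \<in> even_clifford_algebra W" and s: "0 \<le> s"
    and commute: "\<And>fs x. fs \<in> lists L2_halfline \<Longrightarrow> even (length fs) \<Longrightarrow>
      U (clifford_product W (map (shift s) fs) x) = clifford_product W (map (shift s) fs) (U x)"
    and f: "f \<in> L2_halfline"
  shows "annihilation_operator (embed_real (shift s f)) (U (W [])) = 0"
proof -
  define \<xi> where "\<xi> = U (W [])"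
  define r where "r = L2_inner (embed_real (shift s f)) (embed_real (shift s f))"
  have Ub: "U \<in> bounded_operators"
    using U commutant_bounded by (auto simp: even_clifford_algebra_eq)
  have number: "clifford_generator W (shift s g) (U (clifford_generator W (shift s g) (W []))) =
      (1 / 2) *\<^sub>R (L2_inner (embed_real (shift s g)) (embed_real (shift s g)) *\<^sub>C \<xi> -
        2 *\<^sub>C creation_operator W (embed_real (shift s g)) (annihilation_operator (embed_real (shift s g)) \<xi>))"
    if g: "g \<in> L2_halfline" for g
  proof -
    let ?G = "shift s g"
    have G: "?G \<in> L2_halfline"
      by (rule L2_halfline_shift[OF g s])
    note e = embed_real_L2[OF G]
    note lin = annihilation_operator_linear[OF e] creation_operator_linear[OF e]
    \<comment> \<open>Since a(G) kills the vacuum, u(G) may be replaced there by the field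
      difference, which \<open>U\<close> does commute with.\<close>
    have "clifford_generator W ?G (W []) = (1 / sqrt 2) *\<^sub>R field_difference ?G (W [])"
      by (simp add: clifford_generator_eq field_difference_def e)
    then have "U (clifford_generator W ?G (W [])) = (1 / sqrt 2) *\<^sub>R field_difference ?G \<xi>"
      by (simp add: scaleR_scaleC bounded_operators_scaleC[OF Ub] \<xi>_def
          even_clifford_algebra_commutes_field_difference[OF U G])
    then have "clifford_generator W ?G (U (clifford_generator W ?G (W []))) = (1 / 2) *\<^sub>R
        (annihilation_operator (embed_real ?G) (field_difference ?G \<xi>) + creation_operator W (embed_real ?G) (field_difference ?G \<xi>))"
      unfolding scaleR_half_sqrt[symmetric]
      by (simp add: scaleR_scaleC clifford_generator_eq bounded_operators_scaleC[OF clifford_generator_bounded[OF G]] lin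
          scaleC_add_right scaleC_scaleC)
    also have "annihilation_operator (embed_real ?G) (field_difference ?G \<xi>) + creation_operator W (embed_real ?G) (field_difference ?G \<xi>) =
        L2_inner (embed_real ?G) (embed_real ?G) *\<^sub>C \<xi> - 2 *\<^sub>C creation_operator W (embed_real ?G) (annihilation_operator (embed_real ?G) \<xi>)"
      using scaleC_of_real[of 2 "creation_operator W (embed_real ?G) (annihilation_operator (embed_real ?G) \<xi>)"]
      by (simp add: field_difference_def lin car[OF e e] annihilation_operator_twice[OF e]
          creation_operator_twice[OF e] scaleR_2)
    finally show ?thesis .
  qed
  show ?thesis
  proof (cases "r = 0")
    \<comment> \<open>A null vector is annihilated by the norm bound; in the other case
      \<open>r\<close> can be cancelled.\<close>
    case True
    then show ?thesis
      using norm_annihilation_operator_le[OF embed_real_L2[OF L2_halfline_shift[OF f s]], of \<xi>]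
      by (simp add: r_def \<xi>_def)
  next
    case False
    have equal: "norm (annihilation_operator (embed_real (shift s f)) \<xi>) = norm (annihilation_operator (embed_real (shift s g)) \<xi>)"
      if g: "g \<in> L2_halfline" and r: "L2_inner (embed_real (shift s g)) (embed_real (shift s g)) = r" for g
    proof -
      let ?F = "shift s f" and ?G = "shift s g"
      let ?u = "clifford_generator W"
      note FG = L2_halfline_shift[OF f s] L2_halfline_shift[OF g s]
      have FF: "?u ?F (?u ?F x) = (r / 2) *\<^sub>C x" and GG: "?u ?G (?u ?G x) = (r / 2) *\<^sub>C x" for x
        using FG r r_def by (simp_all add: clifford_generator_square scaleR_scaleC scaleC_scaleC)
      have UFG: "U (?u ?F (?u ?G x)) = ?u ?F (?u ?G (U x))" for x
        using commute[of "[f, g]" x] f g by (simp add: clifford_product_Cons clifford_product_Nil)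
      \<comment> \<open>Both sides equal (r/2) u(G) U x: on the left \<open>U\<close> passes the
        even product u(F) u(G), on the right u(G) u(G) is already a scalar.\<close>
      have "?u ?F (U (?u ?F (?u ?G x))) = ?u ?G (U (?u ?G (?u ?G x)))" for x
        by (simp add: UFG FF GG bounded_operators_scaleC[OF Ub] bounded_operators_scaleC[OF clifford_generator_bounded[OF FG(1)]]
            bounded_operators_scaleC[OF clifford_generator_bounded[OF FG(2)]])
      \<comment> \<open>At the argument u(G) x the inner square u(G) u(G) becomes the scalar r/2 on
        both sides.\<close>
      from this[of "?u ?G x" for x] have "(r / 2) *\<^sub>C ?u ?F (U (?u ?F x)) = (r / 2) *\<^sub>C ?u ?G (U (?u ?G x))" for x
        by (simp only: GG bounded_operators_scaleC[OF Ub] bounded_operators_scaleC[OF clifford_generator_bounded[OF FG(1)]]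
            bounded_operators_scaleC[OF clifford_generator_bounded[OF FG(2)]])
      then have "?u ?F (U (?u ?F (W []))) = ?u ?G (U (?u ?G (W [])))"
        using False by (simp add: complex_vector.scale_cancel_left)
      then have "creation_operator W (embed_real ?F) (annihilation_operator (embed_real ?F) \<xi>) =
          creation_operator W (embed_real ?G) (annihilation_operator (embed_real ?G) \<xi>)"
        unfolding number[OF f] number[OF g] r r_def[symmetric] by (simp add: complex_vector.scale_cancel_left)
      then have "cinner (annihilation_operator (embed_real ?F) \<xi>) (annihilation_operator (embed_real ?F) \<xi>) =
          cinner (annihilation_operator (embed_real ?G) \<xi>) (annihilation_operator (embed_real ?G) \<xi>)"
        by (simp add: cinner_annihilation_operator embed_real_L2 FG)
      then have "(norm (annihilation_operator (embed_real ?F) \<xi>))\<^sup>2 = (norm (annihilation_operator (embed_real ?G) \<xi>))\<^sup>2"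
        by (simp only: norm_eq_cinner)
      then show ?thesis
        by simp
    qed
    let ?F = "embed_real (shift s f)"
    have "norm (annihilation_operator ?F \<xi>) = norm (annihilation_operator (\<lambda>x. fast_wave n x *\<^sub>R ?F x) \<xi>)" for n
    proof -
      obtain g where g: "g \<in> L2_halfline" "(\<lambda>x. fast_wave n x *\<^sub>R shift s f x) = shift s g"
        using shift_sign_L2[OF f fast_wave_measurable, of n 1 s] by auto
      have eq: "embed_real (shift s g) = (\<lambda>x. fast_wave n x *\<^sub>R ?F x)"
        unfolding g(2)[symmetric] by (simp add: embed_real_def)
      have "L2_inner (embed_real (shift s g)) (embed_real (shift s g)) = r"
        unfolding eq r_def by (rule L2_inner_sign) (simp add: fast_wave_def square_wave_square)
      then show ?thesis
        using equal[OF g(1)] eq by simp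
    qed
    moreover have "(\<lambda>n. norm (annihilation_operator (\<lambda>x. fast_wave n x *\<^sub>R ?F x) \<xi>)) \<longlonglongrightarrow> 0"
      by (intro tendsto_norm_zero annihilation_operator_fast_wave embed_real_L2 L2_halfline_shift f s)
    ultimately have "(\<lambda>n :: nat. norm (annihilation_operator ?F \<xi>)) \<longlonglongrightarrow> 0"
      by simp
    then show ?thesis
      by (simp add: LIMSEQ_const_iff \<xi>_def)
  qed
qed

section \<open>Parity of the number of particles after a given time\<close>

lemma annihilation_shift_complex:
  assumes real: "\<And>f. f \<in> L2_halfline \<Longrightarrow> annihilation_operator (embed_real (shift s f)) \<xi> = 0"
    and s: "0 \<le> s" and f: "f \<in> L2_halfline"
  shows "annihilation_operator (shift s f) \<xi> = 0"
proof -
  have "(\<lambda>x. fst (shift s f x)) = shift s (\<lambda>x. fst (f x))" "(\<lambda>x. snd (shift s f x)) = shift s (\<lambda>x. snd (f x))"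
    by (auto simp: shift_def)
  then show ?thesis
    using annihilation_operator_split[OF L2_halfline_shift[OF f s], of \<xi>] real[OF fst_L2[OF f]] real[OF snd_L2[OF f]]
    by simp
qed

text \<open>Induction over a wedge product paired with \<xi>. Flipping \<open>f\<close> after
  \<open>s\<close> changes it by a shifted function, whose annihilation operator kills \<xi>. The
  vector a(f) \<xi> is again killed by all shifted functions, by anticommutation, so the induction
  varies \<xi>.\<close>

lemma sign_change_localized:
  assumes s: "0 \<le> s" and ann: "\<And>f. f \<in> L2_halfline \<Longrightarrow> annihilation_operator (shift s f) \<xi> = 0"
  shows "sign_change (sign_at s) \<xi> = \<xi>"
proof (rule cinner_eq_on_dense_family[OF W_dense])
  note sign = sign_at_measurable[of s] sign_at_square[of s]
  fix fs :: "(real \<Rightarrow> 'k \<times> 'k) list" assume "fs \<in> lists L2_halfline"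
  then have "cinner (sign_change (sign_at s) (W fs)) \<xi> = cinner (W fs) \<xi>"
    using ann
  proof (induction fs arbitrary: \<xi> rule: list.induct)
    case Nil
    then show ?case
      by (simp add: sign_change_vacuum[OF sign])
  next
    case (Cons f fs)
    then have f: "f \<in> L2_halfline" and fs: "fs \<in> lists L2_halfline"
      by auto
    \<comment> \<open>The factor 2 is the jump between \<open>f\<close> and its negative after
      \<open>s\<close>; the argument \<open>x + s\<close> cancels the shift.\<close>
    let ?f = "\<lambda>x. sign_at s x *\<^sub>R f x" and ?g = "\<lambda>x. 2 *\<^sub>R f (x + s)"
    have g: "?g \<in> L2_halfline"
      by (rule L2_halfline_compose[OF L2_halfline_unshift[OF f s] bounded_linear_scaleR_right])
    have split: "f = (\<lambda>x. ?f x + shift s ?g x)"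
      by (auto simp: sign_at_def shift_def scaleR_2)
    have "annihilation_operator f \<xi> = annihilation_operator ?f \<xi> + 1 *\<^sub>C annihilation_operator (shift s ?g) \<xi>"
    proof (rule annihilation_operator_combination)
      show "L2_inner f h = L2_inner ?f h + 1 * L2_inner (shift s ?g) h" if "h \<in> L2_halfline" for h
        by (subst split, subst L2_inner_add_left)
          (simp_all add: sign_L2[OF sign] L2_halfline_shift f g s that)
    qed (simp_all add: sign_L2[OF sign] L2_halfline_shift f g s)
    then have eq: "annihilation_operator ?f \<xi> = annihilation_operator f \<xi>"
      by (simp add: Cons.prems(2)[OF g])
    have "cinner (sign_change (sign_at s) (W (f # fs))) \<xi> = cinner (sign_change (sign_at s) (W fs)) (annihilation_operator f \<xi>)"
      by (simp add: f fs sign_L2[OF sign] sign_change_creation[OF sign] cinner_creation_operator eq flip: creation_operator_W)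
    also have "\<dots> = cinner (W fs) (annihilation_operator f \<xi>)"
    proof (rule Cons.IH[OF fs])
      fix h :: "real \<Rightarrow> 'k \<times> 'k" assume h: "h \<in> L2_halfline"
      show "annihilation_operator (shift s h) (annihilation_operator f \<xi>) = 0"
        using annihilation_operator_anticommute[OF L2_halfline_shift[OF h s] f, of \<xi>]
        by (simp add: Cons.prems(2)[OF h] annihilation_operator_linear f)
    qed
    also have "\<dots> = cinner (W (f # fs)) \<xi>"
      by (simp add: f fs flip: cinner_creation_operator creation_operator_W)
    finally show ?case .
  qed
  then show "cinner (W fs) (sign_change (sign_at s) \<xi>) = cinner (W fs) \<xi>"
    by (simp only: sign_change_self_adjoint[OF sign])
qed

text \<open>Shifted functions live where the sign is -1, so the sign operator anticommutes with each
  generator, and an even number of signs cancels.\<close>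

lemma sign_change_clifford_product:
  assumes "fs \<in> lists L2_halfline" "0 \<le> s" "even (length fs)"
  shows "sign_change (sign_at s) (clifford_product W (map (shift s) fs) x) =
    clifford_product W (map (shift s) fs) (sign_change (sign_at s) x)"
proof -
  note sign = sign_at_measurable[of s] sign_at_square[of s]
  have gen: "sign_change (sign_at s) (clifford_generator W (shift s f) x) =
      - clifford_generator W (shift s f) (sign_change (sign_at s) x)" if f: "f \<in> L2_halfline" for f x
  proof -
    let ?F = "embed_real (shift s f)"
    have F: "?F \<in> L2_halfline"
      by (intro embed_real_L2 L2_halfline_shift f assms)
    have eq: "(\<lambda>x. sign_at s x *\<^sub>R ?F x) = (\<lambda>x. - ?F x)"
      by (auto simp: sign_at_def embed_real_def shift_def)
    have F': "(\<lambda>x. - ?F x) \<in> L2_halfline"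
      using sign_L2[OF sign F] unfolding eq .
    have ann: "annihilation_operator (\<lambda>x. - ?F x) y = - annihilation_operator ?F y" for y
    proof -
      \<comment> \<open>Negation is written as 1 - 2 to fit the form of
        \<open>annihilation_operator_combination\<close>.\<close>
      have "annihilation_operator (\<lambda>x. - ?F x) y = annihilation_operator ?F y + (- 2) *\<^sub>C annihilation_operator ?F y"
        by (rule annihilation_operator_combination[OF F' F F])
          (simp add: L2_inner_def complexified_inner_scaleR(1)[of "- 1", simplified])
      then show ?thesis
        using complex_vector.scale_left_distrib[of 1 "- 2" "annihilation_operator ?F y"] by simp
    qed
    have cre: "creation_operator W (\<lambda>x. - ?F x) y = - creation_operator W ?F y" for y
    proof (rule cinner_eq_on_dense_family[OF W_dense])
      show "cinner (W gs) (creation_operator W (\<lambda>x. - ?F x) y) = cinner (W gs) (- creation_operator W ?F y)" for gs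
        by (simp add: F F' ann flip: cinner_annihilation_operator)
    qed
    show ?thesis
      unfolding clifford_generator_eq scaleR_scaleC
      by (simp add: bounded_operators_scaleC[OF sign_change_bounded[OF sign]] bounded_operators_add[OF sign_change_bounded[OF sign]]
          sign_change_annihilation[OF sign F] sign_change_creation[OF sign F] eq ann cre)
        (simp flip: complex_vector.scale_minus_right)
  qed
  have "sign_change (sign_at s) (clifford_product W (map (shift s) fs) x) =
      (- 1) ^ length fs *\<^sub>C clifford_product W (map (shift s) fs) (sign_change (sign_at s) x)"
    using assms(1)
  proof (induction fs)
    case (Cons f fs)
    then show ?case
      by (simp add: clifford_product_Cons gen
          bounded_operators_scaleC[OF clifford_generator_bounded[OF L2_halfline_shift[OF _ assms(2)]]])
  qed (simp add: clifford_product_Nil)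
  then show ?thesis
    using assms(3) by simp
qed

lemma sign_change_square_wave:
  assumes "\<And>s. 0 \<le> s \<Longrightarrow> sign_change (sign_at s) \<xi> = \<xi>" "0 \<le> h"
  shows "sign_change (square_wave h m) \<xi> = \<xi>"
proof (induction m)
  case 0
  have one: "(\<lambda>s. 1 :: real) \<in> borel_measurable borel" "\<And>s. (1 :: real) * 1 = 1"
    by simp_all
  have "sign_change (\<lambda>s. 1) \<xi> = \<xi>"
    by (rule eq_on_dense_family[OF W_dense sign_change_bounded[OF one] bounded_operators_id])
      (simp add: sign_change_W[OF one])
  then show ?case
    by (simp add: square_wave_def[abs_def])
next
  case (Suc m)
  have "sign_change (\<lambda>x. square_wave h m x * sign_at (real (Suc m) * h) x) \<xi> = \<xi>"
    using sign_change_mult[OF square_wave_measurable square_wave_square sign_at_measurable sign_at_square, of h m "real (Suc m) * h" \<xi>]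
      assms(1)[of "real (Suc m) * h"] assms(2) Suc by simp
  then show ?case
    by (simp only: square_wave_Suc[abs_def])
qed

lemma sign_invariant_annihilated:
  assumes inv: "\<And>s. 0 \<le> s \<Longrightarrow> sign_change (sign_at s) \<xi> = \<xi>" and f: "f \<in> L2_halfline"
  shows "annihilation_operator f \<xi> = 0"
proof -
  have "norm (annihilation_operator f \<xi>) = norm (annihilation_operator (\<lambda>x. fast_wave n x *\<^sub>R f x) \<xi>)" for n
  proof -
    note wave = fast_wave_measurable[of n] square_wave_square[of "inverse (real (Suc n))" "Suc n * Suc n", folded fast_wave_def]
    have "sign_change (fast_wave n) \<xi> = \<xi>"
      unfolding fast_wave_def by (rule sign_change_square_wave[OF inv]) simp_all
    then have "sign_change (fast_wave n) (annihilation_operator f \<xi>) = annihilation_operator (\<lambda>x. fast_wave n x *\<^sub>R f x) \<xi>"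
      by (simp add: sign_change_annihilation[OF wave f])
    then show ?thesis
      using norm_sign_change[OF wave, of "annihilation_operator f \<xi>"] by simp
  qed
  moreover have "(\<lambda>n. norm (annihilation_operator (\<lambda>x. fast_wave n x *\<^sub>R f x) \<xi>)) \<longlonglongrightarrow> 0"
    by (intro tendsto_norm_zero annihilation_operator_fast_wave f)
  ultimately have "(\<lambda>n :: nat. norm (annihilation_operator f \<xi>)) \<longlonglongrightarrow> 0"
    by simp
  then show ?thesis
    by (simp add: LIMSEQ_const_iff)
qed

section \<open>From the vacuum vector to scalar operators\<close>

lemma cinner_vacuum: "cinner (W []) (W []) = 1"
  by (simp add: cinner_W gram_determinant_def)

text \<open>A wedge product of positive length is orthogonal to \<xi>, as its first creation
  operator moves across the inner product and annihilates \<xi>.\<close>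

lemma annihilated_is_vacuum:
  assumes "\<And>f. f \<in> L2_halfline \<Longrightarrow> annihilation_operator f \<xi> = 0"
  shows "\<xi> = cinner (W []) \<xi> *\<^sub>C W []"
proof (rule cinner_eq_on_dense_family[OF W_dense])
  fix gs :: "(real \<Rightarrow> 'k \<times> 'k) list" assume "gs \<in> lists L2_halfline"
  then show "cinner (W gs) \<xi> = cinner (W gs) (cinner (W []) \<xi> *\<^sub>C W [])"
    by (cases gs) (simp_all add: cinner_scaleC_right cinner_vacuum assms cinner_creation_operator flip: creation_operator_W)
qed

text \<open>For real \<open>f\<close>, wedging with \<open>f\<close> is the field difference plus a
  contraction. \<open>U\<close> commutes with the former, and the latter produces shorter wedge
  products; hence the strong induction on length.\<close>

lemma even_clifford_algebra_scalar:
  assumes U: "U \<in> even_clifford_algebra W" and vac: "U (W []) = c *\<^sub>C W []"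
  shows "U x = c *\<^sub>C x"
proof -
  have Ub: "U \<in> bounded_operators"
    using U commutant_bounded by (auto simp: even_clifford_algebra_eq)
  have "U (W gs) = c *\<^sub>C W gs" if "gs \<in> lists L2_halfline" for gs
    using that
  proof (induction "length gs" arbitrary: gs rule: less_induct)
    case less
    show ?case
    proof (cases gs)
      case Nil
      then show ?thesis
        using vac by simp
    next
      case (Cons g hs)
      then have g: "g \<in> L2_halfline" and hs: "hs \<in> lists L2_halfline"
        using less.prems by auto
      have IH: "U (W hs) = c *\<^sub>C W hs"
        using less.hyps[of hs] hs Cons by simp
      have ann: "U (contraction f hs) = c *\<^sub>C contraction f hs" for f
        unfolding contraction_def bounded_operators_sum[OF Ub] complex_vector.scale_sum_right
      proof (rule sum.cong[OF refl])
        fix j assume "j \<in> {..<length hs}"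
        then have "U (W (remove_nth j hs)) = c *\<^sub>C W (remove_nth j hs)"
          using less.hyps[of "remove_nth j hs"] Cons remove_nth_in_lists[OF hs] by (simp add: length_remove_nth)
        then show "U (((- 1) ^ j * L2_inner f (hs ! j)) *\<^sub>C W (remove_nth j hs)) =
            c *\<^sub>C ((- 1) ^ j * L2_inner f (hs ! j)) *\<^sub>C W (remove_nth j hs)"
          by (simp add: bounded_operators_scaleC[OF Ub] scaleC_scaleC mult.commute)
      qed
      have real: "U (creation_operator W (embed_real f) (W hs)) = c *\<^sub>C creation_operator W (embed_real f) (W hs)"
        if f: "f \<in> L2_halfline" for f
      proof -
        note e = embed_real_L2[OF f]
        have cre: "creation_operator W (embed_real f) (W hs) = field_difference f (W hs) + contraction (embed_real f) hs"
          by (simp add: field_difference_def annihilation_operator_W[OF e hs])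
        have "U (field_difference f (W hs)) = c *\<^sub>C field_difference f (W hs)"
          by (simp add: even_clifford_algebra_commutes_field_difference[OF U f] IH
              bounded_operators_scaleC[OF field_difference_bounded[OF f]])
        then show ?thesis
          by (simp add: cre bounded_operators_add[OF Ub] ann scaleC_add_right)
      qed
      have "U (creation_operator W g (W hs)) = c *\<^sub>C creation_operator W g (W hs)"
        unfolding creation_operator_split[OF g]
        by (simp add: bounded_operators_add[OF Ub] bounded_operators_scaleC[OF Ub] real fst_L2 snd_L2 g
            scaleC_add_right scaleC_scaleC mult.commute)
      then show ?thesis
        using Cons g hs by (simp add: creation_operator_W)
    qed
  qed
  then show ?thesis
    by (rule eq_on_dense_family[OF W_dense Ub bounded_operators_scale[OF bounded_operators_id]])
qed

end

section \<open>Gauge cocycles of the even Clifford flow\<close>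

text \<open>Continuity improves to differentiability: integrating p(t + x) = p(t) p(x) over x in
  [0, a] writes p(t) times I, the integral of p over [0, a], as the integral over [t, t + a]. With I
  nonzero, differentiation in t gives p' = \<mu> p for \<mu> = (p(a) - 1) / I.\<close>

lemma continuous_multiplicative_is_exp:
  fixes p :: "real \<Rightarrow> complex"
  assumes cont: "continuous_on {0..} p" and p0: "p 0 = 1"
    and mult: "\<And>s t. 0 \<le> s \<Longrightarrow> 0 \<le> t \<Longrightarrow> p (s + t) = p s * p t"
  obtains \<mu> where "\<And>t. 0 \<le> t \<Longrightarrow> p t = exp (\<mu> * of_real t)"
proof -
  \<comment> \<open>Continued to negative times by the constant \<open>p 0\<close>, so that the
    primitive started at -1 has a two-sided derivative at 0.\<close>
  define q where "q x = p (max 0 x)" for x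
  have q: "continuous_on S q" for S
    unfolding q_def by (rule continuous_on_compose2[OF cont]) (auto intro!: continuous_intros)
  have q_int: "q integrable_on {x..y}" for x y
    by (intro integrable_continuous_real q)
  define \<Phi> where "\<Phi> x = integral {-1..x} q" for x
  have \<Phi>: "(\<Phi> has_vector_derivative q x) (at x)" if "-1 < x" for x
  proof -
    have "(\<Phi> has_vector_derivative q x) (at x within {-1..x+1})"
      unfolding \<Phi>_def using that by (intro integral_has_vector_derivative q) auto
    moreover have "at x within {-1..x+1} = at x"
      using that by (intro at_within_interior) auto
    ultimately show ?thesis
      by simp
  qed
  \<comment> \<open>Otherwise the primitive would be constant on [0, 1], while its derivative at 0
    is \<open>p 0\<close>, that is 1.\<close>
  have "\<exists>a>0. \<Phi> a \<noteq> \<Phi> 0"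
  proof (rule ccontr)
    assume no: "\<not> (\<exists>a>0. \<Phi> a \<noteq> \<Phi> 0)"
    have const: "\<Phi> x = \<Phi> 0" if "x \<in> {0..1}" for x
      using no that by (cases "x = 0") auto
    have "(\<Phi> has_vector_derivative 0) (at 0 within {0..1})"
      by (rule has_vector_derivative_transform[where f = "\<lambda>_. \<Phi> 0", OF _ const]) simp_all
    moreover have "(\<Phi> has_vector_derivative 1) (at 0 within {0..1})"
      using has_vector_derivative_at_within[OF \<Phi>[of 0]] p0 by (simp add: q_def)
    moreover have "at (0::real) within {0..1} \<noteq> bot"
      by (simp add: trivial_limit_within)
    ultimately show False
      using vector_derivative_unique_within zero_neq_one by blast
  qed
  then obtain a where a: "0 < a" "\<Phi> a \<noteq> \<Phi> 0"
    by blast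
  define I where "I = \<Phi> a - \<Phi> 0"
  have I: "I \<noteq> 0"
    using a by (simp add: I_def)
  have increment: "\<Phi> (t + a) - \<Phi> t = integral {t..t + a} q" if "0 \<le> t" for t
  proof -
    have "integral {-1..t} q + integral {t..t + a} q = integral {-1..t + a} q"
      using a that by (intro Henstock_Kurzweil_Integration.integral_combine q_int) auto
    then show ?thesis
      by (simp add: \<Phi>_def algebra_simps)
  qed
  have translate: "\<Phi> (t + a) - \<Phi> t = p t * I" if t: "0 \<le> t" for t
  proof -
    have "integral {t..t + a} q = integral {0..a} (q \<circ> (+) t)"
      using integral_shift_cbox_plus[of 0 a q t] by (simp add: add.commute)
    also have "\<dots> = integral {0..a} (\<lambda>x. p t * q x)"
      using t by (intro integral_cong) (simp add: q_def mult)
    also have "\<dots> = p t * integral {0..a} q"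
      by simp
    finally show ?thesis
      using increment[OF t] increment[of 0] by (simp add: I_def)
  qed
  define \<mu> where "\<mu> = (p a - 1) / I"
  have deriv: "(p has_vector_derivative \<mu> * p t) (at t within {0..})" if t: "0 \<le> t" for t
  proof -
    have "((\<Phi> \<circ> (\<lambda>t. t + a)) has_vector_derivative 1 *\<^sub>R q (t + a)) (at t)"
      using t a by (intro vector_diff_chain_at \<Phi>) (auto intro!: derivative_eq_intros)
    then have "((\<lambda>t. \<Phi> (t + a) - \<Phi> t) has_vector_derivative q (t + a) - q t) (at t)"
      using t by (intro has_vector_derivative_diff \<Phi>) (auto simp: o_def)
    then have "((\<lambda>t. (\<Phi> (t + a) - \<Phi> t) * inverse I) has_vector_derivative (q (t + a) - q t) * inverse I) (at t within {0..})"
      by (rule has_vector_derivative_mult_left[OF has_vector_derivative_at_within])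
    then have "(p has_vector_derivative (q (t + a) - q t) * inverse I) (at t within {0..})"
      by (rule has_vector_derivative_transform[rotated 2]) (use t I translate in auto)
    moreover have "(q (t + a) - q t) * inverse I = \<mu> * p t"
      using t a mult[of t a] by (simp add: q_def \<mu>_def field_simps)
    ultimately show ?thesis
      by simp
  qed
  have "((\<lambda>t. p t * exp (t *\<^sub>R (- \<mu>))) has_vector_derivative 0) (at t within {0..})" if "t \<in> {0..}" for t
    by (rule has_vector_derivative_eq_rhs[OF has_vector_derivative_mult[OF deriv exp_scaleR_has_vector_derivative_right]])
      (use that in \<open>auto simp: algebra_simps\<close>)
  then obtain c where c: "\<And>t. t \<in> {0..} \<Longrightarrow> p t * exp (t *\<^sub>R (- \<mu>)) = c"
    using has_vector_derivative_zero_constant[of "{0::real..}" "\<lambda>t. p t * exp (t *\<^sub>R (- \<mu>))"] convex_real_interval(1) by blast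
  have "p t = exp (\<mu> * of_real t)" if "0 \<le> t" for t
  proof -
    have "p t * exp (- (\<mu> * of_real t)) = 1"
      using c[of t] c[of 0] that p0 by (simp add: scaleR_conv_of_real mult.commute)
    then show ?thesis
      by (simp add: exp_minus field_simps)
  qed
  then show ?thesis
    by (rule that)
qed

text \<open>One time determines the exponent only modulo 2 \<pi> i. A time so small that |Im (c -
  d)| t < 1 leaves no room for a nonzero multiple.\<close>

lemma exp_linear_eq_imp_eq:
  assumes "\<And>t :: real. 0 \<le> t \<Longrightarrow> exp (c * of_real t) = exp (d * of_real t)"
  shows "c = (d :: complex)"
proof -
  define t :: real where "t = 1 / (\<bar>Im (c - d)\<bar> + 1)"
  have t: "0 < t" "\<bar>Im (c - d)\<bar> * t < 1"
    by (auto simp: t_def field_simps)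
  have "exp ((c - d) * of_real t) = 1"
    using assms[of t] t(1) by (simp add: left_diff_distrib exp_diff)
  then obtain n :: int where n: "Re (c - d) * t = 0" "Im (c - d) * t = of_int (2 * n) * pi"
    by (auto simp: exp_eq_1)
  have "\<bar>Im (c - d) * t\<bar> < 1"
    using t by (simp add: abs_mult)
  then have "\<bar>of_int (2 * n) * pi\<bar> < 1"
    unfolding n(2) .
  moreover have "1 \<le> \<bar>of_int (2 * n) * pi\<bar>" if "n \<noteq> 0"
  proof -
    have "1 * 1 \<le> \<bar>of_int (2 * n) :: real\<bar> * pi"
      using that pi_gt3 by (intro mult_mono) linarith+
    then show ?thesis
      by (simp add: abs_mult)
  qed
  ultimately have "n = 0"
    by fastforce
  then show ?thesis
    using n t(1) by (simp add: complex_eq_iff)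
qed

section \<open>Normality of the flow and the form of its gauge cocycles\<close>

context fock
begin

context
  fixes \<alpha> :: "real \<Rightarrow> ('h \<Rightarrow> 'h) \<Rightarrow> 'h \<Rightarrow> 'h"
  assumes flow: "clifford_flow W \<alpha>"
begin

lemma flow_product:
  "0 \<le> t \<Longrightarrow> fs \<in> lists L2_halfline \<Longrightarrow> \<alpha> t (clifford_product W fs) = clifford_product W (map (shift t) fs)"
  using flow by (simp add: clifford_flow_def)

lemma flow_normal: "0 \<le> t \<Longrightarrow> normal_unital_star_endomorphism (clifford_algebra W) (\<alpha> t)"
  using flow by (simp add: clifford_flow_def E0_semigroup_def)

text \<open>Let z be the remainder of \<open>\<alpha> s A (W [])\<close> after projection. Normality
  turns B \<mapsto> <z, \<alpha>_s(B) \<Omega>> into a normal functional; it vanishes on even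
  products, hence at \<open>A\<close> by the bicommutant argument. So z is orthogonal to the vector
  and to its projection, and is 0.\<close>

lemma flow_vacuum_in_closure:
  assumes A: "A \<in> even_clifford_algebra W" and s: "0 \<le> s"
  shows "\<alpha> s A (W []) \<in> closure (complex_vector.span
    ((\<lambda>fs. clifford_product W (map (shift s) fs) (W [])) ` {fs \<in> lists L2_halfline. even (length fs)}))"
    (is "_ \<in> closure (complex_vector.span ?S)")
proof -
  let ?V = "\<alpha> s A (W [])"
  obtain y where y: "y \<in> closure (complex_vector.span ?S)"
    "\<And>z. z \<in> closure (complex_vector.span ?S) \<Longrightarrow> cinner z (?V - y) = 0"
    using orthogonal_projection_exists[OF closure_span_subspace closed_closure] by blast
  define z where "z = ?V - y"
  define \<rho> where "\<rho> B = cinner z (B (W []))" for B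
  have "\<rho> \<in> predual (clifford_algebra W)"
  proof -
    let ?\<xi> = "\<lambda>i :: nat. if i = 0 then z else 0" and ?\<eta> = "\<lambda>i :: nat. if i = 0 then W [] else 0"
    have "summable (\<lambda>i. (norm (?\<xi> i))\<^sup>2)" "summable (\<lambda>i. (norm (?\<eta> i))\<^sup>2)"
      by (rule summable_finite[of "{0}"]; simp)+
    moreover have "(\<Sum>i. cinner (?\<xi> i) (B (?\<eta> i))) = \<rho> B" for B
      using suminf_finite[of "{0}" "\<lambda>i. cinner (?\<xi> i) (B (?\<eta> i))"] by (simp add: \<rho>_def)
    ultimately show ?thesis
      unfolding predual_def by (intro CollectI exI[of _ ?\<xi>] exI[of _ ?\<eta>]) simp
  qed
  then have "(\<lambda>B. \<rho> (\<alpha> s B)) \<in> predual (clifford_algebra W)"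
    using flow_normal[OF s] by (simp add: normal_unital_star_endomorphism_def)
  then obtain \<xi> \<eta> :: "nat \<Rightarrow> 'h" where sum: "summable (\<lambda>i. (norm (\<xi> i))\<^sup>2)" "summable (\<lambda>i. (norm (\<eta> i))\<^sup>2)"
    and \<rho>: "\<And>B. B \<in> clifford_algebra W \<Longrightarrow> \<rho> (\<alpha> s B) = (\<Sum>i. cinner (\<xi> i) (B (\<eta> i)))"
    by (auto simp: predual_def)
  have "(\<Sum>i. cinner (\<xi> i) (A (\<eta> i))) = 0"
  proof (rule normal_functional_vanishes_on_bicommutant[OF even_products_bounded _ _ _ _ sum])
    show "(\<lambda>x. x) \<in> even_products"
      using id_in_even_products by (simp add: id_def)
    show "(\<lambda>x. p (q x)) \<in> even_products" if p: "p \<in> even_products" and q: "q \<in> even_products" for p q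
    proof -
      obtain fs where "fs \<in> lists L2_halfline" "even (length fs)" "p = clifford_product W fs"
        using p by (rule even_productsE)
      moreover obtain gs where "gs \<in> lists L2_halfline" "even (length gs)" "q = clifford_product W gs"
        using q by (rule even_productsE)
      ultimately show ?thesis
        unfolding even_products_def by (intro image_eqI[of _ _ "fs @ gs"]) (simp_all add: clifford_product_append o_def)
    qed
    show "\<exists>q\<in>even_products. \<forall>x y. cinner (q x) y = cinner x (p y)" if p: "p \<in> even_products" for p
    proof -
      obtain fs where "fs \<in> lists L2_halfline" "even (length fs)" "p = clifford_product W fs"
        using p by (rule even_productsE)
      moreover from this have "clifford_product W (rev fs) \<in> even_products"
        unfolding even_products_def by (intro imageI) auto
      ultimately show ?thesis
        using clifford_product_rev_adjoint by blast
    qed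
    show "A \<in> commutant (commutant even_products)"
      using A by (simp add: even_clifford_algebra_eq)
    show "(\<Sum>i. cinner (\<xi> i) (p (\<eta> i))) = 0" if p: "p \<in> even_products" for p
    proof -
      obtain fs where fs: "fs \<in> lists L2_halfline" "even (length fs)" "p = clifford_product W fs"
        using p by (rule even_productsE)
      have "clifford_product W (map (shift s) fs) (W []) \<in> closure (complex_vector.span ?S)"
        by (rule subsetD[OF closure_subset], rule complex_vector.span_base, rule imageI) (use fs in simp)
      then have "cinner z (clifford_product W (map (shift s) fs) (W [])) = 0"
        by (subst cinner_commute) (simp add: z_def y(2))
      then have "\<rho> (\<alpha> s p) = 0"
        using fs s by (simp add: \<rho>_def flow_product)
      then show ?thesis
        using \<rho> p even_products_subset even_clifford_algebra_subset by fastforce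
    qed
  qed
  then have "cinner z ?V = 0"
    using \<rho>[OF subsetD[OF even_clifford_algebra_subset A]] by (simp add: \<rho>_def)
  moreover have "cinner z y = 0"
    by (subst cinner_commute) (simp add: z_def y)
  ultimately have "cinner z z = 0"
    using cinner_diff_right[of z ?V y] by (simp add: z_def[symmetric])
  then show ?thesis
    using y(1) by (simp add: z_def)
qed

context
  fixes U :: "real \<Rightarrow> 'h \<Rightarrow> 'h"
  assumes gauge: "U \<in> gauge_group (even_clifford_algebra W) (even_clifford_flow W \<alpha>)"
begin

lemma gauge_in_algebra: "0 \<le> t \<Longrightarrow> U t \<in> even_clifford_algebra W"
  using gauge by (auto simp: gauge_group_def)

lemma gauge_bounded: "0 \<le> t \<Longrightarrow> U t \<in> bounded_operators"
  using gauge_in_algebra commutant_bounded by (auto simp: even_clifford_algebra_eq)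

lemma gauge_cocycle: "0 \<le> s \<Longrightarrow> 0 \<le> t \<Longrightarrow> U s (\<alpha> s (U t) x) = U (s + t) x"
  using gauge gauge_in_algebra[of t]
  by (auto simp: gauge_group_def cocycles_def even_clifford_flow_def fun_eq_iff)

lemma gauge_commutes:
  assumes t: "0 \<le> t" and fs: "fs \<in> lists L2_halfline" "even (length fs)"
  shows "U t (clifford_product W (map (shift t) fs) x) = clifford_product W (map (shift t) fs) (U t x)"
proof -
  have p: "clifford_product W fs \<in> even_clifford_algebra W"
    using fs even_products_subset by (auto simp: even_products_def)
  then have "even_clifford_flow W \<alpha> t (clifford_product W fs) = clifford_product W (map (shift t) fs)"
    using flow_product[OF t fs(1)] by (simp add: even_clifford_flow_def)
  then have "clifford_product W (map (shift t) fs) \<in> even_clifford_flow W \<alpha> t ` even_clifford_algebra W"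
    using p by (metis imageI)
  moreover have "U t \<in> commutant (even_clifford_flow W \<alpha> t ` even_clifford_algebra W)"
    using gauge t by (auto simp: gauge_group_def)
  ultimately show ?thesis
    by (rule commutantD[rotated])
qed

lemma gauge_vacuum_annihilated:
  assumes t: "0 \<le> t" and f: "f \<in> L2_halfline"
  shows "annihilation_operator (shift t f) (U t (W [])) = 0"
  by (rule annihilation_shift_complex[OF relative_commutant_localized[OF gauge_in_algebra[OF t] t] t f])
    (rule gauge_commutes[OF t])

text \<open>For \<open>t \<le> s\<close> there are no particles after \<open>s\<close> at all. For
  \<open>s < t\<close> the cocycle identity is split at \<open>s\<close>, and evenness comes from
  the factor at time \<open>t - s\<close>.\<close>

lemma gauge_vacuum_sign_invariant:
  assumes s: "0 \<le> s" and t: "0 \<le> t"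
  shows "sign_change (sign_at s) (U t (W [])) = U t (W [])"
proof (cases "t \<le> s")
  case True
  show ?thesis
  proof (rule sign_change_localized[OF s])
    fix f :: "real \<Rightarrow> 'k \<times> 'k" assume f: "f \<in> L2_halfline"
    have "shift s f = shift t (shift (s - t) f)"
      using True by (auto simp: shift_def fun_eq_iff algebra_simps)
    then show "annihilation_operator (shift s f) (U t (W [])) = 0"
      using gauge_vacuum_annihilated[OF t L2_halfline_shift[OF f, of "s - t"]] True by simp
  qed
next
  case False
  then have ts: "0 \<le> t - s"
    by simp
  note sign = sign_at_measurable[of s] sign_at_square[of s]
  note Ub = gauge_bounded[OF s] and \<Gamma>b = sign_change_bounded[OF sign]
  let ?S = "(\<lambda>fs. clifford_product W (map (shift s) fs) (W [])) ` {fs \<in> lists L2_halfline. even (length fs)}"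
  have fixed: "sign_change (sign_at s) (U s (W [])) = U s (W [])"
    by (rule sign_change_localized[OF s gauge_vacuum_annihilated[OF s]])
  \<comment> \<open>This closed subspace contains p \<Omega> for every even product p of shifted
    generators, since p commutes both with \<open>U s\<close> and with the sign operator.\<close>
  let ?F = "{v. sign_change (sign_at s) (U s v) = U s v}"
  have "complex_vector.span ?S \<subseteq> ?F"
  proof (intro complex_vector.span_minimal complex_vector.subspaceI)
    show "?S \<subseteq> ?F"
    proof (rule image_subsetI)
      fix fs :: "(real \<Rightarrow> 'k) list" assume "fs \<in> {fs \<in> lists L2_halfline. even (length fs)}"
      then have fs: "fs \<in> lists L2_halfline" "even (length fs)"
        by blast+
      show "clifford_product W (map (shift s) fs) (W []) \<in> ?F"
        by (simp add: gauge_commutes[OF s fs] sign_change_clifford_product[OF fs(1) s fs(2)] fixed)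
    qed
  qed (simp_all add: bounded_operators_add[OF Ub] bounded_operators_add[OF \<Gamma>b] bounded_operators_scaleC[OF Ub]
      bounded_operators_scaleC[OF \<Gamma>b] bounded_operators_zero[OF Ub] bounded_operators_zero[OF \<Gamma>b])
  moreover have "closed ?F"
    by (intro closed_Collect_eq bounded_operators_continuous[OF bounded_operators_comp[OF \<Gamma>b Ub]]
        bounded_operators_continuous[OF Ub])
  ultimately have "closure (complex_vector.span ?S) \<subseteq> ?F"
    by (rule closure_minimal)
  then have "\<alpha> s (U (t - s)) (W []) \<in> ?F"
    using flow_vacuum_in_closure[OF gauge_in_algebra[OF ts] s] by blast
  then show ?thesis
    using gauge_cocycle[OF s ts] by simp
qed

lemma gauge_scalar:
  assumes t: "0 \<le> t"
  shows "U t x = cinner (W []) (U t (W [])) *\<^sub>C x"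
  by (rule even_clifford_algebra_scalar[OF gauge_in_algebra[OF t] annihilated_is_vacuum],
      rule sign_invariant_annihilated[OF gauge_vacuum_sign_invariant[OF _ t]])

text \<open>A unital linear \<open>\<alpha> s\<close> fixes scalars, so the cocycle identity reads
  p(s + t) = p(s) p(t); strong continuity at the vacuum makes p continuous.\<close>

lemma gauge_exponential:
  obtains \<mu> where "\<And>t x. 0 \<le> t \<Longrightarrow> U t x = exp (\<mu> * of_real t) *\<^sub>C x"
proof -
  define p where "p t = cinner (W []) (U t (W []))" for t
  have U: "U t = (\<lambda>x. p t *\<^sub>C x)" if "0 \<le> t" for t
    unfolding p_def by (rule ext) (rule gauge_scalar[OF that])
  have vac: "W [] \<noteq> 0"
    using cinner_vacuum by auto
  have id: "id \<in> clifford_algebra W"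
    using id_in_even_products even_products_subset even_clifford_algebra_subset by blast
  have \<alpha>: "\<alpha> s (U t) = U t" if "0 \<le> s" "0 \<le> t" for s t
  proof -
    have "\<alpha> s (\<lambda>x. p t *\<^sub>C id x) = (\<lambda>x. p t *\<^sub>C \<alpha> s id x)" "\<alpha> s id = id"
      using flow_normal[OF that(1)] id unfolding normal_unital_star_endomorphism_def by blast+
    then have "\<alpha> s (\<lambda>x. p t *\<^sub>C x) = (\<lambda>x. p t *\<^sub>C x)"
      by (simp only: id_apply)
    then show ?thesis
      by (simp only: U that)
  qed
  have mult: "p (s + t) = p s * p t" if "0 \<le> s" "0 \<le> t" for s t
  proof -
    have "U s (U t (W [])) = U (s + t) (W [])"
      using gauge_cocycle[OF that, of "W []"] by (simp only: \<alpha>[OF that])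
    then have "(p s * p t) *\<^sub>C W [] = p (s + t) *\<^sub>C W []"
      using that by (simp add: U scaleC_scaleC)
    then show ?thesis
      using vac by (simp add: complex_vector.scale_cancel_right)
  qed
  \<comment> \<open>Multiplicativity makes \<open>p 0\<close> idempotent; unitarity of
    \<open>U 0\<close> excludes the value 0.\<close>
  have "p 0 \<noteq> 0"
  proof
    assume "p 0 = 0"
    then have "U 0 x = 0" for x
      by (simp add: U)
    moreover have "hilbert_adjoint (U 0) \<circ> U 0 = id"
      using gauge by (auto simp: gauge_group_def cocycles_def unitary_operator_def)
    ultimately have "hilbert_adjoint (U 0) 0 = x" for x :: 'h
      by (metis comp_apply id_apply)
    from this[of "W []"] this[of 0] show False
      using vac by simp
  qed
  then have p0: "p 0 = 1"
    using mult[of 0 0] by simp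
  have "continuous_on {0..} p"
    using gauge unfolding p_def gauge_group_def cocycles_def by (auto intro!: continuous_intros)
  from continuous_multiplicative_is_exp[OF this p0 mult]
  obtain \<mu> where "\<And>t. 0 \<le> t \<Longrightarrow> p t = exp (\<mu> * of_real t)"
    by blast
  then show ?thesis
    using U by (intro that[of \<mu>]) simp
qed

end

text \<open>Both cocycles are scalar exponentials, so the covariance is a difference of exponents,
  one per cocycle; additive separation is what kills the form.\<close>

lemma gauge_covariance_split:
  obtains \<mu> where "\<And>U V. U \<in> gauge_group (even_clifford_algebra W) (even_clifford_flow W \<alpha>) \<Longrightarrow>
    V \<in> gauge_group (even_clifford_algebra W) (even_clifford_flow W \<alpha>) \<Longrightarrow>
    gauge_covariance (vacuum_trace W) U V = \<mu> V - \<mu> U"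
proof -
  let ?G = "gauge_group (even_clifford_algebra W) (even_clifford_flow W \<alpha>)"
  have "\<forall>U\<in>?G. \<exists>\<mu>. \<forall>t\<ge>0. \<forall>x. U t x = exp (\<mu> * of_real t) *\<^sub>C x"
    using gauge_exponential by metis
  then obtain \<mu> where \<mu>: "\<And>U t x. U \<in> ?G \<Longrightarrow> 0 \<le> t \<Longrightarrow> U t x = exp (\<mu> U * of_real t) *\<^sub>C x"
    by metis
  have "gauge_covariance (vacuum_trace W) U V = \<mu> V - \<mu> U" if U: "U \<in> ?G" and V: "V \<in> ?G" for U V
  proof -
    have trace: "vacuum_trace W (hilbert_adjoint (U t) \<circ> V t) = exp ((\<mu> V - \<mu> U) * of_real t)"
      if t: "0 \<le> t" for t
    proof -
      have "hilbert_adjoint (U t) \<circ> U t = id"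
        using U t by (auto simp: gauge_group_def cocycles_def unitary_operator_def)
      then have inv: "hilbert_adjoint (U t) (U t x) = x" for x
        by (metis comp_apply id_apply)
      \<comment> \<open>Written as \<open>U t\<close> of a multiple of the vacuum, so that
        \<open>hilbert_adjoint (U t)\<close> enters only as a left inverse.\<close>
      have "V t (W []) = U t (exp ((\<mu> V - \<mu> U) * of_real t) *\<^sub>C W [])"
        by (simp add: \<mu>[OF U t] \<mu>[OF V t] scaleC_scaleC algebra_simps flip: exp_add)
      then show ?thesis
        by (simp add: vacuum_trace_def inv cinner_scaleC_right cinner_vacuum)
    qed
    show ?thesis
      unfolding gauge_covariance_def
    proof (rule the_equality)
      fix c assume c: "\<forall>t\<ge>0. vacuum_trace W (hilbert_adjoint (U t) \<circ> V t) = exp (c * complex_of_real t)"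
      show "c = \<mu> V - \<mu> U"
        by (rule exp_linear_eq_imp_eq) (use c trace in metis)
    qed (use trace in blast)
  qed
  then show ?thesis
    by (rule that)
qed

end

end

section \<open>Vanishing of the gauge index\<close>

text \<open>Each of the two terms of \<open>c x y\<close> depends on one variable only; summing over
  the other one meets a function of sum zero.\<close>

lemma covariance_form_split_eq_0:
  assumes split: "\<And>x y. x \<in> G \<Longrightarrow> y \<in> G \<Longrightarrow> c x y = \<mu> y - \<mu> x"
    and f: "f \<in> sum_zero_functions G" and g: "g \<in> sum_zero_functions G"
  shows "covariance_form c f g = 0"
proof -
  let ?F = "{x. f x \<noteq> 0}" and ?K = "{x. g x \<noteq> 0}"
  have sum_f: "(\<Sum>x\<in>?F. cnj (f x)) = 0"
    using f by (simp add: sum_zero_functions_def flip: cnj_sum)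
  have sum_g: "(\<Sum>y\<in>?K. g y) = 0"
    using g by (simp add: sum_zero_functions_def)
  have "covariance_form c f g = (\<Sum>x\<in>?F. \<Sum>y\<in>?K. (\<mu> y - \<mu> x) * cnj (f x) * g y)"
    unfolding covariance_form_def using f g
    by (intro sum.cong refl) (auto simp: sum_zero_functions_def subset_iff split)
  also have "\<dots> = (\<Sum>x\<in>?F. cnj (f x) * (\<Sum>y\<in>?K. \<mu> y * g y) - \<mu> x * cnj (f x) * (\<Sum>y\<in>?K. g y))"
    unfolding sum_distrib_left sum_subtractf[symmetric] by (intro sum.cong refl) (simp add: algebra_simps)
  also have "\<dots> = (\<Sum>x\<in>?F. cnj (f x)) * (\<Sum>y\<in>?K. \<mu> y * g y)"
    by (simp add: sum_g sum_distrib_right)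
  finally show ?thesis
    by (simp add: sum_f)
qed

lemma sum_zero_functions_diff:
  assumes f: "f \<in> sum_zero_functions G" and g: "g \<in> sum_zero_functions G"
  shows "f - g \<in> sum_zero_functions G"
proof -
  let ?D = "{x. f x \<noteq> 0} \<union> {x. g x \<noteq> 0}"
  have D: "finite ?D" "{x. (f - g) x \<noteq> 0} \<subseteq> ?D"
    using f g by (auto simp: sum_zero_functions_def)
  have "(\<Sum>x\<in>?D. f x) = (\<Sum>x | f x \<noteq> 0. f x)" "(\<Sum>x\<in>?D. g x) = (\<Sum>x | g x \<noteq> 0. g x)"
    "(\<Sum>x\<in>?D. (f - g) x) = (\<Sum>x | (f - g) x \<noteq> 0. (f - g) x)"
    by (intro sum.mono_neutral_right; use D in auto)+
  then have "(\<Sum>x | (f - g) x \<noteq> 0. (f - g) x) = 0"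
    using f g by (simp add: sum_zero_functions_def sum_subtractf)
  then show ?thesis
    using D finite_subset[OF D(2) D(1)] f g unfolding sum_zero_functions_def by blast
qed

text \<open>Every vector of the completion has inner product 0 with itself, so no nonempty set is
  orthonormal and the empty set is the only orthonormal basis.\<close>

lemma hilbert_dim_form_completion_zero:
  fixes b :: "'v::minus \<Rightarrow> 'v \<Rightarrow> complex"
  assumes zero: "\<And>f g. f \<in> V \<Longrightarrow> g \<in> V \<Longrightarrow> b f g = 0"
    and diff: "\<And>f g. f \<in> V \<Longrightarrow> g \<in> V \<Longrightarrow> f - g \<in> V"
  shows "hilbert_dim (form_completion V b) (completion_inner b) = 0"
proof -
  have inner_zero: "completion_inner b \<xi> \<xi> = 0" if \<xi>: "\<xi> \<in> form_completion V b" for \<xi>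
  proof -
    let ?r = "{(X, Y). X \<in> form_cauchy V b \<and> Y \<in> form_cauchy V b \<and> (\<lambda>m. form_seminorm b (X m - Y m)) \<longlonglongrightarrow> 0}"
    obtain X where X: "X \<in> form_cauchy V b" "\<xi> = ?r `` {X}"
      using \<xi> by (auto simp: form_completion_def elim: quotientE)
    have tendsto: "(\<lambda>m. b (Y m) (Z m)) \<longlonglongrightarrow> 0" if "Y \<in> \<xi>" "Z \<in> \<xi>" for Y Z
    proof -
      have "Y m \<in> V" "Z m \<in> V" for m
        using that X(2) by (auto simp: form_cauchy_def)
      then show ?thesis
        by (simp add: zero)
    qed
    have "X m \<in> V" for m
      using X(1) by (auto simp: form_cauchy_def)
    then have "form_seminorm b (X m - X m) = 0" for m
      by (simp add: form_seminorm_def zero diff)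
    \<comment> \<open>A class must be nonempty for its inner product to be determined: over an empty
      class every value would satisfy the description.\<close>
    then have "X \<in> \<xi>"
      using X by simp
    show ?thesis
      unfolding completion_inner_def
    proof (rule the_equality)
      fix z assume "\<forall>X\<in>\<xi>. \<forall>Y\<in>\<xi>. (\<lambda>m. b (X m) (Y m)) \<longlonglongrightarrow> z"
      then show "z = 0"
        using LIMSEQ_unique tendsto \<open>X \<in> \<xi>\<close> by blast
    qed (use tendsto in blast)
  qed
  have basis: "orthonormal_basis (form_completion V b) (completion_inner b) S \<longleftrightarrow> S = {}" for S
  proof -
    have "S' = {}" if "S' \<subseteq> form_completion V b" "orthonormal (completion_inner b) S'" for S'
      using that inner_zero unfolding orthonormal_def by (metis equals0I subsetD zero_neq_one)
    moreover have "orthonormal (completion_inner b) {}"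
      by (simp add: orthonormal_def)
    ultimately show ?thesis
      unfolding orthonormal_basis_def by blast
  qed
  show ?thesis
    unfolding hilbert_dim_def basis by (simp add: zero_enat_def)
qed

theorem proposition7p7:
  fixes W :: "(real \<Rightarrow> 'k::{real_inner, complete_space, second_countable_topology} \<times> 'k) list
                \<Rightarrow> 'h::complex_hilbert_space"
    and \<alpha> :: "real \<Rightarrow> ('h \<Rightarrow> 'h) \<Rightarrow> 'h \<Rightarrow> 'h"
    and n :: enat
  assumes "1 \<le> n"
    and "hilbert_dim (UNIV :: 'k set) inner = n"
    and "antisymmetric_fock_space W"
    and "clifford_flow W \<alpha>"
  shows "gauge_index (even_clifford_algebra W) (vacuum_trace W) (even_clifford_flow W \<alpha>) = 0"
proof -
  interpret fock W
    by unfold_locales (rule assms(3))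
  obtain \<mu> where \<mu>: "\<And>U V. U \<in> gauge_group (even_clifford_algebra W) (even_clifford_flow W \<alpha>) \<Longrightarrow>
    V \<in> gauge_group (even_clifford_algebra W) (even_clifford_flow W \<alpha>) \<Longrightarrow>
    gauge_covariance (vacuum_trace W) U V = \<mu> V - \<mu> U"
    using gauge_covariance_split[OF assms(4)] by blast
  show ?thesis
    unfolding gauge_index_def Let_def
    by (rule hilbert_dim_form_completion_zero[OF covariance_form_split_eq_0[OF \<mu>] sum_zero_functions_diff])
qed

end
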